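(* Let $d\in\{2,3\}$ and let the mesh consist of triangular ($d=2$) or tetrahedral ($d=3$) elements, quasi-uniform and watertight, whose exact scaled normals satisfy $\boldsymbol nJ^k_f=-\boldsymbol n^+J^{k,+}_f$ on shared faces and $\sum_jG^k_{ij}\hat n_j\hat J_f=n_iJ^k_f$. Let the interpolation points defining the polynomial interpolation operators be distributed such that, for the degree $N$ operator, $N^f_p$ points lie on each face (and analogously for degree $N+1$). Let $\tilde G^k_{ij}$ be the approximate geometric terms, given for $d=3$ by $$\begin{bmatrix}\tilde G^k_{1i}\\ \tilde G^k_{2i}\\ \tilde G^k_{3i}\end{bmatrix}=\begin{bmatrix}I_N\left(-\hat\nabla\times I_{N+1}(x_3\hat\nabla x_2)\right)_i\\ I_N\left(\hat\nabla\times I_{N+1}(x_3\hat\nabla x_1)\right)_i\\ I_N\left(\hat\nabla\times I_{N+1}(x_1\hat\nabla x_2)\right)_i\end{bmatrix},\qquad i=1,2,3,$$ and for $d=2$ by the exact terms $\tilde G^k_{ij}=G^k_{ij}$, and let the approximate scaled normals be defined by $\widetilde{n_iJ^k_f}=\sum_{j=1}^d\tilde G^k_{ij}\hat n_j\hat J_f$. Then: (i) the discrete geometric conservation law holds: $\sum_{j=1}^d\boldsymbol D^j_N\tilde{\boldsymbol G}^k_{ij}=0$ for every $i$ and every element $D^k$, where $\tilde{\boldsymbol G}^k_{ij}$ is the vector of values of $\tilde G^k_{ij}$ at volume and surface quadrature points; (ii) the approximate scaled normals are consistent: at surface quadrature points $\sum_j(\tilde{\boldsymbol G}^k_{ij})_f\circ(\hat{\boldsymbol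 n}_j\circ\hat{\boldsymbol J}_f)$ equals the vector of values of $\widetilde{n_iJ^k_f}$, and on every face shared by $D^k$ and $D^{k,+}$ the approximate scaled outward normals are equal and opposite at all points, $\widetilde{\boldsymbol nJ^k_f}=-\widetilde{\boldsymbol n^+J^{k,+}_f}$; (iii) there is a constant $C_N$ independent of the mesh size $h$ such that $$\left\|G^k_{ij}-\tilde G^k_{ij}\right\|_{L^2(\Omega)}^2\le C_N|\Omega|\,h^{2(N+2)}\sum_{i=1}^d\sum_k\|\boldsymbol r_i\|^2_{W^{N+2,2}(D^k)},$$ where, for $d=3$, $\boldsymbol r_1=x_3\hat\nabla x_2$, $\boldsymbol r_2=x_3\hat\nabla x_1$, $\boldsymbol r_3=x_1\hat\nabla x_2$ (for $d=2$ the left side is zero).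
   Context: The domain $\Omega\subset\mathbb R^d$ is decomposed into elements $D^k=\boldsymbol\Phi_k(\hat D)$, $\hat D$ the reference simplex with coordinates $\hat x_1,\dots,\hat x_d$, $\boldsymbol x=\boldsymbol\Phi_k(\hat{\boldsymbol x})$ an invertible isoparametric (degree $N$ polynomial) mapping with Jacobian determinant $J^k>0$; $h$ is the mesh size. The exact geometric terms are $G^k_{ij}=J^k\,\partial\hat x_j/\partial x_i$. $\hat\nabla$ denotes derivatives in reference coordinates, and the subscript $i$ of a vector its $i$th component. $\|G^k_{ij}-\tilde G^k_{ij}\|_{L^2(\Omega)}^2$ is the sum over $k$ of the squared $L^2(D^k)$ norms. Functions on $\hat D$ are regarded as functions on $D^k$ via $\boldsymbol\Phi_k$, and $W^{s,2}(D^k)$ is the usual Sobolev norm. $P^N(\hat D)$ is the space of polynomials of total degree at most $N$, of dimension $N_p$; $N^f_p$ is the dimension of the trace space of $P^N(\hat D)$ on a face. $I_N$ is the degree $N$ polynomial interpolation operator on $\hat D$ (acting componentwise on vector fields) at a unisolvent set of $N_p$ points; $I_{N+1}$ is the analogous degree $N+1$ operator. "Watertight" means that across a shared face the two element mappings agree on the face, and the interpolation nodes and surface quadrature points of the two elements on the shared face coincide. $n_i$ and $J^k_f$ are the $i$th component of the outward unit normal and the face Jacobian factor of $D^k$; a superscript $+$ denotes quantities on the neighboring element $D^{k,+}$; $\hat n_j$ are the components of the (facewise constant) outward unit normal on $\partial\hat D$ and $\hat J_f$ the Jacobian factor from mapping a face of $\hat D$ to the reference face; $\hat{\boldsymbol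 n}_j,\hat{\boldsymbol J}_f$ are the vectors of their values at surface quadrature points, and $\circ$ is the entrywise product. $(\cdot)_f$ denotes the surface-point part of a vector. Matrices: given a basis $\phi_1,\dots,\phi_{N_p}$ of $P^N(\hat D)$ and volume and surface quadratures on $\hat D$, $\partial\hat D$ with positive weights (the surface weights being those on reference faces), let $\boldsymbol W,\boldsymbol W_f$ be the diagonal weight matrices, $(\boldsymbol V_q)_{ij}=\phi_j(\hat{\boldsymbol x}_i)$ and $(\boldsymbol V_f)_{ij}=\phi_j(\hat{\boldsymbol x}^f_i)$ the evaluation matrices at volume and surface points, $\boldsymbol D_i$ the matrix mapping coefficients of $u\in P^N(\hat D)$ to coefficients of $\partial u/\partial\hat x_i$, $\boldsymbol M=\boldsymbol V_q^T\boldsymbol W\boldsymbol V_q$ (positive definite), $\boldsymbol P_q=\boldsymbol M^{-1}\boldsymbol V_q^T\boldsymbol W$, $\boldsymbol L_q=\boldsymbol M^{-1}\boldsymbol V_f^T\boldsymbol W_f$, and $$\boldsymbol D_N^i=\begin{bmatrix}\boldsymbol V_q\boldsymbol D_i\boldsymbol P_q-\tfrac12\boldsymbol V_q\boldsymbol L_q\,\mathrm{diag}(\hat{\boldsymbol n}_i\circ\hat{\boldsymbol J}_f)\boldsymbol V_f\boldsymbol P_q&\tfrac12\boldsymbol V_q\boldsymbol L_q\,\mathrm{diag}(\hat{\boldsymbol n}_i\circ\hat{\boldsymbol J}_f)\\-\tfrac12\mathrm{diag}(\hat{\boldsymbol n}_i\circ\hat{\boldsymbol J}_f)\boldsymbol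 V_f\boldsymbol P_q&\tfrac12\mathrm{diag}(\hat{\boldsymbol n}_i\circ\hat{\boldsymbol J}_f)\end{bmatrix}.$$ The volume quadrature is exact for degree $2N-1$ polynomials and integration by parts for $u,v\in P^N(\hat D)$ holds under the quadratures. *)

theory Defs
  imports "HOL-Analysis.Analysis" "HOL-Library.Function_Algebras"
begin

section \<open>Polynomial spaces and partial derivatives\<close>

interpretation fs: vector_space "\<lambda>(c::real) (f::'a \<Rightarrow> real) x. c * f x"
  by unfold_locales (auto simp: fun_eq_iff algebra_simps)

text \<open>Polynomials of total degree at most \<open>N\<close>, as functions on the whole space. Since the
  reference simplex has nonempty interior, this is the space \<open>P^N\<close> of the reference simplex.\<close>

definition poly_space :: "nat \<Rightarrow> (real^'n \<Rightarrow> real) set" where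
  "poly_space N = fs.span {(\<lambda>x. \<Prod>i\<in>UNIV. x $ i ^ \<alpha> i) | \<alpha>. (\<Sum>i\<in>UNIV. \<alpha> i) \<le> N}"

definition partial :: "'n \<Rightarrow> (real^'n \<Rightarrow> real) \<Rightarrow> real^'n \<Rightarrow> real" where
  "partial i f x = frechet_derivative f (at x) (axis i 1)"

primrec partials :: "'n list \<Rightarrow> (real^'n \<Rightarrow> real) \<Rightarrow> real^'n \<Rightarrow> real" where
  "partials [] f = f"
| "partials (i # is) f = partial i (partials is f)"

text \<open>Multi-index derivative; the order of differentiation is fixed by the order on the index
  type (it is immaterial for the smooth functions it is applied to).\<close>

definition multi_partial ::
  "('n \<Rightarrow> nat) \<Rightarrow> (real^('n::{finite,linorder}) \<Rightarrow> real)
    \<Rightarrow> real^('n::{finite,linorder}) \<Rightarrow> real" where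
  "multi_partial \<alpha> = partials (concat (map (\<lambda>i. replicate (\<alpha> i) i) (sorted_list_of_set UNIV)))"

definition grad :: "(real^'n \<Rightarrow> real) \<Rightarrow> real^'n \<Rightarrow> real^'n" where
  "grad f x = (\<chi> i. partial i f x)"

definition curl :: "(real^3 \<Rightarrow> real^3) \<Rightarrow> real^3 \<Rightarrow> real^3" where
  "curl v x = vector
     [partial 2 (\<lambda>y. v y $ 3) x - partial 3 (\<lambda>y. v y $ 2) x,
      partial 3 (\<lambda>y. v y $ 1) x - partial 1 (\<lambda>y. v y $ 3) x,
      partial 1 (\<lambda>y. v y $ 2) x - partial 2 (\<lambda>y. v y $ 1) x]"

section \<open>The reference simplex\<close>

text \<open>Vertices, and likewise faces, are indexed by \<^typ>\<open>'n option\<close>: \<open>None\<close> is the origin,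
  \<open>Some i\<close> the \<open>i\<close>th unit vector, and face \<open>f\<close> is the one opposite to vertex \<open>f\<close>.\<close>

definition vertex :: "'n option \<Rightarrow> real^'n" where
  "vertex v = (case v of None \<Rightarrow> 0 | Some i \<Rightarrow> axis i 1)"

definition ref_simplex :: "(real^'n) set" where
  "ref_simplex = convex hull (range vertex)"

definition face :: "'n option \<Rightarrow> (real^'n) set" where
  "face f = convex hull (vertex ` (- {f}))"

definition ref_normal :: "'n option \<Rightarrow> real^'n" where
  "ref_normal f = (case f of None \<Rightarrow> (\<chi> i. 1 / sqrt (real CARD('n))) | Some i \<Rightarrow> - axis i 1)"

text \<open>Area of a face relative to the area of the reference face, which is the unit simplex of
  one dimension less. Hence \<open>ref_normal f\<close> times this factor is the all-ones vector for the
  slanted face and minus a unit vector for the others.\<close>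

definition ref_face_jac :: "'n::finite option \<Rightarrow> 'n itself \<Rightarrow> real" where
  "ref_face_jac f _ = (case f of None \<Rightarrow> sqrt (real CARD('n)) | Some i \<Rightarrow> 1)"

definition ref_scaled_normal :: "'n::finite option \<Rightarrow> 'n \<Rightarrow> real" where
  "ref_scaled_normal f j = ref_normal f $ j * ref_face_jac f TYPE('n)"

section \<open>Interpolation\<close>

definition unisolvent :: "nat \<Rightarrow> (real^'n) set \<Rightarrow> bool" where
  "unisolvent N X \<longleftrightarrow> finite X \<and> X \<subseteq> ref_simplex \<and> card X = fs.dim (poly_space N :: (real^'n \<Rightarrow> real) set)
     \<and> (\<forall>g. \<exists>!p. p \<in> poly_space N \<and> (\<forall>x\<in>X. p x = g x))"

definition interp :: "nat \<Rightarrow> (real^'n) set \<Rightarrow> (real^'n \<Rightarrow> real) \<Rightarrow> real^'n \<Rightarrow> real" where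
  "interp N X g = (THE p. p \<in> poly_space N \<and> (\<forall>x\<in>X. p x = g x))"

definition interp_vec :: "nat \<Rightarrow> (real^'n) set \<Rightarrow> (real^'n \<Rightarrow> real^'m) \<Rightarrow> real^'n \<Rightarrow> real^'m" where
  "interp_vec N X v x = (\<chi> i. interp N X (\<lambda>y. v y $ i) x)"

text \<open>Dimension of the trace space of \<open>P^N\<close> on a face; traces are extended by zero off the face.\<close>

definition trace_dim :: "nat \<Rightarrow> 'n::finite option \<Rightarrow> 'n itself \<Rightarrow> nat" where
  "trace_dim N f _ =
     fs.dim ((\<lambda>p x. if x \<in> face f then p x else 0) ` (poly_space N :: (real^'n \<Rightarrow> real) set))"

definition interpolation_nodes :: "nat \<Rightarrow> (real^'n) set \<Rightarrow> bool" where
  "interpolation_nodes N X \<longleftrightarrow>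
     unisolvent N X \<and> (\<forall>f. card (X \<inter> face f) = trace_dim N f TYPE('n))"

section \<open>Quadrature and difference matrices\<close>

text \<open>The finite types \<open>'p\<close>, \<open>'q\<close>, \<open>'s\<close> index the basis, the volume points and the surface
  points; \<open>fc s\<close> is the face to which the surface point \<open>xf s\<close> belongs.\<close>

definition poly_basis :: "nat \<Rightarrow> ('p::finite \<Rightarrow> real^'n \<Rightarrow> real) \<Rightarrow> bool" where
  "poly_basis N \<phi> \<longleftrightarrow>
     inj \<phi> \<and> fs.independent (range \<phi>) \<and> fs.span (range \<phi>) = poly_space N"

definition reference_quadrature ::
  "nat \<Rightarrow> ('q::finite \<Rightarrow> real^'n) \<Rightarrow> ('q \<Rightarrow> real) \<Rightarrow> ('s::finite \<Rightarrow> 'n option) \<Rightarrow> ('s \<Rightarrow> real^'n)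
    \<Rightarrow> ('s \<Rightarrow> real) \<Rightarrow> bool" where
  "reference_quadrature N xq wq fc xf ws \<longleftrightarrow>
     (\<forall>a. xq a \<in> ref_simplex \<and> 0 < wq a) \<and> (\<forall>s. xf s \<in> face (fc s) \<and> 0 < ws s) \<and>
     (\<forall>p \<in> poly_space (2 * N - 1). (\<Sum>a\<in>UNIV. wq a * p (xq a)) = (LINT x:ref_simplex|lebesgue. p x)) \<and>
     (\<forall>u \<in> poly_space N. \<forall>v \<in> poly_space N. \<forall>i.
        (\<Sum>a\<in>UNIV. wq a * (partial i u (xq a) * v (xq a))) =
        (\<Sum>s\<in>UNIV. ws s * (u (xf s) * v (xf s) * ref_scaled_normal (fc s) i))
        - (\<Sum>a\<in>UNIV. wq a * (u (xq a) * partial i v (xq a))))"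

definition diag_mat :: "real^'a \<Rightarrow> real^'a^'a" where
  "diag_mat v = (\<chi> a b. if a = b then v $ a else 0)"

definition eval_mat :: "('p \<Rightarrow> real^'n \<Rightarrow> real) \<Rightarrow> ('a \<Rightarrow> real^'n) \<Rightarrow> real^'p^'a" where
  "eval_mat \<phi> pts = (\<chi> a b. \<phi> b (pts a))"

definition diff_mat :: "('p::finite \<Rightarrow> real^'n \<Rightarrow> real) \<Rightarrow> 'n \<Rightarrow> real^'p^'p" where
  "diff_mat \<phi> i = (\<chi> a b. fs.representation (range \<phi>) (partial i (\<phi> b)) (\<phi> a))"

definition mass_mat ::
  "('p::finite \<Rightarrow> real^'n \<Rightarrow> real) \<Rightarrow> ('q::finite \<Rightarrow> real^'n) \<Rightarrow> ('q \<Rightarrow> real) \<Rightarrow> real^'p^'p" where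
  "mass_mat \<phi> xq wq = transpose (eval_mat \<phi> xq) ** diag_mat (\<chi> a. wq a) ** eval_mat \<phi> xq"

definition pos_def :: "real^'p^'p \<Rightarrow> bool" where
  "pos_def A \<longleftrightarrow> transpose A = A \<and> (\<forall>c. c \<noteq> 0 \<longrightarrow> 0 < c \<bullet> (A *v c))"

definition proj_mat ::
  "('p::finite \<Rightarrow> real^'n \<Rightarrow> real) \<Rightarrow> ('q::finite \<Rightarrow> real^'n) \<Rightarrow> ('q \<Rightarrow> real) \<Rightarrow> real^'q^'p" where
  "proj_mat \<phi> xq wq =
     matrix_inv (mass_mat \<phi> xq wq) ** transpose (eval_mat \<phi> xq) ** diag_mat (\<chi> a. wq a)"

definition lift_mat ::
  "('p::finite \<Rightarrow> real^'n \<Rightarrow> real) \<Rightarrow> ('q::finite \<Rightarrow> real^'n) \<Rightarrow> ('q \<Rightarrow> real) \<Rightarrow>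
   ('s::finite \<Rightarrow> real^'n) \<Rightarrow> ('s \<Rightarrow> real) \<Rightarrow> real^'s^'p" where
  "lift_mat \<phi> xq wq xf ws =
     matrix_inv (mass_mat \<phi> xq wq) ** transpose (eval_mat \<phi> xf) ** diag_mat (\<chi> s. ws s)"

definition block_mat ::
  "real^'q^'q \<Rightarrow> real^'s^'q \<Rightarrow> real^'q^'s \<Rightarrow> real^'s^'s \<Rightarrow> real^('q + 's)^('q + 's)" where
  "block_mat A B C D = (\<chi> r c. case r of
      Inl a \<Rightarrow> (case c of Inl b \<Rightarrow> A $ a $ b | Inr t \<Rightarrow> B $ a $ t)
    | Inr s \<Rightarrow> (case c of Inl b \<Rightarrow> C $ s $ b | Inr t \<Rightarrow> D $ s $ t))"

text \<open>The entrywise product of the vectors of values of the reference normal component and the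
  reference face factor; \<open>*\<close> on \<^typ>\<open>real^'s\<close> is entrywise.\<close>

definition surf_normal_vec :: "('s \<Rightarrow> 'n::finite option) \<Rightarrow> 'n \<Rightarrow> real^'s" where
  "surf_normal_vec fc i =
     (\<chi> s. ref_normal (fc s) $ i) * (\<chi> s. ref_face_jac (fc s) TYPE('n))"

definition decoupled_op ::
  "('p::finite \<Rightarrow> real^'n \<Rightarrow> real) \<Rightarrow> ('q::finite \<Rightarrow> real^'n) \<Rightarrow> ('q \<Rightarrow> real) \<Rightarrow>
   ('s::finite \<Rightarrow> 'n option) \<Rightarrow> ('s \<Rightarrow> real^'n) \<Rightarrow> ('s \<Rightarrow> real) \<Rightarrow> 'n \<Rightarrow> real^('q + 's)^('q + 's)" where
  "decoupled_op \<phi> xq wq fc xf ws i =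
     (let Vq = eval_mat \<phi> xq; Vf = eval_mat \<phi> xf; Pq = proj_mat \<phi> xq wq;
          Lq = lift_mat \<phi> xq wq xf ws; Nf = diag_mat (surf_normal_vec fc i)
      in block_mat
           (Vq ** diff_mat \<phi> i ** Pq - (1/2) *\<^sub>R (Vq ** Lq ** Nf ** Vf ** Pq))
           ((1/2) *\<^sub>R (Vq ** Lq ** Nf))
           (- ((1/2) *\<^sub>R (Nf ** Vf ** Pq)))
           ((1/2) *\<^sub>R Nf))"

definition point_values ::
  "('q::finite \<Rightarrow> real^'n) \<Rightarrow> ('s::finite \<Rightarrow> real^'n) \<Rightarrow> (real^'n \<Rightarrow> real) \<Rightarrow> real^('q + 's)" where
  "point_values xq xf g = (\<chi> r. case r of Inl a \<Rightarrow> g (xq a) | Inr s \<Rightarrow> g (xf s))"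

definition surf_part :: "real^('q::finite + 's::finite) \<Rightarrow> real^'s::finite" where
  "surf_part v = (\<chi> s. v $ Inr s)"

section \<open>Meshes\<close>

text \<open>A mesh is given by its number \<open>K\<close> of elements and the mappings \<open>\<Phi> k\<close>, \<open>k < K\<close>. All
  geometric quantities are functions of the reference coordinates.\<close>

definition elem :: "(real^'n \<Rightarrow> real^'n) \<Rightarrow> (real^'n) set" where
  "elem \<Phi> = \<Phi> ` ref_simplex"

definition jac_det :: "(real^'n \<Rightarrow> real^'n) \<Rightarrow> real^'n \<Rightarrow> real" where
  "jac_det \<Phi> x = det (jacobian \<Phi> (at x))"

text \<open>Entry \<open>(j, i)\<close> of the inverse Jacobian matrix is the derivative of the \<open>j\<close>th reference
  coordinate with respect to the \<open>i\<close>th physical coordinate.\<close>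

definition geo :: "(real^'n \<Rightarrow> real^'n) \<Rightarrow> 'n \<Rightarrow> 'n \<Rightarrow> real^'n \<Rightarrow> real" where
  "geo \<Phi> i j x = jac_det \<Phi> x * matrix_inv (jacobian \<Phi> (at x)) $ j $ i"

definition mesh_size :: "nat \<Rightarrow> (nat \<Rightarrow> real^'n \<Rightarrow> real^'n) \<Rightarrow> real" where
  "mesh_size K \<Phi> = Max ((\<lambda>k. diameter (elem (\<Phi> k))) ` {..<K})"

definition isoparametric_mesh ::
  "nat \<Rightarrow> (real^'n) set \<Rightarrow> nat \<Rightarrow> (nat \<Rightarrow> real^'n \<Rightarrow> real^'n) \<Rightarrow> bool" where
  "isoparametric_mesh N \<Omega> K \<Phi> \<longleftrightarrow>
     (\<forall>k<K. (\<forall>i. (\<lambda>x. \<Phi> k x $ i) \<in> poly_space N) \<and> inj_on (\<Phi> k) ref_simplex \<and>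
            (\<forall>x\<in>ref_simplex. 0 < jac_det (\<Phi> k) x)) \<and>
     closure \<Omega> = (\<Union>k<K. elem (\<Phi> k)) \<and>
     (\<forall>k<K. \<forall>l<K. k \<noteq> l \<longrightarrow> interior (elem (\<Phi> k)) \<inter> interior (elem (\<Phi> l)) = {})"

text \<open>Quasi-uniformity with constant \<open>\<sigma>\<close>, in the sense of regular isoparametric families: all
  elements have size comparable to \<open>h\<close>, and derivatives of order \<open>m\<close> of the mappings scale
  as \<open>h ^ m\<close>. For affine mappings only \<open>m = 1\<close> matters and this is the usual condition that
  all inscribed balls have radius at least a fixed multiple of \<open>h\<close>.\<close>

definition quasi_uniform :: "real \<Rightarrow> nat \<Rightarrow> (nat \<Rightarrow> real^'n \<Rightarrow> real^'n) \<Rightarrow> bool" where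
  "quasi_uniform \<sigma> K \<Phi> \<longleftrightarrow>
     (\<forall>k<K. \<forall>x\<in>ref_simplex.
        mesh_size K \<Phi> ^ CARD('n) \<le> \<sigma> * jac_det (\<Phi> k) x \<and>
        (\<forall>is i. is \<noteq> [] \<longrightarrow>
           \<bar>partials is (\<lambda>y. \<Phi> k y $ i) x\<bar> \<le> \<sigma> * mesh_size K \<Phi> ^ length is))"

definition shared_face ::
  "nat \<Rightarrow> (nat \<Rightarrow> real^'n \<Rightarrow> real^'n) \<Rightarrow> nat \<Rightarrow> 'n option \<Rightarrow> nat \<Rightarrow> 'n option \<Rightarrow> bool" where
  "shared_face K \<Phi> k f l g \<longleftrightarrow> k < K \<and> l < K \<and> k \<noteq> l \<and> \<Phi> k ` face f = \<Phi> l ` face g"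

text \<open>The two mappings agree on a shared face up to a matching \<open>\<pi>\<close> of the vertices of the
  reference simplex, i.e. as functions of barycentric coordinates on the face. The nodes
  \<open>X\<close>, \<open>X'\<close> (degrees \<open>N\<close> and \<open>N + 1\<close>) and surface points coincide in physical space.\<close>

definition watertight ::
  "(real^'n) set \<Rightarrow> (real^'n) set \<Rightarrow> ('s \<Rightarrow> 'n option) \<Rightarrow> ('s \<Rightarrow> real^'n) \<Rightarrow>
   nat \<Rightarrow> (nat \<Rightarrow> real^'n \<Rightarrow> real^'n) \<Rightarrow> bool" where
  "watertight X X' fc xf K \<Phi> \<longleftrightarrow>
     (\<forall>k f l g. shared_face K \<Phi> k f l g \<longrightarrow>
        (\<exists>\<pi>. bij \<pi> \<and> \<pi> f = g \<and>
           (\<forall>b. (\<forall>v. 0 \<le> b v) \<and> b f = 0 \<and> (\<Sum>v\<in>UNIV. b v) = 1 \<longrightarrow>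
              \<Phi> k (\<Sum>v\<in>UNIV. b v *\<^sub>R vertex v) = \<Phi> l (\<Sum>v\<in>UNIV. b v *\<^sub>R vertex (\<pi> v)))) \<and>
        \<Phi> k ` (X \<inter> face f) = \<Phi> l ` (X \<inter> face g) \<and>
        \<Phi> k ` (X' \<inter> face f) = \<Phi> l ` (X' \<inter> face g) \<and>
        \<Phi> k ` (xf ` {s. fc s = f}) = \<Phi> l ` (xf ` {s. fc s = g}))"

definition face_normal :: "(real^'n \<Rightarrow> real^'n) \<Rightarrow> 'n option \<Rightarrow> real^'n \<Rightarrow> real^'n" where
  "face_normal \<Phi> f x = (THE n. norm n = 1 \<and>
     (\<forall>t. t \<bullet> ref_normal f = 0 \<longrightarrow> n \<bullet> (jacobian \<Phi> (at x) *v t) = 0) \<and>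
     0 < n \<bullet> (jacobian \<Phi> (at x) *v ref_normal f))"

text \<open>Area scaling factor of the map from the reference face to the physical face. The reference
  face is mapped affinely onto \<open>face f\<close> with edge vectors \<open>e_j\<close>, \<open>j \<noteq> i\<close>, if \<open>f = Some i\<close>,
  and \<open>e_j - e_i\<close>, \<open>j \<noteq> i\<close>, with any fixed \<open>i\<close>, if \<open>f = None\<close>. The area spanned by the
  images of the edge vectors equals the volume spanned by them and the unit normal, which
  occupies row \<open>i\<close>.\<close>

definition face_jac :: "(real^'n \<Rightarrow> real^'n) \<Rightarrow> 'n option \<Rightarrow> real^'n \<Rightarrow> real" where
  "face_jac \<Phi> f x =
     (let i = (case f of None \<Rightarrow> (SOME i. True) | Some i \<Rightarrow> i);
          base = (case f of None \<Rightarrow> axis i 1 | Some i \<Rightarrow> 0)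
      in \<bar>det ((\<chi> j. if j = i then face_normal \<Phi> f x
                     else jacobian \<Phi> (at x) *v (axis j 1 - base)) :: real^'n^'n)\<bar>)"

definition exact_scaled_normals :: "nat \<Rightarrow> (nat \<Rightarrow> real^'n \<Rightarrow> real^'n) \<Rightarrow> bool" where
  "exact_scaled_normals K \<Phi> \<longleftrightarrow>
     (\<forall>k<K. \<forall>f. \<forall>x\<in>face f. \<forall>i.
        (\<Sum>j\<in>UNIV. geo (\<Phi> k) i j x * ref_normal f $ j * ref_face_jac f TYPE('n)) =
        face_normal (\<Phi> k) f x $ i * face_jac (\<Phi> k) f x) \<and>
     (\<forall>k f l g. shared_face K \<Phi> k f l g \<longrightarrow>
        (\<forall>x\<in>face f. \<forall>y\<in>face g. \<Phi> k x = \<Phi> l y \<longrightarrow>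
           face_jac (\<Phi> k) f x *\<^sub>R face_normal (\<Phi> k) f x =
           - (face_jac (\<Phi> l) g y *\<^sub>R face_normal (\<Phi> l) g y)))"

section \<open>Approximate geometric terms\<close>

definition geo_potential :: "(real^3 \<Rightarrow> real^3) \<Rightarrow> 3 \<Rightarrow> real^3 \<Rightarrow> real^3" where
  "geo_potential \<Phi> i x =
     (if i = 1 then \<Phi> x $ 3 *\<^sub>R grad (\<lambda>y. \<Phi> y $ 2) x
      else if i = 2 then \<Phi> x $ 3 *\<^sub>R grad (\<lambda>y. \<Phi> y $ 1) x
      else \<Phi> x $ 1 *\<^sub>R grad (\<lambda>y. \<Phi> y $ 2) x)"

definition approx_geo3 ::
  "nat \<Rightarrow> (real^3) set \<Rightarrow> (real^3) set \<Rightarrow> (real^3 \<Rightarrow> real^3) \<Rightarrow> 3 \<Rightarrow> 3 \<Rightarrow> real^3 \<Rightarrow> real" where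
  "approx_geo3 N X X' \<Phi> i j =
     interp N X (\<lambda>x. (if i = 1 then - curl (interp_vec (N + 1) X' (geo_potential \<Phi> i)) x
                      else curl (interp_vec (N + 1) X' (geo_potential \<Phi> i)) x) $ j)"

definition approx_geo2 :: "(real^2 \<Rightarrow> real^2) \<Rightarrow> 2 \<Rightarrow> 2 \<Rightarrow> real^2 \<Rightarrow> real" where
  "approx_geo2 \<Phi> i j = geo \<Phi> i j"

definition approx_scaled_normal ::
  "('n \<Rightarrow> 'n \<Rightarrow> real^'n \<Rightarrow> real) \<Rightarrow> 'n option \<Rightarrow> real^'n \<Rightarrow> real^'n" where
  "approx_scaled_normal G f x =
     (\<chi> i. \<Sum>j\<in>UNIV. G i j x * ref_normal f $ j * ref_face_jac f TYPE('n))"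

section \<open>Norms\<close>

definition on_elem :: "(real^'n \<Rightarrow> real^'n) \<Rightarrow> (real^'n \<Rightarrow> 'b) \<Rightarrow> real^'n \<Rightarrow> 'b" where
  "on_elem \<Phi> u x = u (inv_into ref_simplex \<Phi> x)"

definition L2_norm_sq :: "(real^'n) set \<Rightarrow> (real^'n \<Rightarrow> real) \<Rightarrow> real" where
  "L2_norm_sq D u = (LINT x:D|lebesgue. (u x)\<^sup>2)"

text \<open>Squared norm of \<open>W^{s,2}\<close> for vector fields that are smooth in the interior of \<open>D\<close>, where
  weak derivatives are classical ones.\<close>

definition sobolev_norm_sq ::
  "nat \<Rightarrow> (real^('n::{finite,linorder})) set \<Rightarrow> (real^('n::{finite,linorder}) \<Rightarrow> real^'m) \<Rightarrow> real" where
  "sobolev_norm_sq s D u =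
     (\<Sum>c\<in>UNIV. \<Sum>\<alpha> | (\<Sum>i\<in>UNIV. \<alpha> i) \<le> s.
        L2_norm_sq (interior D) (multi_partial \<alpha> (\<lambda>x. u x $ c)))"

end

theory Submission
  imports Defs
begin

text \<open>
  In three dimensions row \<open>i\<close> of the cofactor matrix of the mapping is, up to sign, the curl of the
  potential \<open>r\<^sub>i\<close> (\<open>geo_3_eq_curl\<close>), and the approximate geometric terms arise from it by replacing
  \<open>r\<^sub>i\<close> by its interpolant of degree \<open>N + 1\<close>. The curl of that interpolant has degree \<open>N\<close>, so the outer
  interpolation does nothing (\<open>approx_geo3_eq_curl\<close>). All three claims follow from this description.

  Conservation: on values of a polynomial of degree \<open>N\<close> the matrix \<open>D\<^sub>N\<^sup>j\<close> is exact differentiation at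
  the volume points and zero at the surface points (\<open>decoupled_op_poly_values\<close>), so that the discrete
  law is \<open>div curl = 0\<close>. In two dimensions the exact terms are already polynomials with zero divergence.

  Normals: the normal component of a curl on a face is determined by the tangential trace of the field
  (\<open>curl_face\<close>). The tangential trace of \<open>r\<^sub>i\<close> depends on the mapping on the face only, and the trace of
  an interpolant is determined by the nodes on the face, because there are as many of them as the
  dimension of the trace space (\<open>zero_on_face_if_zero_at_nodes\<close>). On a shared face all these data
  correspond under an affine renumbering of the vertices, which changes the normal component by a sign
  that depends on the two orientations only (\<open>curl_normal_face\<close>). The same sign relates the exact scaled
  normals, which are opposite and nonzero; hence it is negative (\<open>approx_scaled_normals_opposite\<close>).

  Error: on a fixed reference element, \<open>r\<^sub>i\<close> is a polynomial of degree at most \<open>2 N\<close>. On this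
  finite-dimensional space the interpolation error is controlled by the derivatives of order \<open>N + 2\<close>,
  because it vanishes where they vanish: a semidefinite quadratic form dominates any other one that is
  zero on its kernel (\<open>psd_form_dominates\<close>, \<open>interpolation_error_reference\<close>). By the chain rule and
  quasi-uniformity, every derivative in reference coordinates costs a factor \<open>h\<close> relative to the
  derivatives in physical coordinates (\<open>reference_derivatives_bound\<close>), and the powers of \<open>h\<close> from the
  two changes of variables cancel (\<open>geometric_error_element\<close>). The domain has positive measure as soon
  as there is an element, so \<open>|\<Omega>|\<close> can be split off the constant (\<open>geometric_error_mesh\<close>).
\<close>

section \<open>Polynomial spaces\<close>

definition monomial :: "('n::finite \<Rightarrow> nat) \<Rightarrow> real^'n \<Rightarrow> real" where
  "monomial \<alpha> x = (\<Prod>i\<in>UNIV. x $ i ^ \<alpha> i)"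

lemma poly_space_monomials: "poly_space N = fs.span (monomial ` {\<alpha>. (\<Sum>i\<in>UNIV. \<alpha> i) \<le> N})"
proof -
  have "{(\<lambda>x::real^'a. \<Prod>i\<in>UNIV. x $ i ^ \<alpha> i) | \<alpha>. (\<Sum>i\<in>UNIV. \<alpha> i) \<le> N} = monomial ` {\<alpha>. (\<Sum>i\<in>UNIV. \<alpha> i) \<le> N}"
    by (auto simp: monomial_def[abs_def])
  then show ?thesis by (simp add: poly_space_def)
qed

lemma finite_multi_indices: "finite {\<alpha>::'n::finite \<Rightarrow> nat. (\<Sum>i\<in>UNIV. \<alpha> i) \<le> N}"
proof (rule finite_subset)
  show "{\<alpha>::'n \<Rightarrow> nat. (\<Sum>i\<in>UNIV. \<alpha> i) \<le> N} \<subseteq> PiE UNIV (\<lambda>_. {..N})"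
  proof (clarsimp simp: PiE_UNIV_domain)
    fix \<alpha> :: "'n \<Rightarrow> nat" and i assume "sum \<alpha> UNIV \<le> N"
    moreover have "\<alpha> i \<le> sum \<alpha> UNIV" by (rule member_le_sum) auto
    ultimately show "\<alpha> i \<le> N" by simp
  qed
  show "finite (PiE (UNIV::'n set) (\<lambda>_. {..N}))" by (rule finite_PiE) auto
qed

lemma monomial_in_poly_space: "(\<Sum>i\<in>UNIV. \<alpha> i) \<le> N \<Longrightarrow> monomial \<alpha> \<in> poly_space N"
  unfolding poly_space_monomials by (rule fs.span_base) auto

lemma poly_space_mono: "N \<le> M \<Longrightarrow> poly_space N \<subseteq> poly_space M"
  unfolding poly_space_monomials by (rule fs.span_mono) auto

lemma poly_space_add: "p \<in> poly_space N \<Longrightarrow> q \<in> poly_space N \<Longrightarrow> (\<lambda>x. p x + q x) \<in> poly_space N"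
  using fs.span_add[of p _ q] unfolding poly_space_def plus_fun_def .

lemma poly_space_diff: "p \<in> poly_space N \<Longrightarrow> q \<in> poly_space N \<Longrightarrow> (\<lambda>x. p x - q x) \<in> poly_space N"
  using fs.span_diff[of p _ q] unfolding poly_space_def fun_diff_def .

lemma poly_space_scale: "p \<in> poly_space N \<Longrightarrow> (\<lambda>x. c * p x) \<in> poly_space N"
  using fs.span_scale[of p _ c] unfolding poly_space_def .

lemma poly_space_uminus: "p \<in> poly_space N \<Longrightarrow> (\<lambda>x. - p x) \<in> poly_space N"
  using poly_space_scale[of p N "-1"] by simp

lemma poly_space_zero: "(\<lambda>x. 0) \<in> poly_space N"
  using fs.span_zero unfolding poly_space_def zero_fun_def .

lemma poly_space_sum: "(\<And>a. a \<in> A \<Longrightarrow> p a \<in> poly_space N) \<Longrightarrow> (\<lambda>x. \<Sum>a\<in>A. p a x) \<in> poly_space N"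
  by (induction A rule: infinite_finite_induct) (auto intro: poly_space_zero poly_space_add)

lemma poly_space_const: "(\<lambda>x. c) \<in> poly_space N"
  using poly_space_scale[OF monomial_in_poly_space[of "\<lambda>_. 0" N], of c] by (simp add: monomial_def)

lemma poly_space_coord: "1 \<le> N \<Longrightarrow> (\<lambda>x. x $ i) \<in> poly_space N"
proof -
  assume N: "1 \<le> N"
  have "monomial (\<lambda>k. if k = i then 1 else 0) = (\<lambda>x::real^'a. x $ i)"
  proof
    fix x :: "real^'a"
    have "monomial (\<lambda>k. if k = i then 1 else 0) x = (\<Prod>k\<in>UNIV. if k = i then x $ i else 1)"
      unfolding monomial_def by (rule prod.cong) auto
    then show "monomial (\<lambda>k. if k = i then 1 else 0) x = x $ i" by simp
  qed
  with N monomial_in_poly_space[of "\<lambda>k. if k = i then 1 else 0" N] show ?thesis by simp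
qed

lemma poly_space_induct [consumes 1, case_names zero add monomial]:
  fixes p :: "real^'n \<Rightarrow> real"
  assumes p: "p \<in> poly_space N"
    and zero: "P (\<lambda>x. 0)"
    and add: "\<And>c p q. P p \<Longrightarrow> P q \<Longrightarrow> P (\<lambda>x. c * p x + q x)"
    and mono: "\<And>\<alpha>. (\<Sum>i\<in>UNIV. \<alpha> i) \<le> N \<Longrightarrow> P (monomial \<alpha>)"
  shows "P p"
proof (rule fs.span_induct_alt[OF p[unfolded poly_space_monomials], of P])
  show "P 0" using zero by (simp add: zero_fun_def)
next
  fix c and x y :: "real^'n \<Rightarrow> real" assume "x \<in> monomial ` {\<alpha>. (\<Sum>i\<in>UNIV. \<alpha> i) \<le> N}" "P y"
  then show "P ((\<lambda>z. c * x z) + y)" using add[of x y c] mono by (auto simp: plus_fun_def)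
qed

lemma poly_space_mult:
  assumes p: "p \<in> poly_space M" and q: "q \<in> poly_space N"
  shows "(\<lambda>x. p x * q x) \<in> poly_space (M + N)"
  using p
proof (induction rule: poly_space_induct)
  case zero show ?case by (simp add: poly_space_zero)
next
  case (add c f g)
  have "(\<lambda>x. (c * f x + g x) * q x) = (\<lambda>x. c * (f x * q x) + g x * q x)" by (auto simp: algebra_simps)
  with add show ?case by (simp add: poly_space_add poly_space_scale)
next
  case (monomial \<alpha>)
  show ?case using q
  proof (induction rule: poly_space_induct)
    case zero show ?case by (simp add: poly_space_zero)
  next
    case (add c f g)
    have "(\<lambda>x. monomial \<alpha> x * (c * f x + g x)) = (\<lambda>x. c * (monomial \<alpha> x * f x) + monomial \<alpha> x * g x)"
      by (auto simp: algebra_simps)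
    with add show ?case by (simp add: poly_space_add poly_space_scale)
  next
    case (monomial \<beta>)
    have "(\<lambda>x. monomial \<alpha> x * monomial \<beta> x) = monomial (\<lambda>i. \<alpha> i + \<beta> i)"
      by (auto simp: monomial_def power_add prod.distrib)
    moreover have "(\<Sum>i\<in>UNIV. \<alpha> i + \<beta> i) \<le> M + N"
      using monomial \<open>sum \<alpha> UNIV \<le> M\<close> by (simp add: sum.distrib)
    ultimately show ?case using monomial_in_poly_space by metis
  qed
qed

lemma poly_space_power: "p \<in> poly_space M \<Longrightarrow> (\<lambda>x. p x ^ n) \<in> poly_space (n * M)"
  by (induction n) (auto intro: poly_space_const dest: poly_space_mult[of p M])

lemma poly_space_prod:
  "finite A \<Longrightarrow> (\<And>a. a \<in> A \<Longrightarrow> p a \<in> poly_space (M a)) \<Longrightarrow> (\<lambda>x. \<Prod>a\<in>A. p a x) \<in> poly_space (\<Sum>a\<in>A. M a)"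
  by (induction A rule: finite_induct) (auto intro: poly_space_const dest: poly_space_mult)

text \<open>An affine substitution turns a coordinate into a polynomial of degree one, and degrees add up in
  products.\<close>

lemma poly_space_affine_comp:
  fixes T :: "real^'m \<Rightarrow> real^'n"
  assumes T: "\<And>i. (\<lambda>x. T x $ i) \<in> poly_space 1" and p: "p \<in> poly_space N"
  shows "(\<lambda>x. p (T x)) \<in> poly_space N"
  using p
proof (induction rule: poly_space_induct)
  case zero show ?case by (rule poly_space_zero)
next
  case (add c f g) then show ?case by (simp add: poly_space_add poly_space_scale)
next
  case (monomial \<alpha>)
  have "(\<lambda>x. monomial \<alpha> (T x)) \<in> poly_space (\<Sum>i\<in>UNIV. \<alpha> i * 1)"
    unfolding monomial_def by (intro poly_space_prod poly_space_power T) auto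
  then show ?case using monomial poly_space_mono[of "\<Sum>i\<in>UNIV. \<alpha> i" N] by auto
qed

section \<open>Partial derivatives\<close>

lemma partial_has_derivative: "(f has_derivative f') (at x) \<Longrightarrow> partial i f x = f' (axis i 1)"
  unfolding partial_def using frechet_derivative_at by metis

lemma has_derivative_partials:
  fixes f :: "real^'n \<Rightarrow> real"
  assumes "f differentiable (at x)"
  shows "(f has_derivative (\<lambda>v. \<Sum>i\<in>UNIV. v $ i * partial i f x)) (at x)"
proof -
  let ?D = "frechet_derivative f (at x)"
  have D: "(f has_derivative ?D) (at x)" using assms by (simp add: frechet_derivative_works)
  interpret linear ?D using D has_derivative_linear by blast
  have "?D = (\<lambda>v. \<Sum>i\<in>UNIV. v $ i * partial i f x)"
  proof
    fix v :: "real^'n"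
    have "v = (\<Sum>i\<in>UNIV. (v $ i) *\<^sub>R axis i 1)"
      by (simp add: basis_expansion scalar_mult_eq_scaleR[symmetric])
    then have "?D v = ?D (\<Sum>i\<in>UNIV. (v $ i) *\<^sub>R axis i 1)" by simp
    also have "\<dots> = (\<Sum>i\<in>UNIV. v $ i * ?D (axis i 1))" by (simp add: sum scale)
    finally show "?D v = (\<Sum>i\<in>UNIV. v $ i * partial i f x)" by (simp add: partial_def)
  qed
  with D show ?thesis by simp
qed

lemma partial_cong_at:
  assumes "\<forall>\<^sub>F y in nhds x. f y = g y"
  shows "partial i f x = partial i g x" "f differentiable (at x) \<longleftrightarrow> g differentiable (at x)"
proof -
  have ev: "\<forall>\<^sub>F y in at x. f y = g y" "\<forall>\<^sub>F y in at x. g y = f y" "f x = g x"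
    using assms by (auto simp: eventually_nhds_conv_at eq_commute)
  have eq: "(f has_derivative D) (at x) \<longleftrightarrow> (g has_derivative D) (at x)" for D
    using has_derivative_transform_eventually[of f D x UNIV g] has_derivative_transform_eventually[of g D x UNIV f] ev
    by auto
  show "partial i f x = partial i g x" unfolding partial_def frechet_derivative_def eq ..
  show "f differentiable (at x) \<longleftrightarrow> g differentiable (at x)" unfolding differentiable_def eq ..
qed

lemma partial_add: "f differentiable (at x) \<Longrightarrow> g differentiable (at x) \<Longrightarrow>
    partial i (\<lambda>y. f y + g y) x = partial i f x + partial i g x"
  unfolding frechet_derivative_works by (drule (1) has_derivative_add, drule partial_has_derivative[where i = i]) (simp add: partial_def)

lemma partial_diff: "f differentiable (at x) \<Longrightarrow> g differentiable (at x) \<Longrightarrow>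
    partial i (\<lambda>y. f y - g y) x = partial i f x - partial i g x"
  unfolding frechet_derivative_works by (drule (1) has_derivative_diff, drule partial_has_derivative[where i = i]) (simp add: partial_def)

lemma partial_uminus: "f differentiable (at x) \<Longrightarrow> partial i (\<lambda>y. - f y) x = - partial i f x"
  unfolding frechet_derivative_works by (drule has_derivative_minus, drule partial_has_derivative[where i = i]) (simp add: partial_def)

lemma partial_const: "partial i (\<lambda>y. c) x = 0"
  by (rule partial_has_derivative[of _ "\<lambda>_. 0", simplified]) simp

lemma partial_mult: "f differentiable (at x) \<Longrightarrow> g differentiable (at x) \<Longrightarrow>
    partial i (\<lambda>y. f y * g y) x = partial i f x * g x + f x * partial i g x"
  unfolding frechet_derivative_works by (drule (1) has_derivative_mult, drule partial_has_derivative[where i = i]) (simp add: partial_def)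

lemma partial_cmult: "f differentiable (at x) \<Longrightarrow> partial i (\<lambda>y. c * f y) x = c * partial i f x"
  by (subst partial_mult) (auto simp: partial_const)

lemma partial_lin: "f differentiable (at x) \<Longrightarrow> g differentiable (at x) \<Longrightarrow>
    partial i (\<lambda>y. c * f y + g y) x = c * partial i f x + partial i g x"
  by (simp add: partial_add partial_cmult)

lemma partial_sum: "finite A \<Longrightarrow> (\<And>a. a \<in> A \<Longrightarrow> f a differentiable (at x)) \<Longrightarrow>
    partial i (\<lambda>y. \<Sum>a\<in>A. f a y) x = (\<Sum>a\<in>A. partial i (f a) x)"
  by (induction A rule: finite_induct) (auto simp: partial_const partial_add)

lemma monomial_has_derivative:
  "(monomial \<alpha> has_derivative (\<lambda>v. \<Sum>j\<in>UNIV. v $ j * (real (\<alpha> j) * monomial (\<alpha>(j := \<alpha> j - 1)) x))) (at x)"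
proof -
  have "((\<lambda>x. \<Prod>i\<in>UNIV. x $ i ^ \<alpha> i) has_derivative
      (\<lambda>v. \<Sum>j\<in>UNIV. (of_nat (\<alpha> j) * v $ j * x $ j ^ (\<alpha> j - 1)) * (\<Prod>i\<in>UNIV - {j}. x $ i ^ \<alpha> i))) (at x)"
    by (intro has_derivative_prod has_derivative_power bounded_linear_imp_has_derivative bounded_linear_vec_nth)
  moreover have "monomial (\<alpha>(j := \<alpha> j - 1)) x = x $ j ^ (\<alpha> j - 1) * (\<Prod>i\<in>UNIV - {j}. x $ i ^ \<alpha> i)" for j
    unfolding monomial_def by (subst prod.remove[of _ j]) (auto intro!: prod.cong)
  ultimately show ?thesis unfolding monomial_def[of \<alpha>, abs_def] by (simp add: mult_ac)
qed

lemma poly_space_differentiable: "p \<in> poly_space N \<Longrightarrow> p differentiable (at x)"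
proof (induction rule: poly_space_induct)
  case (monomial \<alpha>) show ?case using monomial_has_derivative differentiable_def by blast
qed auto

lemma partial_poly_space:
  assumes "p \<in> poly_space N" shows "partial i p \<in> poly_space (N - 1)"
proof -
  have "(\<forall>x. p differentiable (at x)) \<and> partial i p \<in> poly_space (N - 1)"
    using assms
  proof (induction rule: poly_space_induct)
    case zero show ?case by (auto simp: poly_space_zero partial_const[abs_def])
  next
    case (add c f g)
    then have "partial i (\<lambda>x. c * f x + g x) = (\<lambda>x. c * partial i f x + partial i g x)"
      by (auto simp: partial_add partial_cmult)
    with add show ?case by (simp add: poly_space_add poly_space_scale)
  next
    case (monomial \<alpha>)
    have *: "partial i (monomial \<alpha>) = (\<lambda>x. real (\<alpha> i) * monomial (\<alpha>(i := \<alpha> i - 1)) x)"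
      by (rule ext, subst partial_has_derivative[OF monomial_has_derivative]) (auto simp: axis_def intro!: sum.remove[of UNIV i, THEN trans])
    have "partial i (monomial \<alpha>) \<in> poly_space (N - 1)"
    proof (cases "\<alpha> i = 0")
      case True then show ?thesis by (simp add: * poly_space_zero)
    next
      case False
      have "(\<Sum>j\<in>UNIV. (\<alpha>(i := \<alpha> i - 1)) j) = (\<alpha> i - 1) + (\<Sum>j\<in>UNIV - {i}. \<alpha> j)"
        by (subst sum.remove[of _ i]) (auto intro!: sum.cong)
      moreover have "(\<Sum>j\<in>UNIV. \<alpha> j) = \<alpha> i + (\<Sum>j\<in>UNIV - {i}. \<alpha> j)" by (rule sum.remove) auto
      ultimately have "(\<Sum>j\<in>UNIV. (\<alpha>(i := \<alpha> i - 1)) j) \<le> N - 1" using monomial False by linarith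
      then show ?thesis unfolding * by (intro poly_space_scale monomial_in_poly_space)
    qed
    then show ?case using monomial_has_derivative differentiable_def by blast
  qed
  then show ?thesis by simp
qed

lemma partial_poly_space': "p \<in> poly_space N \<Longrightarrow> partial i p \<in> poly_space N"
  using partial_poly_space[of p N i] poly_space_mono[of "N - 1" N] by auto

lemma poly_space_continuous: "p \<in> poly_space N \<Longrightarrow> continuous_on S p"
  by (meson poly_space_differentiable differentiable_imp_continuous_within continuous_on_eq_continuous_within continuous_at_imp_continuous_at_within)

lemma sum_fun_apply: "(\<Sum>a\<in>A. f a) x = (\<Sum>a\<in>A. f a x :: real)"
  by (induction A rule: infinite_finite_induct) auto

section \<open>Interpolation\<close>

lemma interp_unique:
  assumes "unisolvent N X" "p \<in> poly_space N" "\<And>x. x \<in> X \<Longrightarrow> p x = g x"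
  shows "interp N X g = p"
  using assms unfolding interp_def unisolvent_def by (intro the1_equality) auto

lemma interp_works:
  assumes "unisolvent N X"
  shows "interp N X g \<in> poly_space N" "x \<in> X \<Longrightarrow> interp N X g x = g x"
proof -
  have "\<exists>!p. p \<in> poly_space N \<and> (\<forall>x\<in>X. p x = g x)" using assms unfolding unisolvent_def by blast
  from theI'[OF this] show "interp N X g \<in> poly_space N" "x \<in> X \<Longrightarrow> interp N X g x = g x"
    unfolding interp_def by blast+
qed

lemma interp_poly: "unisolvent N X \<Longrightarrow> p \<in> poly_space N \<Longrightarrow> interp N X p = p"
  by (rule interp_unique) auto

lemma interp_linear:
  assumes "unisolvent N X"
  shows "interp N X (\<lambda>x. c * f x + d * g x) = (\<lambda>x. c * interp N X f x + d * interp N X g x)"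
  using interp_works[OF assms] by (intro interp_unique[OF assms] poly_space_add poly_space_scale) auto

lemma interp_sum:
  assumes "unisolvent N X" "finite A"
  shows "interp N X (\<lambda>x. \<Sum>a\<in>A. c a * f a x) = (\<lambda>x. \<Sum>a\<in>A. c a * interp N X (f a) x)"
  using interp_works[OF assms(1)] by (intro interp_unique[OF assms(1)] poly_space_sum poly_space_scale) auto

text \<open>The Lagrange functions of the nodes on a face have linearly independent traces. There are as
  many of them as the dimension of the trace space, so they span it; this is how the number of
  nodes on a face enters.\<close>

lemma zero_on_face_if_zero_at_nodes:
  fixes X :: "(real^'n) set"
  assumes X: "interpolation_nodes N X" and p: "p \<in> poly_space N"
    and zero: "\<And>x. x \<in> X \<inter> face f \<Longrightarrow> p x = 0" and x: "x \<in> face f"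
  shows "p x = 0"
proof -
  define tr :: "(real^'n \<Rightarrow> real) \<Rightarrow> real^'n \<Rightarrow> real" where "tr q = (\<lambda>x. if x \<in> face f then q x else 0)" for q
  define T where "T = tr ` poly_space N"
  define F where "F = X \<inter> face f"
  have uni: "unisolvent N X" and card: "card F = fs.dim T"
    using X by (auto simp: interpolation_nodes_def trace_dim_def T_def tr_def F_def)
  have finF: "finite F" using uni by (simp add: F_def unisolvent_def)
  define L where "L y = interp N X (\<lambda>z. if z = y then 1 else 0)" for y
  define B where "B = (\<lambda>y. tr (L y)) ` F"
  have LT: "L y \<in> poly_space N" for y unfolding L_def by (rule interp_works[OF uni])
  have Lval: "tr (L y) z = (if z = y then 1 else 0)" if "z \<in> F" for y z
    using that interp_works(2)[OF uni] by (auto simp: tr_def L_def F_def)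
  have inj: "inj_on (\<lambda>y. tr (L y)) F"
    by (rule inj_onI) (metis Lval zero_neq_one)
  have BT: "B \<subseteq> T" using LT by (auto simp: B_def T_def)
  have finB: "finite B" using finF by (simp add: B_def)
  have sumF: "(\<Sum>v\<in>B. u v * v z) = u (tr (L z))" if "z \<in> F" for u z
  proof -
    have "(\<Sum>v\<in>B. u v * v z) = (\<Sum>y\<in>F. u (tr (L y)) * tr (L y) z)"
      unfolding B_def by (subst sum.reindex[OF inj]) simp
    also have "\<dots> = (\<Sum>y\<in>F. if y = z then u (tr (L y)) else 0)"
      by (rule sum.cong) (auto simp: Lval that)
    also have "\<dots> = u (tr (L z))" using that finF by simp
    finally show ?thesis .
  qed
  have ind: "fs.independent B"
  proof (rule fs.independent_if_scalars_zero[OF finB])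
    fix u v assume 0: "(\<Sum>v\<in>B. (\<lambda>x. u v * v x)) = 0" and "v \<in> B"
    then obtain z where z: "z \<in> F" "v = tr (L z)" by (auto simp: B_def)
    have "u v = (\<Sum>v\<in>B. u v * v z)" using sumF[OF z(1)] z by simp
    also have "\<dots> = (\<Sum>v\<in>B. (\<lambda>x. u v * v x)) z" by (simp add: sum_fun_apply)
    finally show "u v = 0" using 0 by simp
  qed
  have Tfin: "T \<subseteq> fs.span (tr ` monomial ` {\<alpha>. (\<Sum>i\<in>UNIV. \<alpha> i) \<le> N})" (is "_ \<subseteq> fs.span ?M")
  proof
    fix q assume "q \<in> T"
    then obtain p where p: "p \<in> poly_space N" "q = tr p" by (auto simp: T_def)
    have "tr p \<in> fs.span ?M" using p(1)
    proof (induction rule: poly_space_induct)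
      case zero
      have "tr (\<lambda>x. 0) = 0" by (auto simp: tr_def)
      then show ?case using fs.span_zero[of ?M] by metis
    next
      case (add c f g)
      have eq: "tr (\<lambda>x. c * f x + g x) = (\<lambda>x. c * tr f x) + tr g" by (auto simp: tr_def)
      show ?case unfolding eq by (intro fs.span_add fs.span_scale add)
    next
      case (monomial \<alpha>) then show ?case by (intro fs.span_base) auto
    qed
    with p show "q \<in> fs.span ?M" by simp
  qed
  have finM: "finite ?M" using finite_multi_indices by blast
  have span: "v \<in> fs.span B" if "v \<in> T" for v
  proof (rule ccontr)
    assume v: "v \<notin> fs.span B"
    have "fs.independent (insert v B)" using v ind by (rule fs.independent_insertI)
    moreover obtain C where C: "C \<subseteq> T" "fs.independent C" "T \<subseteq> fs.span C" "card C = fs.dim T"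
      using fs.basis_exists by blast
    moreover have "finite C"
      using fs.independent_span_bound[OF finM C(2)] C(1) Tfin by blast
    moreover have "insert v B \<subseteq> fs.span C" using that BT C by blast
    ultimately have "card (insert v B) \<le> card C" using fs.independent_span_bound by blast
    moreover have "card B = card F" unfolding B_def using inj by (rule card_image)
    moreover have "v \<notin> B" using v fs.span_base by blast
    ultimately show False using card C finB by simp
  qed
  have "tr p \<in> fs.span B" using p by (intro span) (auto simp: T_def)
  then obtain u where u: "tr p = (\<Sum>v\<in>B. (\<lambda>x. u v * v x))"
    using fs.span_finite[OF finB] by auto
  have "u v = 0" if "v \<in> B" for v
  proof -
    from that obtain z where z: "z \<in> F" "v = tr (L z)" by (auto simp: B_def)
    have "u v = (\<Sum>v\<in>B. u v * v z)" using sumF[OF z(1)] z by simp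
    also have "\<dots> = tr p z" by (simp add: u sum_fun_apply)
    also have "\<dots> = 0" using z zero by (auto simp: tr_def F_def)
    finally show ?thesis .
  qed
  then have "tr p = 0" unfolding u by (intro sum.neutral) auto
  then show ?thesis using x by (auto simp: tr_def dest: fun_cong[of _ _ x])
qed



section \<open>Smooth functions\<close>

text \<open>Smoothness is graded by the number of derivatives, so that the closure properties follow by
  induction from the rules for first derivatives.\<close>

primrec smooth_up_to :: "nat \<Rightarrow> (real^'n) set \<Rightarrow> (real^'n \<Rightarrow> real) \<Rightarrow> bool" where
  "smooth_up_to 0 U f \<longleftrightarrow> True"
| "smooth_up_to (Suc n) U f \<longleftrightarrow> (\<forall>x\<in>U. f differentiable (at x)) \<and> (\<forall>i. smooth_up_to n U (partial i f))"

definition smooth :: "(real^'n) set \<Rightarrow> (real^'n \<Rightarrow> real) \<Rightarrow> bool" where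
  "smooth U f \<longleftrightarrow> (\<forall>n. smooth_up_to n U f)"

lemma partial_cong_open:
  assumes "open U" "\<And>y. y \<in> U \<Longrightarrow> f y = g y" "x \<in> U"
  shows "partial i f x = partial i g x" "f differentiable (at x) \<longleftrightarrow> g differentiable (at x)"
proof -
  have "\<forall>\<^sub>F y in nhds x. f y = g y" using assms unfolding eventually_nhds by blast
  from partial_cong_at[OF this] show "partial i f x = partial i g x" "f differentiable (at x) \<longleftrightarrow> g differentiable (at x)"
    by blast+
qed

lemma smooth_up_to_cong:
  assumes "open U"
  shows "(\<And>y. y \<in> U \<Longrightarrow> f y = g y) \<Longrightarrow> smooth_up_to n U f \<longleftrightarrow> smooth_up_to n U g"
proof (induction n arbitrary: f g)
  case (Suc n)
  have "f differentiable (at x) \<longleftrightarrow> g differentiable (at x)" if "x \<in> U" for x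
    using partial_cong_open(2)[OF assms Suc.prems that] .
  moreover have "smooth_up_to n U (partial i f) \<longleftrightarrow> smooth_up_to n U (partial i g)" for i
    by (rule Suc.IH) (rule partial_cong_open(1)[OF assms Suc.prems])
  ultimately show ?case by auto
qed simp

lemma smooth_up_to_Suc: "smooth_up_to (Suc n) U f \<Longrightarrow> smooth_up_to n U f"
  by (induction n arbitrary: f) auto

lemma smooth_up_to_const: "smooth_up_to n U (\<lambda>x. c)"
  by (induction n arbitrary: c) (auto simp: partial_const[abs_def])

lemma smooth_up_to_add:
  assumes "open U"
  shows "smooth_up_to n U f \<Longrightarrow> smooth_up_to n U g \<Longrightarrow> smooth_up_to n U (\<lambda>x. f x + g x)"
proof (induction n arbitrary: f g)
  case (Suc n)
  have "smooth_up_to n U (partial i (\<lambda>x. f x + g x))" for i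
  proof -
    have "smooth_up_to n U (\<lambda>x. partial i f x + partial i g x)" using Suc by auto
    then show ?thesis
      by (subst smooth_up_to_cong[OF assms, of _ "\<lambda>x. partial i f x + partial i g x"])
        (use Suc.prems in \<open>auto intro: partial_add\<close>)
  qed
  then show ?case using Suc.prems by auto
qed simp

lemma smooth_up_to_mult:
  assumes "open U"
  shows "smooth_up_to n U f \<Longrightarrow> smooth_up_to n U g \<Longrightarrow> smooth_up_to n U (\<lambda>x. f x * g x)"
proof (induction n arbitrary: f g)
  case (Suc n)
  have "smooth_up_to n U (partial i (\<lambda>x. f x * g x))" for i
  proof -
    have "smooth_up_to n U (\<lambda>x. partial i f x * g x + f x * partial i g x)"
      using Suc.prems smooth_up_to_Suc[OF Suc.prems(1)] smooth_up_to_Suc[OF Suc.prems(2)]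
      by (intro smooth_up_to_add[OF assms] Suc.IH) auto
    then show ?thesis
      by (subst smooth_up_to_cong[OF assms, of _ "\<lambda>x. partial i f x * g x + f x * partial i g x"])
        (use Suc.prems in \<open>auto intro: partial_mult\<close>)
  qed
  then show ?case using Suc.prems by auto
qed simp

lemma partial_inverse:
  assumes "f differentiable (at x)" "f x \<noteq> 0"
  shows "(\<lambda>y. inverse (f y)) differentiable (at x)"
    "partial i (\<lambda>y. inverse (f y)) x = - 1 * (partial i f x * (inverse (f x) * inverse (f x)))"
proof -
  have d: "((\<lambda>y. inverse (f y)) has_derivative (\<lambda>h. - (inverse (f x) * frechet_derivative f (at x) h * inverse (f x)))) (at x)"
    using assms frechet_derivative_works by (intro Deriv.has_derivative_inverse) blast+
  then show "(\<lambda>y. inverse (f y)) differentiable (at x)" using differentiable_def by blast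
  show "partial i (\<lambda>y. inverse (f y)) x = - 1 * (partial i f x * (inverse (f x) * inverse (f x)))"
    using partial_has_derivative[OF d, of i] by (simp add: partial_def)
qed

lemma smooth_up_to_inverse:
  assumes "open U"
  shows "smooth_up_to n U f \<Longrightarrow> (\<And>x. x \<in> U \<Longrightarrow> f x \<noteq> 0) \<Longrightarrow> smooth_up_to n U (\<lambda>x. inverse (f x))"
proof (induction n arbitrary: f)
  case (Suc n)
  have "smooth_up_to n U (partial i (\<lambda>x. inverse (f x)))" for i
  proof -
    have "smooth_up_to n U (\<lambda>x. - 1 * (partial i f x * (inverse (f x) * inverse (f x))))"
      using Suc smooth_up_to_Suc[OF Suc.prems(1)]
      by (intro smooth_up_to_mult[OF assms] smooth_up_to_const Suc.IH) auto
    then show ?thesis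
      by (subst smooth_up_to_cong[OF assms, of _ "\<lambda>x. - 1 * (partial i f x * (inverse (f x) * inverse (f x)))"])
        (use Suc.prems in \<open>auto intro: partial_inverse(2)[simplified]\<close>)
  qed
  then show ?case using Suc.prems by (auto intro: partial_inverse(1))
qed simp

lemma smooth_const: "smooth U (\<lambda>x. c)"
  by (simp add: smooth_def smooth_up_to_const)
lemma smooth_add: "open U \<Longrightarrow> smooth U f \<Longrightarrow> smooth U g \<Longrightarrow> smooth U (\<lambda>x. f x + g x)"
  by (simp add: smooth_def smooth_up_to_add)
lemma smooth_mult: "open U \<Longrightarrow> smooth U f \<Longrightarrow> smooth U g \<Longrightarrow> smooth U (\<lambda>x. f x * g x)"
  by (simp add: smooth_def smooth_up_to_mult)
lemma smooth_inverse: "open U \<Longrightarrow> smooth U f \<Longrightarrow> (\<And>x. x \<in> U \<Longrightarrow> f x \<noteq> 0) \<Longrightarrow> smooth U (\<lambda>x. inverse (f x))"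
  by (simp add: smooth_def smooth_up_to_inverse)
lemma smooth_sum: "open U \<Longrightarrow> (\<And>a. a \<in> A \<Longrightarrow> smooth U (f a)) \<Longrightarrow> smooth U (\<lambda>x. \<Sum>a\<in>A. f a x)"
  by (induction A rule: infinite_finite_induct) (auto intro: smooth_const smooth_add)
lemma smooth_cong: "open U \<Longrightarrow> (\<And>x. x \<in> U \<Longrightarrow> f x = g x) \<Longrightarrow> smooth U f \<longleftrightarrow> smooth U g"
  unfolding smooth_def using smooth_up_to_cong by blast
lemma smooth_differentiable: "smooth U f \<Longrightarrow> x \<in> U \<Longrightarrow> f differentiable (at x)"
  unfolding smooth_def by (metis smooth_up_to.simps(2))
lemma smooth_partial: "smooth U f \<Longrightarrow> smooth U (partial i f)"
  unfolding smooth_def by (metis smooth_up_to.simps(2))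
lemma smooth_partials: "smooth U f \<Longrightarrow> smooth U (partials is f)"
  by (induction "is") (auto intro: smooth_partial)
lemma smooth_continuous_on: "smooth U f \<Longrightarrow> continuous_on U f"
  by (meson continuous_at_imp_continuous_on differentiable_imp_continuous_within smooth_differentiable)

lemma smooth_poly: "p \<in> poly_space N \<Longrightarrow> smooth U p"
proof -
  have "p \<in> poly_space N \<Longrightarrow> smooth_up_to n U p" for n
    by (induction n arbitrary: p) (auto intro: poly_space_differentiable partial_poly_space')
  then show "p \<in> poly_space N \<Longrightarrow> smooth U p" by (simp add: smooth_def)
qed

lemma partials_append: "partials (xs @ ys) f = partials xs (partials ys f)"
  by (induction xs) auto

lemma partials_cong_open:
  assumes "open U" "\<And>y. y \<in> U \<Longrightarrow> f y = g y" "x \<in> U"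
  shows "partials is f x = partials is g x"
  using assms(3)
proof (induction "is" arbitrary: x)
  case (Cons i js)
  then show ?case using partial_cong_open(1)[OF assms(1), of "partials js f" "partials js g"] by auto
qed (use assms in auto)

subsection \<open>Symmetry of second derivatives\<close>

lemma has_real_derivative_along_axis:
  assumes "f differentiable (at (x + s *\<^sub>R axis i 1))"
  shows "((\<lambda>s. f (x + s *\<^sub>R axis i 1)) has_real_derivative partial i f (x + s *\<^sub>R axis i 1)) (at s)"
proof -
  have "((\<lambda>s. f (x + s *\<^sub>R axis i 1)) has_derivative
      (\<lambda>h. frechet_derivative f (at (x + s *\<^sub>R axis i 1)) (h *\<^sub>R axis i 1))) (at s)"
    by (rule has_derivative_compose[of "\<lambda>s. x + s *\<^sub>R axis i 1" "\<lambda>h. h *\<^sub>R axis i 1" s UNIV])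
      (use assms frechet_derivative_works in \<open>auto intro!: derivative_eq_intros\<close>)
  moreover have "(\<lambda>h. frechet_derivative f (at (x + s *\<^sub>R axis i 1)) (h *\<^sub>R axis i 1)) = (*) (partial i f (x + s *\<^sub>R axis i 1))"
    using linear_frechet_derivative[OF assms] by (auto simp: partial_def linear_cmul mult.commute)
  ultimately show ?thesis by (simp add: has_field_derivative_def)
qed

text \<open>Two applications of the mean value theorem express the second difference over a small square,
  in which the two directions play symmetric roles, by a mixed derivative.\<close>

lemma second_difference_eq_mixed_partial:
  fixes f :: "real^'n \<Rightarrow> real"
  assumes h: "0 < h" and ball: "cball x (2 * h) \<subseteq> U"
    and f: "\<And>y. y \<in> U \<Longrightarrow> f differentiable (at y)" and pf: "\<And>y. y \<in> U \<Longrightarrow> partial i f differentiable (at y)"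
  shows "\<exists>y. dist x y \<le> 2 * h \<and>
     f (x + h *\<^sub>R axis i 1 + h *\<^sub>R axis j 1) - f (x + h *\<^sub>R axis i 1) - f (x + h *\<^sub>R axis j 1) + f x
       = h * h * partial j (partial i f) y"
proof -
  define P where "P s t = x + s *\<^sub>R axis i (1::real) + t *\<^sub>R axis j (1::real)" for s t
  have dP: "dist x (P s t) \<le> 2 * h" if "0 \<le> s" "s \<le> h" "0 \<le> t" "t \<le> h" for s t
  proof -
    have "x - P s t = - (s *\<^sub>R axis i (1::real) + t *\<^sub>R axis j (1::real))" by (simp add: P_def)
    then have "dist x (P s t) = norm (s *\<^sub>R axis i (1::real) + t *\<^sub>R axis j (1::real))"
      unfolding dist_norm by (metis norm_minus_cancel)
    also have "\<dots> \<le> norm (s *\<^sub>R axis i (1::real)) + norm (t *\<^sub>R axis j (1::real))" by (rule norm_triangle_ineq)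
    finally show ?thesis using that by simp
  qed
  have PU: "P s t \<in> U" if "0 \<le> s" "s \<le> h" "0 \<le> t" "t \<le> h" for s t
    using dP[OF that] ball by auto
  have Ps: "P s t = (x + t *\<^sub>R axis j 1) + s *\<^sub>R axis i 1" for s t by (simp add: P_def algebra_simps)
  have Pt: "P s t = (x + s *\<^sub>R axis i 1) + t *\<^sub>R axis j 1" for s t by (simp add: P_def)
  have d1: "((\<lambda>s. f (P s t)) has_real_derivative partial i f (P s t)) (at s)" if "0 \<le> s" "s \<le> h" "0 \<le> t" "t \<le> h" for s t
    unfolding Ps by (rule has_real_derivative_along_axis, rule f, rule PU[OF that, unfolded Ps])
  have d2: "((\<lambda>t. partial i f (P s t)) has_real_derivative partial j (partial i f) (P s t)) (at t)"
    if "0 \<le> s" "s \<le> h" "0 \<le> t" "t \<le> h" for s t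
    unfolding Pt by (rule has_real_derivative_along_axis, rule pf, rule PU[OF that, unfolded Pt])
  have "\<exists>s>0. s < h \<and> (f (P h h) - f (P h 0)) - (f (P 0 h) - f (P 0 0)) = (h - 0) * (partial i f (P s h) - partial i f (P s 0))"
    by (rule MVT2[OF h]) (use h in \<open>intro DERIV_diff d1; simp\<close>)
  then obtain s where s: "0 < s" "s < h"
    "(f (P h h) - f (P h 0)) - (f (P 0 h) - f (P 0 0)) = (h - 0) * (partial i f (P s h) - partial i f (P s 0))"
    by blast
  have "\<exists>t>0. t < h \<and> partial i f (P s h) - partial i f (P s 0) = (h - 0) * partial j (partial i f) (P s t)"
    by (rule MVT2[OF h]) (use s in \<open>intro d2; simp\<close>)
  then obtain t where t: "0 < t" "t < h"
    "partial i f (P s h) - partial i f (P s 0) = (h - 0) * partial j (partial i f) (P s t)"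
    by blast
  show ?thesis
  proof (intro exI conjI)
    show "dist x (P s t) \<le> 2 * h" using s t by (intro dP) auto
    show "f (x + h *\<^sub>R axis i 1 + h *\<^sub>R axis j 1) - f (x + h *\<^sub>R axis i 1) - f (x + h *\<^sub>R axis j 1) + f x
       = h * h * partial j (partial i f) (P s t)"
      using s(3) t(3) by (simp add: P_def)
  qed
qed

lemma partial_commute:
  fixes f :: "real^'n \<Rightarrow> real"
  assumes U: "open U" and f: "smooth U f" and x: "x \<in> U"
  shows "partial i (partial j f) x = partial j (partial i f) x"
proof (rule ccontr)
  let ?a = "partial i (partial j f)" and ?b = "partial j (partial i f)"
  assume ne: "?a x \<noteq> ?b x"
  define e where "e = \<bar>?a x - ?b x\<bar> / 2"
  have e: "0 < e" using ne by (simp add: e_def)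
  have cont: "isCont g x" if "smooth U g" for g
    using smooth_differentiable[OF that x] by (rule differentiable_imp_continuous_within)
  have sa: "smooth U ?a" and sb: "smooth U ?b" using f by (auto intro: smooth_partial)
  obtain d1 where d1: "0 < d1" "\<And>y. dist y x < d1 \<Longrightarrow> dist (?a y) (?a x) < e"
    using cont[OF sa] e unfolding continuous_at_eps_delta by blast
  obtain d2 where d2: "0 < d2" "\<And>y. dist y x < d2 \<Longrightarrow> dist (?b y) (?b x) < e"
    using cont[OF sb] e unfolding continuous_at_eps_delta by blast
  obtain r where r: "0 < r" "cball x r \<subseteq> U" using U x open_contains_cball by blast
  define h where "h = min r (min d1 d2) / 4"
  have h: "0 < h" "2 * h \<le> r" "2 * h < d1" "2 * h < d2" using r d1 d2 by (auto simp: h_def)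
  have ball: "cball x (2 * h) \<subseteq> U" using r h by (meson order_trans subset_cball)
  have df: "f differentiable (at y)" "partial k f differentiable (at y)" if "y \<in> U" for y k
    using smooth_differentiable[OF f that] smooth_differentiable[OF smooth_partial[OF f] that] by auto
  obtain y where y: "dist x y \<le> 2 * h" and ey:
     "f (x + h *\<^sub>R axis i 1 + h *\<^sub>R axis j 1) - f (x + h *\<^sub>R axis i 1) - f (x + h *\<^sub>R axis j 1) + f x = h * h * ?b y"
    using second_difference_eq_mixed_partial[OF h(1) ball df, of i j] by blast
  obtain z where z: "dist x z \<le> 2 * h" and ez:
     "f (x + h *\<^sub>R axis j 1 + h *\<^sub>R axis i 1) - f (x + h *\<^sub>R axis j 1) - f (x + h *\<^sub>R axis i 1) + f x = h * h * ?a z"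
    using second_difference_eq_mixed_partial[OF h(1) ball df, of j i] by blast
  have "x + h *\<^sub>R axis j 1 + h *\<^sub>R axis i 1 = x + h *\<^sub>R axis i 1 + h *\<^sub>R axis j 1" by (simp add: algebra_simps)
  note ez = ez[unfolded this]
  have "h * h * ?b y = h * h * ?a z" using ey ez by linarith
  with h have "?b y = ?a z" by simp
  moreover have "dist (?a z) (?a x) < e" using d1(2)[of z] z h by (simp add: dist_commute)
  moreover have "dist (?b y) (?b x) < e" using d2(2)[of y] y h by (simp add: dist_commute)
  ultimately show False unfolding e_def dist_real_def by argo
qed

lemma partials_move_front:
  assumes "open U" "smooth U f"
  shows "x \<in> U \<Longrightarrow> partials (xs @ i # ys) f x = partials (i # xs @ ys) f x"
proof (induction xs arbitrary: x)
  case (Cons j xs)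
  have "partials ((j # xs) @ i # ys) f x = partial j (partial i (partials (xs @ ys) f)) x"
    using partial_cong_open(1)[OF assms(1), of "partials (xs @ i # ys) f"] Cons by auto
  also have "\<dots> = partial i (partial j (partials (xs @ ys) f)) x"
    using partial_commute[OF assms(1) smooth_partials[OF assms(2)] Cons.prems] .
  finally show ?case by simp
qed simp

lemma partials_permute:
  assumes "open U" "smooth U f"
  shows "mset is = mset js \<Longrightarrow> x \<in> U \<Longrightarrow> partials is f x = partials js f x"
proof (induction "is" arbitrary: js x)
  case (Cons i "is")
  then have "i \<in> set js" by (metis list.set_intros(1) set_mset_mset)
  then obtain xs ys where js: "js = xs @ i # ys" by (meson split_list)
  with Cons.prems have m: "mset is = mset (xs @ ys)" by simp
  have "partials (i # is) f x = partial i (partials (xs @ ys) f) x"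
    using partial_cong_open(1)[OF assms(1) Cons.IH[OF m] Cons.prems(2)] by simp
  also have "\<dots> = partials js f x" using partials_move_front[OF assms Cons.prems(2)] js by simp
  finally show ?case .
qed simp

lemma sum_count_mset: "(\<Sum>i\<in>UNIV. count (mset is) i) = length is" for "is" :: "'a::finite list"
proof (induction "is")
  case (Cons i "is")
  have "(\<Sum>j\<in>UNIV. count (mset (i # is)) j) = (\<Sum>j\<in>UNIV. count (mset is) j) + (\<Sum>j\<in>UNIV. if i = j then 1 else 0)"
    unfolding sum.distrib[symmetric] by (rule sum.cong) auto
  with Cons show ?case by simp
qed simp

text \<open>The chain rule produces derivatives in an arbitrary order, the Sobolev norm contains only those
  in a fixed order.\<close>

lemma partials_eq_multi_partial:
  fixes f :: "real^('n::{finite,linorder}) \<Rightarrow> real"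
  assumes "open U" "smooth U f" "x \<in> U"
  shows "partials is f x = multi_partial (\<lambda>i. count (mset is) i) f x"
proof -
  have c: "count (mset (concat (map (\<lambda>i. replicate (\<alpha> i) i) L))) j = (if j \<in> set L then \<alpha> j else 0)"
    if "distinct L" for \<alpha> :: "'n \<Rightarrow> nat" and L j
    using that by (induction L) auto
  show "partials is f x = multi_partial (\<lambda>i. count (mset is) i) f x"
    unfolding multi_partial_def
    by (rule partials_permute[OF assms(1,2) _ assms(3)]) (rule multiset_eqI, subst c, auto)
qed



section \<open>The difference matrices on polynomials\<close>

lemma UNIV_sum_decomp: "(\<Sum>r\<in>UNIV. f r) = (\<Sum>a\<in>UNIV. f (Inl a)) + (\<Sum>s\<in>UNIV. f (Inr s))"
  for f :: "'a::finite + 'b::finite \<Rightarrow> real"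
  by (simp add: sum.Plus UNIV_Plus_UNIV[symmetric] del: UNIV_Plus_UNIV)

lemma block_mat_mult_vec:
  "block_mat A B C D *v v = (\<chi> r. case r of
      Inl a \<Rightarrow> (A *v (\<chi> b. v $ Inl b)) $ a + (B *v (\<chi> t. v $ Inr t)) $ a
    | Inr s \<Rightarrow> (C *v (\<chi> b. v $ Inl b)) $ s + (D *v (\<chi> t. v $ Inr t)) $ s)"
  by (simp add: vec_eq_iff matrix_vector_mult_def block_mat_def UNIV_sum_decomp split: sum.split)

lemma poly_basis_expand:
  assumes "poly_basis N \<phi>" "p \<in> poly_space N"
  obtains c where "p = (\<lambda>x. \<Sum>b\<in>UNIV. \<phi> b x * c $ b)"
proof -
  have "p \<in> fs.span (range \<phi>)" and inj: "inj \<phi>" using assms by (auto simp: poly_basis_def)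
  then obtain u where u: "p = (\<Sum>v\<in>range \<phi>. (\<lambda>x. u v * v x))"
    using fs.span_finite[of "range \<phi>"] by auto
  have "p x = (\<Sum>b\<in>UNIV. \<phi> b x * (\<chi> b. u (\<phi> b)) $ b)" for x
    unfolding u by (simp add: sum_fun_apply sum.reindex[OF inj] mult.commute)
  with that show thesis by blast
qed

lemma eval_mat_mult_vec: "eval_mat \<phi> pts *v c = (\<chi> a. \<Sum>b\<in>UNIV. \<phi> b (pts a) * c $ b)"
  by (simp add: eval_mat_def matrix_vector_mult_def)

lemma diff_mat_coefficients:
  assumes \<phi>: "poly_basis N \<phi>"
  shows "(\<Sum>a\<in>UNIV. \<phi> a x * (diff_mat \<phi> j *v c) $ a) = partial j (\<lambda>x. \<Sum>b\<in>UNIV. \<phi> b x * c $ b) x"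
proof -
  have inj: "inj \<phi>" and ind: "fs.independent (range \<phi>)" and span: "fs.span (range \<phi>) = poly_space N"
    using \<phi> by (auto simp: poly_basis_def)
  have \<phi>N: "\<phi> b \<in> poly_space N" for b using span fs.span_base[of "\<phi> b" "range \<phi>"] by auto
  have rep: "(\<Sum>a\<in>UNIV. \<phi> a x * fs.representation (range \<phi>) (partial j (\<phi> b)) (\<phi> a)) = partial j (\<phi> b) x" for b
  proof -
    have "partial j (\<phi> b) = (\<Sum>v\<in>range \<phi>. (\<lambda>x. fs.representation (range \<phi>) (partial j (\<phi> b)) v * v x))"
      by (rule fs.sum_representation_eq[symmetric, OF ind]) (use partial_poly_space'[OF \<phi>N] span in auto)
    from fun_cong[OF this, of x] show ?thesis
      by (simp add: sum_fun_apply sum.reindex[OF inj] mult.commute)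
  qed
  have "(\<Sum>a\<in>UNIV. \<phi> a x * (diff_mat \<phi> j *v c) $ a) =
      (\<Sum>b\<in>UNIV. (\<Sum>a\<in>UNIV. \<phi> a x * fs.representation (range \<phi>) (partial j (\<phi> b)) (\<phi> a)) * c $ b)"
    unfolding diff_mat_def matrix_vector_mult_def
    by (simp add: sum_distrib_left sum_distrib_right mult.assoc) (rule sum.swap)
  also have "\<dots> = (\<Sum>b\<in>UNIV. partial j (\<lambda>x. c $ b * \<phi> b x) x)"
    by (simp add: rep partial_cmult poly_space_differentiable[OF \<phi>N] mult.commute)
  also have "\<dots> = partial j (\<lambda>x. \<Sum>b\<in>UNIV. \<phi> b x * c $ b) x"
    by (subst partial_sum[symmetric]) (auto simp: mult.commute intro!: differentiable_mult poly_space_differentiable[OF \<phi>N])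
  finally show ?thesis .
qed

lemma matrix_inv_mult_left: "invertible A \<Longrightarrow> matrix_inv A ** A = mat 1" for A :: "real^'n^'n"
  unfolding invertible_def matrix_inv_def by (drule someI_ex) blast

lemma pos_def_invertible:
  assumes "pos_def A" shows "matrix_inv A ** A = mat 1"
proof -
  have "c = 0" if "A *v c = 0" for c
    using assms that unfolding pos_def_def by (metis inner_zero_right less_irrefl)
  then have "\<exists>B. B ** A = mat 1" by (simp add: matrix_left_invertible_ker)
  then have "invertible A" by (simp add: invertible_left_inverse)
  then show ?thesis by (rule matrix_inv_mult_left)
qed

lemma matrix_vector_mult_minus: "(- A) *v x = - (A *v x)" for A :: "real^'n^'m"
  by (simp add: vec_eq_iff matrix_vector_mult_def sum_negf)

text \<open>On values of a polynomial the projection recovers its coefficients, the surface values in the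
  two blocks of a row cancel, and what remains is the derivative at the volume points and zero at
  the surface points.\<close>

lemma decoupled_op_poly_values:
  assumes \<phi>: "poly_basis N \<phi>" and M: "pos_def (mass_mat \<phi> xq wq)" and p: "p \<in> poly_space N"
  shows "decoupled_op \<phi> xq wq fc xf ws j *v point_values xq xf p =
    (\<chi> r. case r of Inl a \<Rightarrow> partial j p (xq a) | Inr s \<Rightarrow> 0)"
proof -
  obtain c where c: "p = (\<lambda>x. \<Sum>b\<in>UNIV. \<phi> b x * c $ b)" using poly_basis_expand[OF \<phi> p] by blast
  have q: "(\<chi> a. point_values xq xf p $ Inl a) = eval_mat \<phi> xq *v c"
    and f: "(\<chi> s. point_values xq xf p $ Inr s) = eval_mat \<phi> xf *v c"
    by (simp_all add: point_values_def c eval_mat_mult_vec)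
  have P: "proj_mat \<phi> xq wq *v (eval_mat \<phi> xq *v c) = c"
    unfolding proj_mat_def matrix_vector_mul_assoc
    using pos_def_invertible[OF M] unfolding mass_mat_def by (simp add: matrix_mul_assoc)
  have D: "(eval_mat \<phi> xq *v (diff_mat \<phi> j *v c)) $ a = partial j p (xq a)" for a
    using diff_mat_coefficients[OF \<phi>, of "xq a" j c] by (simp add: eval_mat_mult_vec c)
  show ?thesis
    unfolding decoupled_op_def Let_def block_mat_mult_vec q f
    by (simp add: vec_eq_iff matrix_vector_mult_diff_rdistrib matrix_vector_mult_minus scaleR_matrix_vector_assoc[symmetric]
        matrix_vector_mul_assoc[symmetric] P D split: sum.split)
qed

text \<open>Summed over the directions, the derivatives at the volume points give the divergence, so the
  conservation law reduces to a pointwise identity for polynomials.\<close>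

lemma discrete_divergence_zero:
  fixes xq :: "'q::finite \<Rightarrow> real^'n" and xf :: "'s::finite \<Rightarrow> real^'n"
  assumes \<phi>: "poly_basis N \<phi>" and M: "pos_def (mass_mat \<phi> xq wq)" and p: "\<And>j. p j \<in> poly_space N"
    and div: "\<And>x. (\<Sum>j\<in>UNIV. partial j (p j) x) = 0"
  shows "(\<Sum>j\<in>UNIV. decoupled_op \<phi> xq wq fc xf ws j *v point_values xq xf (p j)) = 0"
proof -
  have "(\<Sum>j\<in>UNIV. case r of Inl a \<Rightarrow> partial j (p j) (xq a) | Inr s \<Rightarrow> 0) = 0" for r :: "'q + 's"
    by (cases r) (simp_all add: div)
  then show ?thesis unfolding decoupled_op_poly_values[OF \<phi> M p] by (simp add: vec_eq_iff)
qed

section \<open>Geometric terms as polynomials\<close>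

lemma poly_map_differentiable:
  assumes "\<And>i. (\<lambda>x. \<Phi> x $ i) \<in> poly_space N"
  shows "\<Phi> differentiable (at x)"
  using assms poly_space_differentiable by (subst differentiable_componentwise_within) (auto simp: Basis_vec_def inner_axis)

lemma jacobian_component:
  assumes "\<Phi> differentiable (at x)"
  shows "jacobian \<Phi> (at x) $ c $ a = partial a (\<lambda>y. \<Phi> y $ c) x"
proof -
  have "(\<Phi> has_derivative (\<lambda>h. jacobian \<Phi> (at x) *v h)) (at x)"
    using assms jacobian_works by blast
  then have "((\<lambda>y. \<Phi> y $ c) has_derivative (\<lambda>h. (jacobian \<Phi> (at x) *v h) $ c)) (at x)"
    by (rule bounded_linear.has_derivative[OF bounded_linear_vec_nth])
  from partial_has_derivative[OF this, of a] show ?thesis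
    by (simp add: matrix_vector_mult_basis column_def)
qed

lemma matrix_inv_eqI:
  fixes A B :: "real^'n^'n"
  assumes "A ** B = mat 1" shows "matrix_inv A = B"
proof -
  have "invertible A" using assms by (auto simp: invertible_right_inverse)
  then have "matrix_inv A ** A = mat 1" by (rule matrix_inv_mult_left)
  then have "matrix_inv A ** A ** B = B" by simp
  then show ?thesis using assms by (simp add: matrix_mul_assoc[symmetric])
qed

lemma geo_2:
  fixes \<Phi> :: "real^2 \<Rightarrow> real^2"
  assumes \<Phi>: "\<Phi> differentiable (at x)" and J: "jac_det \<Phi> x \<noteq> 0"
  shows "geo \<Phi> i j x = (if i = 1 then if j = 1 then partial 2 (\<lambda>y. \<Phi> y $ 2) x else - partial 1 (\<lambda>y. \<Phi> y $ 2) x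
     else if j = 1 then - partial 2 (\<lambda>y. \<Phi> y $ 1) x else partial 1 (\<lambda>y. \<Phi> y $ 1) x)"
proof -
  define A where "A = jacobian \<Phi> (at x)"
  have d: "det A \<noteq> 0" using J by (simp add: jac_det_def A_def)
  define B :: "real^2^2" where "B = (\<chi> j i. (if i = 1 then if j = 1 then A$2$2 else - A$2$1
     else if j = 1 then - A$1$2 else A$1$1) / det A)"
  have "A ** B = mat 1"
  proof -
    define D where "D = det A"
    have D: "D = A$1$1 * A$2$2 - A$1$2 * A$2$1" by (simp add: D_def det_2)
    have "(A ** B) $ a $ b = (if a = b then D else 0) / D" for a b
      using exhaust_2[of a] exhaust_2[of b]
      by (auto simp: matrix_matrix_mult_def B_def D_def[symmetric] sum_2 diff_divide_distrib[symmetric]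
          add_divide_distrib[symmetric]) (simp_all add: D algebra_simps)
    with d show ?thesis by (simp add: vec_eq_iff mat_def D_def)
  qed
  then have "matrix_inv A = B" by (rule matrix_inv_eqI)
  then show ?thesis using d
    by (simp add: geo_def jac_det_def A_def[symmetric] B_def)
      (simp add: A_def jacobian_component[OF \<Phi>])
qed

lemma partial_commute_poly: "p \<in> poly_space N \<Longrightarrow> partial i (partial j p) x = partial j (partial i p) x"
  by (rule partial_commute[of UNIV]) (auto intro: smooth_poly)

lemma curl_poly:
  assumes "\<And>c. (\<lambda>y. v y $ c) \<in> poly_space M"
  shows "(\<lambda>x. curl v x $ j) \<in> poly_space (M - 1)"
proof -
  have "\<forall>j. (\<lambda>x. curl v x $ j) \<in> poly_space (M - 1)"
    unfolding forall_3 curl_def vector_3 by (intro conjI poly_space_diff partial_poly_space assms)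
  then show ?thesis by blast
qed

lemma div_curl:
  assumes v: "\<And>c. (\<lambda>y. v y $ c) \<in> poly_space M"
  shows "(\<Sum>j\<in>UNIV. partial j (\<lambda>x. curl v x $ j) x) = 0"
proof -
  have d: "partial i (\<lambda>y. v y $ c) differentiable (at x)" for i c x
    by (rule poly_space_differentiable[OF partial_poly_space[OF v]])
  show ?thesis
    using partial_commute_poly[OF v, of 1 2 3] partial_commute_poly[OF v, of 1 3 2] partial_commute_poly[OF v, of 2 3 1]
    unfolding sum_3 curl_def by (simp add: partial_diff d)
qed

lemma curl_scaled_grad:
  assumes f: "f \<in> poly_space M" and g: "g \<in> poly_space N"
  shows "curl (\<lambda>x. f x *\<^sub>R grad g x) x = cross3 (grad f x) (grad g x)"
proof -
  have d: "f differentiable (at x)" "partial i g differentiable (at x)" for i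
    using f g partial_poly_space[OF g] poly_space_differentiable by blast+
  show ?thesis
    using partial_commute_poly[OF g, of 1 2] partial_commute_poly[OF g, of 1 3] partial_commute_poly[OF g, of 2 3]
    unfolding vec_eq_iff forall_3
    by (simp add: curl_def grad_def cross3_def partial_mult d)
qed

lemma geo_potential_poly:
  assumes "\<And>i. (\<lambda>x. \<Phi> x $ i) \<in> poly_space N"
  shows "(\<lambda>x. geo_potential \<Phi> i x $ c) \<in> poly_space (2 * N)"
proof -
  have "(\<lambda>x. \<Phi> x $ a * partial c (\<lambda>y. \<Phi> y $ b) x) \<in> poly_space (N + N)" for a b
    by (intro poly_space_mult assms partial_poly_space')
  then show ?thesis
    using exhaust_3[of i] by (auto simp: geo_potential_def[abs_def] grad_def mult_2)
qed

text \<open>By \<open>curl (f \<nabla>g) = \<nabla>f \<times> \<nabla>g\<close> the curls of the potentials are the cross products of two rows of the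
  Jacobian matrix. The first potential gives them in the wrong order, hence the sign.\<close>

lemma geo_3_eq_curl:
  fixes \<Phi> :: "real^3 \<Rightarrow> real^3"
  assumes \<Phi>: "\<And>i. (\<lambda>x. \<Phi> x $ i) \<in> poly_space N" and J: "jac_det \<Phi> x \<noteq> 0"
  shows "geo \<Phi> i j x = (if i = 1 then - curl (geo_potential \<Phi> i) x else curl (geo_potential \<Phi> i) x) $ j"
proof -
  have \<Phi>d: "\<Phi> differentiable (at x)" using \<Phi> by (rule poly_map_differentiable)
  define A where "A = jacobian \<Phi> (at x)"
  have d: "det A \<noteq> 0" using J by (simp add: jac_det_def A_def)
  define B :: "real^3^3" where "B = (\<chi> j i. (if i = 1 then cross3 (A$2) (A$3) else if i = 2 then cross3 (A$3) (A$1)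
     else cross3 (A$1) (A$2)) $ j / det A)"
  have "A ** B = mat 1"
  proof -
    define D where "D = det A"
    have D: "D = A$1$1 * A$2$2 * A$3$3 + A$1$2 * A$2$3 * A$3$1 + A$1$3 * A$2$1 * A$3$2
        - A$1$1 * A$2$3 * A$3$2 - A$1$2 * A$2$1 * A$3$3 - A$1$3 * A$2$2 * A$3$1" by (simp add: D_def det_3)
    have "(A ** B) $ a $ b = (A $ a \<bullet> (if b = 1 then cross3 (A$2) (A$3) else if b = 2 then cross3 (A$3) (A$1)
        else cross3 (A$1) (A$2))) / D" for a b
      by (simp add: matrix_matrix_mult_def B_def D_def[symmetric] inner_vec_def sum_divide_distrib)
    also have "\<dots> a b = (if a = b then D else 0) / D" for a b
      using exhaust_3[of a] exhaust_3[of b]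
      by (auto simp: inner_vec_def sum_3 cross_components) (simp_all add: D algebra_simps)
    finally have "(A ** B) $ a $ b = (if a = b then D else 0) / D" for a b .
    with d show ?thesis by (simp add: vec_eq_iff mat_def D_def)
  qed
  then have "matrix_inv A = B" by (rule matrix_inv_eqI)
  then have 1: "geo \<Phi> i j x = (if i = 1 then cross3 (A$2) (A$3) else if i = 2 then cross3 (A$3) (A$1)
     else cross3 (A$1) (A$2)) $ j" using d
    by (simp add: geo_def jac_det_def A_def[symmetric] B_def)
  have A: "A $ c = grad (\<lambda>y. \<Phi> y $ c) x" for c
    by (simp add: vec_eq_iff grad_def A_def jacobian_component[OF \<Phi>d])
  have "curl (geo_potential \<Phi> i) x =
     (if i = 1 then cross3 (A$3) (A$2) else if i = 2 then cross3 (A$3) (A$1) else cross3 (A$1) (A$2))"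
    unfolding geo_potential_def[abs_def] using exhaust_3[of i] by (auto simp: curl_scaled_grad[OF \<Phi> \<Phi>] A)
  with 1 show ?thesis using cross_skew[of "A$3" "A$2"] by (cases "i = 1") auto
qed

lemma interp_vec_poly: "unisolvent N X \<Longrightarrow> (\<lambda>y. interp_vec N X v y $ c) \<in> poly_space N"
  unfolding interp_vec_def by (simp add: interp_works)

text \<open>Taking the curl lowers the degree to \<open>N\<close>, where interpolation is the identity. Without this the
  interpolated field need not be divergence free.\<close>

lemma approx_geo3_eq_curl:
  assumes "unisolvent N X" "unisolvent (N + 1) X'"
  shows "approx_geo3 N X X' \<Phi> i j = (\<lambda>x. (if i = 1 then - curl (interp_vec (N + 1) X' (geo_potential \<Phi> i)) x
                      else curl (interp_vec (N + 1) X' (geo_potential \<Phi> i)) x) $ j)"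
proof -
  have "(\<lambda>x. curl (interp_vec (N + 1) X' (geo_potential \<Phi> i)) x $ j) \<in> poly_space N" for j
    using curl_poly[of _ "N + 1"] interp_vec_poly[OF assms(2)] by auto
  then have "(\<lambda>x. (if i = 1 then - curl (interp_vec (N + 1) X' (geo_potential \<Phi> i)) x
                      else curl (interp_vec (N + 1) X' (geo_potential \<Phi> i)) x) $ j) \<in> poly_space N"
    by (cases "i = 1") (simp_all add: poly_space_uminus)
  then show ?thesis unfolding approx_geo3_def by (rule interp_poly[OF assms(1)])
qed

lemma approx_geo3_poly:
  "unisolvent N X \<Longrightarrow> approx_geo3 N X X' \<Phi> i j \<in> poly_space N"
  unfolding approx_geo3_def by (rule interp_works)

lemma approx_geo3_div:
  assumes X: "unisolvent N X" "unisolvent (N + 1) X'"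
  shows "(\<Sum>j\<in>UNIV. partial j (approx_geo3 N X X' \<Phi> i j) x) = 0"
proof -
  define v where "v = interp_vec (N + 1) X' (geo_potential \<Phi> i)"
  have v: "(\<lambda>y. v y $ c) \<in> poly_space (N + 1)" for c unfolding v_def by (rule interp_vec_poly[OF X(2)])
  have d: "(\<lambda>x. curl v x $ j) differentiable (at x)" for j
    by (rule poly_space_differentiable[OF curl_poly[OF v]])
  show ?thesis
    unfolding approx_geo3_eq_curl[OF X] v_def[symmetric] using div_curl[OF v, of x]
    by (cases "i = 1") (simp_all add: partial_uminus[OF d] sum_negf)
qed



section \<open>Faces and barycentric coordinates\<close>

definition bary :: "'n option \<Rightarrow> real^'n \<Rightarrow> real" where
  "bary v x = (case v of None \<Rightarrow> 1 - (\<Sum>i\<in>UNIV. x $ i) | Some i \<Rightarrow> x $ i)"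

lemma sum_option: "(\<Sum>v\<in>UNIV. F v) = F None + (\<Sum>i\<in>UNIV. F (Some i))" for F :: "'n::finite option \<Rightarrow> 'a::comm_monoid_add"
  by (simp add: UNIV_option_conv sum.reindex)

lemma sum_bary: "(\<Sum>v\<in>UNIV. bary v x) = 1"
  by (simp add: sum_option bary_def)

lemma bary_combination: "(\<Sum>v\<in>UNIV. bary v x *\<^sub>R vertex v) = x"
  by (simp add: sum_option bary_def vertex_def basis_expansion scalar_mult_eq_scaleR[symmetric])

lemma bary_vertex: "bary v (vertex w) = (if v = w then 1 else 0)"
proof (cases w)
  case None then show ?thesis by (cases v) (auto simp: bary_def vertex_def)
next
  case (Some i)
  have "(\<Sum>j\<in>UNIV. axis i (1::real) $ j) = 1" by (simp add: axis_def)
  with Some show ?thesis by (cases v) (auto simp: bary_def vertex_def axis_def)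
qed

lemma bary_affine: "bary v ((1 - s) *\<^sub>R x + s *\<^sub>R y) = (1 - s) * bary v x + s * bary v y"
proof (cases v)
  case None
  then show ?thesis by (simp add: bary_def sum.distrib sum_distrib_left[symmetric]) (simp add: algebra_simps)
qed (simp add: bary_def)

lemma face_eq_bary: "face f = {x. (\<forall>v. 0 \<le> bary v x) \<and> bary f x = 0}"
proof
  show "face f \<subseteq> {x. (\<forall>v. 0 \<le> bary v x) \<and> bary f x = 0}"
    unfolding face_def
  proof (rule hull_minimal)
    show "vertex ` (- {f}) \<subseteq> {x. (\<forall>v. 0 \<le> bary v x) \<and> bary f x = 0}" by (auto simp: bary_vertex)
    show "convex {x. (\<forall>v. 0 \<le> bary v x) \<and> bary f x = 0}"
      unfolding convex_alt by (auto simp: bary_affine)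
  qed
  show "{x. (\<forall>v. 0 \<le> bary v x) \<and> bary f x = 0} \<subseteq> face f"
  proof clarify
    fix x assume x: "\<forall>v. 0 \<le> bary v x" "bary f x = 0"
    have "(\<Sum>v\<in>-{f}. bary v x *\<^sub>R vertex v) \<in> face f"
      unfolding face_def
    proof (rule convex_sum)
      show "(\<Sum>v\<in>-{f}. bary v x) = 1" using sum_bary[of x] x by (simp add: sum.remove[of UNIV f] Compl_eq_Diff_UNIV)
    qed (use x in \<open>auto intro: hull_inc\<close>)
    moreover have "(\<Sum>v\<in>-{f}. bary v x *\<^sub>R vertex v) = x"
      using bary_combination[of x] x by (simp add: sum.remove[of UNIV f] Compl_eq_Diff_UNIV)
    ultimately show "x \<in> face f" by simp
  qed
qed

lemma face_subset_simplex: "face f \<subseteq> ref_simplex"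
  unfolding face_def ref_simplex_def by (rule hull_mono) auto

lemma vertex_in_face: "v \<noteq> f \<Longrightarrow> vertex v \<in> face f"
  unfolding face_def by (rule hull_inc) auto

text \<open>On a shared face two neighbouring mappings differ by such a substitution, since watertightness
  identifies points by their barycentric coordinates.\<close>

definition vertex_map :: "('n option \<Rightarrow> 'n option) \<Rightarrow> real^'n \<Rightarrow> real^'n" where
  "vertex_map \<pi> x = (\<Sum>v\<in>UNIV. bary v x *\<^sub>R vertex (\<pi> v))"

lemma vertex_map_vertex: "vertex_map \<pi> (vertex v) = vertex (\<pi> v)"
  by (simp add: vertex_map_def bary_vertex if_distrib[of "\<lambda>c. c *\<^sub>R _"] cong: if_cong)

lemma vertex_map_affine: "vertex_map \<pi> ((1 - s) *\<^sub>R x + s *\<^sub>R y) = (1 - s) *\<^sub>R vertex_map \<pi> x + s *\<^sub>R vertex_map \<pi> y"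
  by (simp add: vertex_map_def bary_affine sum.distrib scaleR_sum_right scaleR_add_left)

lemma vertex_map_poly: "(\<lambda>x. vertex_map \<pi> x $ i) \<in> poly_space 1"
proof -
  have "bary v \<in> poly_space 1" for v :: "'a option"
  proof (cases v)
    case None
    then have "bary v = (\<lambda>x. 1 - (\<Sum>i\<in>UNIV. x $ i))" by (auto simp: bary_def)
    then show ?thesis by (simp only:) (intro poly_space_diff poly_space_const poly_space_sum poly_space_coord order_refl)
  next
    case (Some i)
    then have "bary v = (\<lambda>x. x $ i)" by (auto simp: bary_def)
    then show ?thesis by (simp only:) (intro poly_space_coord order_refl)
  qed
  then have "(\<lambda>x. \<Sum>v\<in>UNIV. vertex (\<pi> v) $ i * bary v x) \<in> poly_space 1"
    by (intro poly_space_sum poly_space_scale)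
  then show ?thesis by (simp add: vertex_map_def mult.commute)
qed

lemma vertex_map_face:
  assumes \<pi>: "bij \<pi>" and x: "x \<in> face f"
  shows "vertex_map \<pi> x \<in> face (\<pi> f)"
proof -
  have b: "\<And>v. 0 \<le> bary v x" "bary f x = 0" using x by (auto simp: face_eq_bary)
  have "vertex_map \<pi> x = (\<Sum>v\<in>-{f}. bary v x *\<^sub>R vertex (\<pi> v))"
    unfolding vertex_map_def using b by (simp add: sum.remove[of UNIV f] Compl_eq_Diff_UNIV)
  also have "\<dots> \<in> face (\<pi> f)"
    unfolding face_def
  proof (rule convex_sum)
    show "(\<Sum>v\<in>-{f}. bary v x) = 1" using sum_bary[of x] b by (simp add: sum.remove[of UNIV f] Compl_eq_Diff_UNIV)
    show "vertex (\<pi> v) \<in> convex hull (vertex ` (- {\<pi> f}))" if "v \<in> - {f}" for v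
      using that \<pi> by (intro hull_inc) (auto simp: bij_def inj_eq)
  qed (use b in auto)
  finally show ?thesis .
qed

section \<open>Tangential traces\<close>

definition dir_deriv :: "real^'n \<Rightarrow> (real^'n \<Rightarrow> real) \<Rightarrow> real^'n \<Rightarrow> real" where
  "dir_deriv t f x = (\<Sum>i\<in>UNIV. t $ i * partial i f x)"

lemma dir_deriv_diff: "dir_deriv (s - t) f x = dir_deriv s f x - dir_deriv t f x"
  by (simp add: dir_deriv_def algebra_simps sum_subtractf)

lemma has_derivative_segment:
  assumes "f differentiable (at x)"
  shows "((\<lambda>s. f ((1 - s) *\<^sub>R x + s *\<^sub>R y)) has_vector_derivative dir_deriv (y - x) f x) (at (0::real) within S)"
proof -
  have "((\<lambda>s. (1 - s) *\<^sub>R x + s *\<^sub>R y) has_derivative (\<lambda>h. h *\<^sub>R (y - x))) (at (0::real) within S)"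
    by (auto intro!: derivative_eq_intros simp: algebra_simps)
  moreover have "(f has_derivative (\<lambda>v. dir_deriv v f x)) (at ((1 - 0) *\<^sub>R x + 0 *\<^sub>R y))"
    using has_derivative_partials[OF assms] by (simp add: dir_deriv_def)
  ultimately have "((\<lambda>s. f ((1 - s) *\<^sub>R x + s *\<^sub>R y)) has_derivative (\<lambda>h. dir_deriv (h *\<^sub>R (y - x)) f x)) (at 0 within S)"
    by (rule has_derivative_compose)
  then show ?thesis by (simp add: has_vector_derivative_def dir_deriv_def sum_distrib_left mult.assoc)
qed

text \<open>The derivative at a point of the face is tested on the segments to the vertices of the face. They
  stay in the face, even from a point of its boundary, and their directions span all edge directions.\<close>

lemma dir_deriv_face:
  fixes p q :: "real^'n \<Rightarrow> real"
  assumes p: "p \<in> poly_space M" and q: "q \<in> poly_space M'"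
    and eq: "\<And>x. x \<in> face f \<Longrightarrow> p x = q (vertex_map \<pi> x)"
    and x: "x \<in> face f" and a: "a \<noteq> f" and b: "b \<noteq> f"
  shows "dir_deriv (vertex b - vertex a) p x = dir_deriv (vertex (\<pi> b) - vertex (\<pi> a)) q (vertex_map \<pi> x)"
proof -
  let ?T = "vertex_map \<pi>"
  have to_vertex: "dir_deriv (vertex v - x) p x = dir_deriv (vertex (\<pi> v) - ?T x) q (?T x)" if v: "v \<noteq> f" for v
  proof -
    have "((\<lambda>s. p ((1 - s) *\<^sub>R x + s *\<^sub>R vertex v)) has_vector_derivative dir_deriv (vertex v - x) p x) (at 0 within cbox 0 1)"
      by (rule has_derivative_segment[OF poly_space_differentiable[OF p]])
    moreover have "((\<lambda>s. q ((1 - s) *\<^sub>R ?T x + s *\<^sub>R vertex (\<pi> v))) has_vector_derivative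
        dir_deriv (vertex (\<pi> v) - ?T x) q (?T x)) (at 0 within cbox 0 1)"
      by (rule has_derivative_segment[OF poly_space_differentiable[OF q]])
    moreover have "p ((1 - s) *\<^sub>R x + s *\<^sub>R vertex v) = q ((1 - s) *\<^sub>R ?T x + s *\<^sub>R vertex (\<pi> v))" if "s \<in> cbox 0 1" for s
    proof -
      have "(1 - s) *\<^sub>R x + s *\<^sub>R vertex v \<in> face f"
        using that x vertex_in_face[OF v] unfolding face_def by (intro convexD[OF convex_convex_hull]) auto
      from eq[OF this] show ?thesis by (simp add: vertex_map_affine vertex_map_vertex)
    qed
    ultimately show ?thesis
      by (intro vector_derivative_unique_within_closed_interval[of 0 1 0 "\<lambda>s. p ((1 - s) *\<^sub>R x + s *\<^sub>R vertex v)"])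
        (auto elim!: has_vector_derivative_transform[rotated 2])
  qed
  have "dir_deriv (vertex b - vertex a) p x = dir_deriv (vertex b - x) p x - dir_deriv (vertex a - x) p x"
    by (simp add: dir_deriv_diff)
  also have "\<dots> = dir_deriv (vertex (\<pi> b) - vertex (\<pi> a)) q (?T x)"
    by (simp add: to_vertex a b) (simp add: dir_deriv_diff)
  finally show ?thesis .
qed

definition tangentially_matched ::
  "'n option \<Rightarrow> ('n option \<Rightarrow> 'n option) \<Rightarrow> (real^'n \<Rightarrow> real^'n) \<Rightarrow> (real^'n \<Rightarrow> real^'n) \<Rightarrow> bool" where
  "tangentially_matched f \<pi> v w \<longleftrightarrow> (\<forall>x\<in>face f. \<forall>a b. a \<noteq> f \<longrightarrow> b \<noteq> f \<longrightarrow>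
     v x \<bullet> (vertex b - vertex a) = w (vertex_map \<pi> x) \<bullet> (vertex (\<pi> b) - vertex (\<pi> a)))"

lemma poly_inner_const:
  assumes "\<And>c. (\<lambda>y. v y $ c) \<in> poly_space M"
  shows "(\<lambda>y. v y \<bullet> t) \<in> poly_space M"
proof -
  have "(\<lambda>y. \<Sum>c\<in>UNIV. t $ c * v y $ c) \<in> poly_space M" by (intro poly_space_sum poly_space_scale assms)
  then show ?thesis by (simp add: inner_vec_def mult.commute)
qed

lemma curl_inner_cross:
  assumes v: "\<And>c. (\<lambda>y. v y $ c) \<in> poly_space M"
  shows "curl v x \<bullet> cross3 s t = dir_deriv s (\<lambda>y. v y \<bullet> t) x - dir_deriv t (\<lambda>y. v y \<bullet> s) x"
proof -
  have "partial i (\<lambda>y. v y \<bullet> t) x = (\<Sum>c\<in>UNIV. t $ c * partial i (\<lambda>y. v y $ c) x)" for i t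
  proof -
    have "partial i (\<lambda>y. v y \<bullet> t) x = partial i (\<lambda>y. \<Sum>c\<in>UNIV. t $ c * v y $ c) x"
      by (simp add: inner_vec_def mult.commute)
    also have "\<dots> = (\<Sum>c\<in>UNIV. t $ c * partial i (\<lambda>y. v y $ c) x)"
      by (subst partial_sum) (auto simp: partial_cmult[OF poly_space_differentiable[OF v]] intro!: differentiable_mult poly_space_differentiable[OF v])
    finally show ?thesis .
  qed
  then show ?thesis
    by (simp add: dir_deriv_def sum_3 inner_vec_def curl_def cross_components algebra_simps)
qed

lemma curl_face:
  assumes v: "\<And>c. (\<lambda>y. v y $ c) \<in> poly_space M" and w: "\<And>c. (\<lambda>y. w y $ c) \<in> poly_space M'"
    and match: "tangentially_matched f \<pi> v w" and x: "x \<in> face f" and abc: "a \<noteq> f" "b \<noteq> f" "c \<noteq> f"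
  shows "curl v x \<bullet> cross3 (vertex b - vertex a) (vertex c - vertex a) =
    curl w (vertex_map \<pi> x) \<bullet> cross3 (vertex (\<pi> b) - vertex (\<pi> a)) (vertex (\<pi> c) - vertex (\<pi> a))"
  unfolding curl_inner_cross[OF v] curl_inner_cross[OF w]
  using match abc unfolding tangentially_matched_def
  by (intro arg_cong2[where f = "(-)"] dir_deriv_face[OF poly_inner_const[OF v] poly_inner_const[OF w] _ x]) auto

definition scaled_normal :: "'n option \<Rightarrow> real^'n" where
  "scaled_normal f = (\<chi> j. ref_scaled_normal f j)"

text \<open>The scaled reference normal is the vector area of the parallelogram spanned by two edges of the
  face. Its sign depends on the numbering of the vertices, so that the lemma leaves it open.\<close>

lemma scaled_normal_eq_cross:
  fixes f :: "3 option"
  assumes "distinct [f, a, b, c]"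
  shows "scaled_normal f = cross3 (vertex b - vertex a) (vertex c - vertex a) \<or>
     scaled_normal f = - cross3 (vertex b - vertex a) (vertex c - vertex a)"
proof -
  have sn: "scaled_normal f = (case f of None \<Rightarrow> (\<chi> i. 1) | Some i \<Rightarrow> - axis i 1)"
    by (auto simp: scaled_normal_def ref_scaled_normal_def ref_normal_def ref_face_jac_def vec_eq_iff split: option.split)
  have ex: "v = None \<or> v = Some 1 \<or> v = Some 2 \<or> v = Some 3" for v :: "3 option"
    using exhaust_3 by (cases v) auto
  show ?thesis
    using assms ex[of f] ex[of a] ex[of b] ex[of c] unfolding sn
    by (elim disjE; simp add: vertex_def vec_eq_iff forall_3 cross_components axis_def)
qed

lemma scaled_normal_nonzero: "scaled_normal f \<noteq> (0 :: real^'n)"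
proof (cases f)
  case None
  then have "scaled_normal f $ i = 1" for i :: 'n
    by (simp add: scaled_normal_def ref_scaled_normal_def ref_normal_def ref_face_jac_def)
  then show ?thesis by (metis zero_index zero_neq_one)
next
  case (Some i)
  then have "scaled_normal f $ i = - 1"
    by (simp add: scaled_normal_def ref_scaled_normal_def ref_normal_def ref_face_jac_def)
  then show ?thesis by auto
qed

text \<open>The normal component of a curl on a face is a surface curl, so that it is determined by the
  tangential trace. Renumbering the vertices transforms it by a sign, the relative orientation of
  the two faces.\<close>

lemma curl_normal_face:
  fixes f :: "3 option"
  assumes \<pi>: "bij \<pi>"
  obtains s where "s = 1 \<or> s = (-1::real)"
    "\<And>v w M M' x. (\<And>c. (\<lambda>y. v y $ c) \<in> poly_space M) \<Longrightarrow> (\<And>c. (\<lambda>y. w y $ c) \<in> poly_space M') \<Longrightarrow>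
      tangentially_matched f \<pi> v w \<Longrightarrow> x \<in> face f \<Longrightarrow>
      curl v x \<bullet> scaled_normal f = s * (curl w (vertex_map \<pi> x) \<bullet> scaled_normal (\<pi> f))"
proof -
  obtain a b c where d: "distinct [f, a, b, c]"
  proof -
    have "distinct [None, Some 1, Some 2, Some (3::3)]" by simp
    moreover have "f = None \<or> f = Some 1 \<or> f = Some 2 \<or> f = Some 3" using exhaust_3 by (cases f) auto
    ultimately show thesis
      using that[of "Some 1" "Some 2" "Some 3"] that[of None "Some 2" "Some 3"]
        that[of None "Some 1" "Some 3"] that[of None "Some 1" "Some 2"] by auto
  qed
  have d': "distinct [\<pi> f, \<pi> a, \<pi> b, \<pi> c]" using d \<pi> by (auto simp: bij_def inj_eq)
  let ?n = "cross3 (vertex b - vertex a) (vertex c - vertex a)"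
  let ?m = "cross3 (vertex (\<pi> b) - vertex (\<pi> a)) (vertex (\<pi> c) - vertex (\<pi> a))"
  obtain e where e: "e = 1 \<or> e = (-1::real)" "scaled_normal f = e *\<^sub>R ?n"
    using scaled_normal_eq_cross[OF d] by (metis scaleR_one scaleR_minus1_left)
  obtain e' where e': "e' = 1 \<or> e' = (-1::real)" "scaled_normal (\<pi> f) = e' *\<^sub>R ?m"
    using scaled_normal_eq_cross[OF d'] by (metis scaleR_one scaleR_minus1_left)
  show thesis
  proof (rule that[of "e * e'"])
    show "e * e' = 1 \<or> e * e' = -1" using e e' by auto
    fix v w M M' x
    assume *: "\<And>c. (\<lambda>y. v y $ c) \<in> poly_space M" "\<And>c. (\<lambda>y. w y $ c) \<in> poly_space M'"
      "tangentially_matched f \<pi> v w" "x \<in> face f"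
    have "curl v x \<bullet> ?n = curl w (vertex_map \<pi> x) \<bullet> ?m"
      by (rule curl_face[OF *]) (use d in auto)
    then show "curl v x \<bullet> scaled_normal f = e * e' * (curl w (vertex_map \<pi> x) \<bullet> scaled_normal (\<pi> f))"
      using e e' by auto
  qed
qed

section \<open>Scaled normals of neighbouring elements\<close>

text \<open>The tangential trace of a potential involves only traces and tangential derivatives of the
  mapping, which coincide on a shared face.\<close>

lemma geo_potential_inner: "geo_potential \<Phi> i x \<bullet> t =
    (if i = 1 then \<Phi> x $ 3 * dir_deriv t (\<lambda>y. \<Phi> y $ 2) x
     else if i = 2 then \<Phi> x $ 3 * dir_deriv t (\<lambda>y. \<Phi> y $ 1) x
     else \<Phi> x $ 1 * dir_deriv t (\<lambda>y. \<Phi> y $ 2) x)"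
  by (simp add: geo_potential_def dir_deriv_def grad_def inner_vec_def sum_distrib_left mult_ac)

lemma geo_potential_matched:
  assumes \<Phi>: "\<And>i. (\<lambda>x. \<Phi> x $ i) \<in> poly_space N" and \<Psi>: "\<And>i. (\<lambda>x. \<Psi> x $ i) \<in> poly_space N"
    and eq: "\<And>x. x \<in> face f \<Longrightarrow> \<Phi> x = \<Psi> (vertex_map \<pi> x)"
  shows "tangentially_matched f \<pi> (geo_potential \<Phi> i) (geo_potential \<Psi> i)"
proof -
  have "dir_deriv (vertex b - vertex a) (\<lambda>y. \<Phi> y $ c) x =
      dir_deriv (vertex (\<pi> b) - vertex (\<pi> a)) (\<lambda>y. \<Psi> y $ c) (vertex_map \<pi> x)"
    if "x \<in> face f" "a \<noteq> f" "b \<noteq> f" for x a b c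
    by (rule dir_deriv_face[OF \<Phi> \<Psi> _ that]) (simp add: eq)
  then show ?thesis by (simp add: tangentially_matched_def geo_potential_inner eq)
qed

lemma interp_vec_inner:
  assumes "unisolvent N X"
  shows "interp_vec N X v x \<bullet> t = interp N X (\<lambda>y. v y \<bullet> t) x"
proof -
  have "interp N X (\<lambda>y. v y \<bullet> t) x = interp N X (\<lambda>y. \<Sum>c\<in>UNIV. t $ c * v y $ c) x"
    by (simp add: inner_vec_def mult.commute)
  then show ?thesis by (simp add: interp_sum[OF assms] interp_vec_def inner_vec_def mult.commute)
qed

text \<open>The traces of the interpolants are determined by the values at the nodes on the face, and these
  nodes are matched themselves.\<close>

lemma interp_vec_matched:
  assumes X: "interpolation_nodes N X" and nodes: "vertex_map \<pi> ` (X \<inter> face f) \<subseteq> X"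
    and match: "tangentially_matched f \<pi> v w"
  shows "tangentially_matched f \<pi> (interp_vec N X v) (interp_vec N X w)"
  unfolding tangentially_matched_def
proof (intro ballI allI impI)
  fix x a b assume x: "x \<in> face f" and ab: "a \<noteq> f" "b \<noteq> f"
  have uni: "unisolvent N X" using X by (simp add: interpolation_nodes_def)
  let ?p = "interp N X (\<lambda>y. v y \<bullet> (vertex b - vertex a))"
  let ?q = "interp N X (\<lambda>y. w y \<bullet> (vertex (\<pi> b) - vertex (\<pi> a)))"
  have "(\<lambda>x. ?p x - ?q (vertex_map \<pi> x)) x = 0"
  proof (rule zero_on_face_if_zero_at_nodes[OF X _ _ x])
    show "(\<lambda>x. ?p x - ?q (vertex_map \<pi> x)) \<in> poly_space N"
      by (intro poly_space_diff poly_space_affine_comp[OF vertex_map_poly] interp_works[OF uni])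
    fix z assume z: "z \<in> X \<inter> face f"
    then have "vertex_map \<pi> z \<in> X" using nodes by auto
    then show "?p z - ?q (vertex_map \<pi> z) = 0"
      using z match ab by (simp add: interp_works(2)[OF uni] tangentially_matched_def)
  qed
  then show "interp_vec N X v x \<bullet> (vertex b - vertex a) =
      interp_vec N X w (vertex_map \<pi> x) \<bullet> (vertex (\<pi> b) - vertex (\<pi> a))"
    by (simp add: interp_vec_inner[OF uni])
qed

lemma approx_scaled_normal_eq: "approx_scaled_normal G f x $ i = (\<Sum>j\<in>UNIV. G i j x * scaled_normal f $ j)"
  by (simp add: approx_scaled_normal_def scaled_normal_def ref_scaled_normal_def mult.assoc)

text \<open>The exact scaled normal is the image of the reference normal under the cofactor matrix, which is
  invertible.\<close>

lemma geo_normal_nonzero: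
  fixes \<Phi> :: "real^'n \<Rightarrow> real^'n"
  assumes J: "jac_det \<Phi> x \<noteq> 0"
  shows "approx_scaled_normal (geo \<Phi>) f x \<noteq> 0"
proof
  let ?A = "jacobian \<Phi> (at x)"
  assume 0: "approx_scaled_normal (geo \<Phi>) f x = 0"
  have "(\<Sum>j\<in>UNIV. matrix_inv ?A $ j $ i * scaled_normal f $ j) = 0" for i
  proof -
    have "jac_det \<Phi> x * (\<Sum>j\<in>UNIV. matrix_inv ?A $ j $ i * scaled_normal f $ j) = approx_scaled_normal (geo \<Phi>) f x $ i"
      by (simp add: approx_scaled_normal_eq geo_def sum_distrib_left mult.assoc)
    with 0 J show ?thesis by simp
  qed
  then have "scaled_normal f v* matrix_inv ?A = 0" by (simp add: vec_eq_iff vector_matrix_mult_def mult.commute)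
  moreover have "invertible ?A" using J by (simp add: jac_det_def invertible_det_nz)
  then have "matrix_inv ?A ** ?A = mat 1" by (rule matrix_inv_mult_left)
  then have "scaled_normal f = (scaled_normal f v* matrix_inv ?A) v* ?A" by (simp add: vector_matrix_mul_assoc)
  ultimately show False using scaled_normal_nonzero[of f] by (simp add: vector_matrix_mult_def vec_eq_iff)
qed

text \<open>The exact and the approximate scaled normals transform with the same sign from one side of a
  shared face to the other. The exact ones are opposite and do not vanish, hence that sign is
  negative.\<close>

lemma approx_scaled_normals_opposite:
  fixes \<Phi> :: "nat \<Rightarrow> real^3 \<Rightarrow> real^3"
  assumes X: "interpolation_nodes N X" and X': "interpolation_nodes (N + 1) X'"
    and mesh: "isoparametric_mesh N \<Omega> K \<Phi>" and wt: "watertight X X' fc xf K \<Phi>"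
    and ex: "exact_scaled_normals K \<Phi>" and sh: "shared_face K \<Phi> k f l g"
    and x: "x \<in> face f" and y: "y \<in> face g" and xy: "\<Phi> k x = \<Phi> l y"
  shows "approx_scaled_normal (approx_geo3 N X X' (\<Phi> k)) f x = - approx_scaled_normal (approx_geo3 N X X' (\<Phi> l)) g y"
proof -
  have uni: "unisolvent N X" "unisolvent (N + 1) X'" using X X' by (auto simp: interpolation_nodes_def)
  have kl: "k < K" "l < K" using sh by (auto simp: shared_face_def)
  have poly: "\<And>i. (\<lambda>x. \<Phi> k x $ i) \<in> poly_space N" "\<And>i. (\<lambda>x. \<Phi> l x $ i) \<in> poly_space N"
    and inj: "inj_on (\<Phi> l) ref_simplex"
    and J: "\<And>z. z \<in> ref_simplex \<Longrightarrow> jac_det (\<Phi> k) z \<noteq> 0" "\<And>z. z \<in> ref_simplex \<Longrightarrow> jac_det (\<Phi> l) z \<noteq> 0"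
    using mesh kl unfolding isoparametric_mesh_def by (auto simp: less_imp_neq[symmetric])
  have "\<exists>\<pi>. bij \<pi> \<and> \<pi> f = g \<and>
      (\<forall>b. (\<forall>v. 0 \<le> b v) \<and> b f = 0 \<and> (\<Sum>v\<in>UNIV. b v) = 1 \<longrightarrow>
        \<Phi> k (\<Sum>v\<in>UNIV. b v *\<^sub>R vertex v) = \<Phi> l (\<Sum>v\<in>UNIV. b v *\<^sub>R vertex (\<pi> v)))"
    and nodes: "\<Phi> k ` (X' \<inter> face f) = \<Phi> l ` (X' \<inter> face g)"
    using wt[unfolded watertight_def, THEN spec[of _ k], THEN spec[of _ f], THEN spec[of _ l], THEN spec[of _ g], THEN mp, OF sh]
    by blast+
  then obtain \<pi> where \<pi>: "bij \<pi>" "\<pi> f = g"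
    and agree: "\<And>b. (\<forall>v. 0 \<le> b v) \<and> b f = 0 \<and> (\<Sum>v\<in>UNIV. b v) = 1 \<Longrightarrow>
        \<Phi> k (\<Sum>v\<in>UNIV. b v *\<^sub>R vertex v) = \<Phi> l (\<Sum>v\<in>UNIV. b v *\<^sub>R vertex (\<pi> v))"
    by blast
  let ?T = "vertex_map \<pi>"
  have eq: "\<Phi> k z = \<Phi> l (?T z)" if "z \<in> face f" for z
    using agree[of "\<lambda>v. bary v z"] that by (simp add: face_eq_bary sum_bary bary_combination vertex_map_def)
  have unique: "z' = ?T z" if "z \<in> face f" "z' \<in> face g" "\<Phi> k z = \<Phi> l z'" for z z'
    using inj_onD[OF inj, of z' "?T z"] that eq[OF that(1)] vertex_map_face[OF \<pi>(1) that(1)] \<pi>(2) face_subset_simplex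
    by auto
  have y: "y = ?T x" using unique x y xy by blast
  have nodesT: "?T ` (X' \<inter> face f) \<subseteq> X'"
  proof clarify
    fix z assume z: "z \<in> X'" "z \<in> face f"
    then obtain z' where "z' \<in> X' \<inter> face g" "\<Phi> k z = \<Phi> l z'" using nodes by blast
    with unique z show "?T z \<in> X'" by blast
  qed
  obtain s where s: "s = 1 \<or> s = (-1::real)"
    and curl: "\<And>v w M M' x. (\<And>c. (\<lambda>y. v y $ c) \<in> poly_space M) \<Longrightarrow> (\<And>c. (\<lambda>y. w y $ c) \<in> poly_space M') \<Longrightarrow>
      tangentially_matched f \<pi> v w \<Longrightarrow> x \<in> face f \<Longrightarrow>
      curl v x \<bullet> scaled_normal f = s * (curl w (?T x) \<bullet> scaled_normal (\<pi> f))"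
    using curl_normal_face[OF \<pi>(1)] by blast
  have match: "tangentially_matched f \<pi> (geo_potential (\<Phi> k) i) (geo_potential (\<Phi> l) i)" for i
    by (rule geo_potential_matched[OF poly eq])
  have approx: "approx_scaled_normal (approx_geo3 N X X' (\<Phi> k)) f x = s *\<^sub>R approx_scaled_normal (approx_geo3 N X X' (\<Phi> l)) g y"
  proof -
    have "approx_scaled_normal (approx_geo3 N X X' (\<Phi> m)) f z $ i =
        (if i = 1 then -1 else 1) * (curl (interp_vec (N + 1) X' (geo_potential (\<Phi> m) i)) z \<bullet> scaled_normal f)" for m f z i
      unfolding approx_scaled_normal_eq approx_geo3_eq_curl[OF uni]
      by (cases "i = 1") (simp_all add: inner_vec_def sum_negf)
    moreover have "curl (interp_vec (N + 1) X' (geo_potential (\<Phi> k) i)) x \<bullet> scaled_normal f =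
        s * (curl (interp_vec (N + 1) X' (geo_potential (\<Phi> l) i)) y \<bullet> scaled_normal g)" for i
      unfolding y \<pi>(2)[symmetric]
      by (rule curl[OF interp_vec_poly[OF uni(2)] interp_vec_poly[OF uni(2)] interp_vec_matched[OF X' nodesT match] x])
    ultimately have "approx_scaled_normal (approx_geo3 N X X' (\<Phi> k)) f x $ i =
        s * approx_scaled_normal (approx_geo3 N X X' (\<Phi> l)) g y $ i" for i
      by (simp only: mult.left_commute)
    then show ?thesis unfolding vec_eq_iff vector_scaleR_component real_scaleR_def by blast
  qed
  have exact: "approx_scaled_normal (geo (\<Phi> k)) f x = s *\<^sub>R approx_scaled_normal (geo (\<Phi> l)) g y"
  proof -
    have curl_form: "approx_scaled_normal (geo (\<Phi> m)) f z $ i =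
        (if i = 1 then -1 else 1) * (curl (geo_potential (\<Phi> m) i) z \<bullet> scaled_normal f)"
      if "\<And>i. (\<lambda>x. \<Phi> m x $ i) \<in> poly_space N" "jac_det (\<Phi> m) z \<noteq> 0" for m f z i
      unfolding approx_scaled_normal_eq geo_3_eq_curl[OF that]
      by (cases "i = 1") (simp_all add: inner_vec_def sum_negf)
    have "curl (geo_potential (\<Phi> k) i) x \<bullet> scaled_normal f = s * (curl (geo_potential (\<Phi> l) i) y \<bullet> scaled_normal g)" for i
      unfolding y \<pi>(2)[symmetric]
      by (rule curl[OF geo_potential_poly[OF poly(1)] geo_potential_poly[OF poly(2)] match x])
    moreover have J': "jac_det (\<Phi> k) x \<noteq> 0" "jac_det (\<Phi> l) y \<noteq> 0"
      using J x \<open>y \<in> face g\<close> face_subset_simplex by blast+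
    ultimately have "approx_scaled_normal (geo (\<Phi> k)) f x $ i = s * approx_scaled_normal (geo (\<Phi> l)) g y $ i" for i
      by (simp only: mult.left_commute curl_form[OF poly(1) J'(1)] curl_form[OF poly(2) J'(2)])
    then show ?thesis unfolding vec_eq_iff vector_scaleR_component real_scaleR_def by blast
  qed
  have "approx_scaled_normal (geo (\<Phi> m)) f z = face_jac (\<Phi> m) f z *\<^sub>R face_normal (\<Phi> m) f z"
    if "m < K" "z \<in> face f" for m f z
    using ex that unfolding exact_scaled_normals_def by (simp add: vec_eq_iff approx_scaled_normal_def mult.commute)
  then have "approx_scaled_normal (geo (\<Phi> k)) f x = - approx_scaled_normal (geo (\<Phi> l)) g y"
    using ex sh x \<open>y \<in> face g\<close> xy kl unfolding exact_scaled_normals_def by simp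
  moreover have "approx_scaled_normal (geo (\<Phi> l)) g y \<noteq> 0"
    using J(2) \<open>y \<in> face g\<close> face_subset_simplex by (intro geo_normal_nonzero) blast
  \<comment> \<open>With \<open>s = 1\<close> a nonzero vector would be its own negative.\<close>
  ultimately have "s = -1" using exact s by (auto simp: eq_neg_iff_add_eq_0 simp flip: scaleR_2)
  with approx show ?thesis by simp
qed



section \<open>Comparison of quadratic forms on a polynomial space\<close>

text \<open>The laws are required on a polynomial space only, because integrals are additive only for integrable
  functions.\<close>

definition psd_form :: "nat \<Rightarrow> ((real^'n \<Rightarrow> real) \<Rightarrow> (real^'n \<Rightarrow> real) \<Rightarrow> real) \<Rightarrow> bool" where
  "psd_form M b \<longleftrightarrow> (\<forall>u\<in>poly_space M. 0 \<le> b u u \<and> (\<forall>v\<in>poly_space M. b u v = b v u \<and>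
     (\<forall>w\<in>poly_space M. \<forall>c. b (\<lambda>x. c * u x + v x) w = c * b u w + b v w)))"

lemma psd_form_nonneg: "psd_form M b \<Longrightarrow> u \<in> poly_space M \<Longrightarrow> 0 \<le> b u u"
  by (simp add: psd_form_def)

lemma psd_form_sym: "psd_form M b \<Longrightarrow> u \<in> poly_space M \<Longrightarrow> v \<in> poly_space M \<Longrightarrow> b u v = b v u"
  by (simp add: psd_form_def)

lemma psd_form_linear: "psd_form M b \<Longrightarrow> u \<in> poly_space M \<Longrightarrow> v \<in> poly_space M \<Longrightarrow> w \<in> poly_space M \<Longrightarrow>
    b (\<lambda>x. c * u x + v x) w = c * b u w + b v w"
  by (simp add: psd_form_def)

lemma psd_form_expand:
  assumes b: "psd_form M b" and u: "u \<in> poly_space M" and v: "v \<in> poly_space M"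
  shows "b (\<lambda>x. c * u x + v x) (\<lambda>x. c * u x + v x) = c\<^sup>2 * b u u + 2 * c * b u v + b v v"
proof -
  define s where "s = (\<lambda>x. c * u x + v x)"
  have s: "s \<in> poly_space M" unfolding s_def using u v by (intro poly_space_add poly_space_scale)
  have l: "b s w = c * b u w + b v w" if "w \<in> poly_space M" for w
    unfolding s_def by (rule psd_form_linear[OF b u v that])
  have "b s s = c * b s u + b s v"
    using l[OF s] psd_form_sym[OF b s u] psd_form_sym[OF b s v] by simp
  also have "\<dots> = c\<^sup>2 * b u u + 2 * c * b u v + b v v"
    using psd_form_sym[OF b u v] by (simp add: l[OF u] l[OF v] power2_eq_square algebra_simps)
  finally show ?thesis unfolding s_def .
qed

text \<open>The form at \<open>c u + v\<close> is affine in \<open>c\<close> if \<open>u\<close> is a null vector; were it not constant, it would become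
  negative.\<close>

lemma psd_form_null:
  assumes b: "psd_form M b" and u: "u \<in> poly_space M" and v: "v \<in> poly_space M" and 0: "b u u = 0"
  shows "b u v = 0"
proof (rule ccontr)
  assume ne: "b u v \<noteq> 0"
  \<comment> \<open>the point where that affine function takes the value \<open>-1\<close>\<close>
  define c where "c = - (b v v + 1) / (2 * b u v)"
  have "0 \<le> b (\<lambda>x. c * u x + v x) (\<lambda>x. c * u x + v x)"
    using u v by (intro psd_form_nonneg[OF b] poly_space_add poly_space_scale)
  also have "\<dots> = 2 * c * b u v + b v v" using psd_form_expand[OF b u v, of c] 0 by simp
  also have "\<dots> = -1" using ne by (simp add: c_def field_simps)
  finally show False by simp
qed

text \<open>The induction adds one generator at a time and makes it orthogonal to the previous ones for \<open>b\<close>.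
  Then \<open>b\<close> splits into two parts, whereas \<open>a\<close> is at most twice the sum of its parts, and the new
  part is a one-dimensional comparison. The projections that achieve the orthogonality are produced
  in the same induction.\<close>

lemma psd_form_dominates_span:
  fixes a b :: "(real^'n \<Rightarrow> real) \<Rightarrow> (real^'n \<Rightarrow> real) \<Rightarrow> real"
  assumes a: "psd_form M a" and b: "psd_form M b"
    and ker: "\<And>u. u \<in> poly_space M \<Longrightarrow> b u u = 0 \<Longrightarrow> a u u = 0"
    and B: "finite B" "B \<subseteq> poly_space M"
  shows "(\<exists>C. \<forall>u\<in>fs.span B. a u u \<le> C * b u u) \<and>
    (\<forall>g\<in>poly_space M. \<exists>w\<in>fs.span B. \<forall>v\<in>fs.span B. b (\<lambda>x. g x - w x) v = 0)"
  using B
proof (induction B rule: finite_induct)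
  case empty
  have zero: "c (\<lambda>x. 0) u = 0" if "psd_form M c" "u \<in> poly_space M" for c :: "(real^'n \<Rightarrow> real) \<Rightarrow> (real^'n \<Rightarrow> real) \<Rightarrow> real" and u
    using psd_form_linear[OF that(1) poly_space_zero poly_space_zero that(2), of "-1"] by simp
  have "fs.span {} = {\<lambda>x::real^'n. 0}" by (simp add: zero_fun_def)
  moreover have "b (\<lambda>x. g x - 0) (\<lambda>x. 0) = 0" if "g \<in> poly_space M" for g
    using zero[OF b that] psd_form_sym[OF b that poly_space_zero] by simp
  ultimately show ?case using zero[OF a poly_space_zero] zero[OF b poly_space_zero] by simp
next
  case (insert f B)
  let ?P = "poly_space M :: (real^'n \<Rightarrow> real) set"
  have f: "f \<in> ?P" and BP: "fs.span B \<subseteq> ?P"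
    using insert.prems fs.span_minimal[of B ?P] unfolding poly_space_def by (auto simp: fs.subspace_span)
  from insert obtain C where C: "\<And>u. u \<in> fs.span B \<Longrightarrow> a u u \<le> C * b u u" by blast
  have proj: "\<exists>w\<in>fs.span B. \<forall>v\<in>fs.span B. b (\<lambda>x. g x - w x) v = 0" if "g \<in> ?P" for g
    using insert that by blast
  obtain w where w: "w \<in> fs.span B" "\<And>v. v \<in> fs.span B \<Longrightarrow> b (\<lambda>x. f x - w x) v = 0" using proj[OF f] by blast
  define g where "g = (\<lambda>x. f x - w x)"
  have g: "g \<in> ?P" unfolding g_def using f w BP by (intro poly_space_diff) auto
  have decomp: "\<exists>c. \<exists>v\<in>fs.span B. u = (\<lambda>x. c * g x + v x)" if u: "u \<in> fs.span (insert f B)" for u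
  proof -
    obtain c where c: "u - (\<lambda>x. c * f x) \<in> fs.span B" using u fs.span_breakdown_eq by blast
    have "(u - (\<lambda>x. c * f x)) + (\<lambda>x. c * w x) \<in> fs.span B" by (intro fs.span_add fs.span_scale c w)
    moreover have "u = (\<lambda>x. c * g x + ((u - (\<lambda>x. c * f x)) + (\<lambda>x. c * w x)) x)" by (auto simp: g_def algebra_simps)
    ultimately show ?thesis by blast
  qed
  have gf: "g \<in> fs.span (insert f B)"
  proof -
    have "f \<in> fs.span (insert f B)" "w \<in> fs.span (insert f B)"
      using fs.span_base[of f "insert f B"] w(1) fs.span_mono[of B "insert f B"] by auto
    from fs.span_diff[OF this] show ?thesis unfolding g_def fun_diff_def .
  qed
  have lin: "b (\<lambda>x. c * u x + v x) z = c * b u z + b v z" "b u v = b v u" "0 \<le> b u u" "0 \<le> a u u"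
    if "u \<in> ?P" "v \<in> ?P" "z \<in> ?P" for c u v z
    using a b that by (simp_all add: psd_form_def)
  show ?case
  proof (intro conjI)
    define k where "k = a g g / b g g"
    define C' where "C' = 2 * (\<bar>C\<bar> + k)"
    have "a u u \<le> C' * b u u" if "u \<in> fs.span (insert f B)" for u
    proof -
      obtain c v where v: "v \<in> fs.span B" and u: "u = (\<lambda>x. c * g x + v x)" using decomp[OF \<open>u \<in> _\<close>] by blast
      have vP: "v \<in> ?P" using v BP by blast
      have bu: "b u u = c\<^sup>2 * b g g + b v v"
        unfolding u psd_form_expand[OF b g vP] using w(2)[OF v] by (simp add: g_def)
      have "0 \<le> a (\<lambda>x. (-c) * g x + v x) (\<lambda>x. (-c) * g x + v x)"
        using g vP by (intro psd_form_nonneg[OF a] poly_space_add poly_space_scale)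
      then have au: "a u u \<le> 2 * (c\<^sup>2 * a g g) + 2 * a v v"
        unfolding psd_form_expand[OF a g vP] u by (simp add: algebra_simps)
      have ag: "a g g = k * b g g" using ker[OF g] by (cases "b g g = 0") (auto simp: k_def)
      have nn: "0 \<le> b g g" "0 \<le> b v v" "0 \<le> a g g" using lin g vP by blast+
      have "a v v \<le> \<bar>C\<bar> * b v v" using C[OF v] nn(2) by (meson abs_ge_self mult_right_mono order_trans)
      with au have "a u u \<le> 2 * (c\<^sup>2 * a g g) + 2 * (\<bar>C\<bar> * b v v)" by linarith
      also have "\<dots> \<le> C' * b u u"
      proof -
        have "C' * b u u = 2 * (c\<^sup>2 * (k * b g g)) + 2 * (\<bar>C\<bar> * b v v)
            + (2 * (\<bar>C\<bar> * (c\<^sup>2 * b g g)) + 2 * (k * b v v))"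
          unfolding bu C'_def by (simp add: algebra_simps)
        moreover have "0 \<le> 2 * (\<bar>C\<bar> * (c\<^sup>2 * b g g)) + 2 * (k * b v v)" using nn by (simp add: k_def)
        ultimately show ?thesis unfolding ag[symmetric] by linarith
      qed
      finally show ?thesis .
    qed
    then show "\<exists>C. \<forall>u\<in>fs.span (insert f B). a u u \<le> C * b u u" by blast
  next
    show "\<forall>h\<in>?P. \<exists>w\<in>fs.span (insert f B). \<forall>v\<in>fs.span (insert f B). b (\<lambda>x. h x - w x) v = 0"
    proof
      fix h assume h: "h \<in> ?P"
      obtain w1 where w1: "w1 \<in> fs.span B" "\<And>v. v \<in> fs.span B \<Longrightarrow> b (\<lambda>x. h x - w1 x) v = 0" using proj[OF h] by blast
      define h1 where "h1 = (\<lambda>x. h x - w1 x)"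
      have h1: "h1 \<in> ?P" unfolding h1_def using h w1 BP by (intro poly_space_diff) auto
      \<comment> \<open>If \<open>b g g = 0\<close> the quotient is zero, and \<open>g\<close> is orthogonal to everything.\<close>
      define t where "t = b h1 g / b g g"
      have t: "b h1 g = t * b g g"
        using psd_form_null[OF b g h1] lin(2)[OF h1 g g] by (cases "b g g = 0") (auto simp: t_def)
      show "\<exists>w\<in>fs.span (insert f B). \<forall>v\<in>fs.span (insert f B). b (\<lambda>x. h x - w x) v = 0"
      proof (intro bexI ballI)
        show "w1 + (\<lambda>x. t * g x) \<in> fs.span (insert f B)"
          using w1(1) fs.span_mono[of B "insert f B"] by (intro fs.span_add fs.span_scale gf) auto
        fix u assume "u \<in> fs.span (insert f B)"
        then obtain c v where v: "v \<in> fs.span B" and u: "u = (\<lambda>x. c * g x + v x)" using decomp by blast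
        have vP: "v \<in> ?P" using v BP by blast
        have uP: "u \<in> ?P" unfolding u using g vP by (intro poly_space_add poly_space_scale)
        have eq: "(\<lambda>x. h x - (w1 + (\<lambda>x. t * g x)) x) = (\<lambda>x. (-t) * g x + h1 x)" by (auto simp: h1_def)
        have sP: "(\<lambda>x. (-t) * g x + h1 x) \<in> ?P" using g h1 by (intro poly_space_add poly_space_scale)
        have "b (\<lambda>x. (-t) * g x + h1 x) u = b u (\<lambda>x. (-t) * g x + h1 x)" by (rule lin(2)[OF sP uP uP])
        also have "\<dots> = c * b g (\<lambda>x. (-t) * g x + h1 x) + b v (\<lambda>x. (-t) * g x + h1 x)"
          unfolding u by (rule lin(1)[OF g vP sP])
        also have "b g (\<lambda>x. (-t) * g x + h1 x) = (-t) * b g g + b h1 g"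
          unfolding lin(2)[OF g sP sP] by (rule lin(1)[OF g h1 g])
        also have "b v (\<lambda>x. (-t) * g x + h1 x) = (-t) * b g v + b h1 v"
          unfolding lin(2)[OF vP sP sP] by (rule lin(1)[OF g h1 vP])
        also have "b g v = 0" using w(2)[OF v] by (simp add: g_def)
        also have "b h1 v = 0" using w1(2)[OF v] by (simp add: h1_def)
        finally show "b (\<lambda>x. h x - (w1 + (\<lambda>x. t * g x)) x) u = 0" unfolding eq t by simp
      qed
    qed
  qed
qed

lemma psd_form_dominates:
  fixes a b :: "(real^'n \<Rightarrow> real) \<Rightarrow> (real^'n \<Rightarrow> real) \<Rightarrow> real"
  assumes "psd_form M a" "psd_form M b" "\<And>u. u \<in> poly_space M \<Longrightarrow> b u u = 0 \<Longrightarrow> a u u = 0"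
  shows "\<exists>C\<ge>0. \<forall>u\<in>poly_space M. a u u \<le> C * b u u"
proof -
  let ?B = "monomial ` {\<alpha>::'n \<Rightarrow> nat. (\<Sum>i\<in>UNIV. \<alpha> i) \<le> M}"
  have "?B \<subseteq> poly_space M" using monomial_in_poly_space by auto
  then obtain C where C: "\<And>u. u \<in> poly_space M \<Longrightarrow> a u u \<le> C * b u u"
    using psd_form_dominates_span[OF assms, of ?B] finite_multi_indices unfolding poly_space_monomials by blast
  have "a u u \<le> \<bar>C\<bar> * b u u" if "u \<in> poly_space M" for u
  proof -
    have "0 \<le> b u u" using assms(2) that by (simp add: psd_form_def)
    then show ?thesis using C[OF that] by (meson abs_ge_self mult_right_mono order_trans)
  qed
  then show ?thesis by (intro exI[of _ "\<bar>C\<bar>"]) auto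
qed

section \<open>The open reference simplex\<close>

definition open_simplex :: "(real^'n) set" where
  "open_simplex = {x. \<forall>v. 0 < bary v x}"

lemma ref_simplex_eq_bary: "ref_simplex = {x. \<forall>v. 0 \<le> bary v x}"
proof
  show "ref_simplex \<subseteq> {x. \<forall>v. 0 \<le> bary v x}"
    unfolding ref_simplex_def
  proof (rule hull_minimal)
    show "range vertex \<subseteq> {x. \<forall>v. 0 \<le> bary v x}" by (auto simp: bary_vertex)
    show "convex {x. \<forall>v. 0 \<le> bary v x}" unfolding convex_alt by (auto simp: bary_affine)
  qed
  show "{x. \<forall>v. 0 \<le> bary v x} \<subseteq> ref_simplex"
  proof clarify
    fix x assume x: "\<forall>v. 0 \<le> bary v x"
    have "(\<Sum>v\<in>UNIV. bary v x *\<^sub>R vertex v) \<in> ref_simplex"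
      unfolding ref_simplex_def by (rule convex_sum) (use x sum_bary in \<open>auto intro: hull_inc\<close>)
    then show "x \<in> ref_simplex" by (simp add: bary_combination)
  qed
qed

lemma open_simplex_subset: "open_simplex \<subseteq> ref_simplex"
  by (auto simp: ref_simplex_eq_bary open_simplex_def less_imp_le)

lemma compact_ref_simplex: "compact ref_simplex"
  unfolding ref_simplex_def by (intro compact_convex_hull finite_imp_compact) auto

lemma continuous_bary: "continuous_on S (bary v)"
proof (cases v)
  case None
  then have "bary v = (\<lambda>x. 1 - (\<Sum>i\<in>UNIV. x $ i))" by (auto simp: bary_def)
  then show ?thesis by (simp only:) (intro continuous_intros)
next
  case (Some i)
  then have "bary v = (\<lambda>x. x $ i)" by (auto simp: bary_def)
  then show ?thesis by (simp only:) (intro continuous_intros)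
qed

lemma open_open_simplex: "open (open_simplex :: (real^'n) set)"
proof -
  have "(open_simplex :: (real^'n) set) = (\<Inter>v. {x. 0 < bary v x})" by (auto simp: open_simplex_def)
  moreover have "open {x. 0 < bary v x}" for v :: "'n option"
    using continuous_bary by (intro open_Collect_less) auto
  then have "open (\<Inter>v::'n option. {x. 0 < bary v x})" by (intro open_INT) auto
  ultimately show ?thesis by metis
qed

lemma open_simplex_segment:
  assumes "y \<in> open_simplex" "x \<in> ref_simplex" "0 < s" "s \<le> 1"
  shows "(1 - s) *\<^sub>R x + s *\<^sub>R y \<in> open_simplex"
  using assms by (auto simp: open_simplex_def ref_simplex_eq_bary bary_affine intro!: add_nonneg_pos)

lemma open_simplex_nonempty: "(open_simplex :: (real^'n) set) \<noteq> {}"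
proof -
  let ?c = "1 / (real CARD('n) + 1)"
  have "1 - (\<Sum>i\<in>(UNIV::'n set). ?c) = ?c" by (simp add: field_simps)
  then have "(\<chi> i. ?c) \<in> (open_simplex :: (real^'n) set)"
    by (auto simp: open_simplex_def bary_def add_pos_nonneg split: option.split)
  then show ?thesis by blast
qed

text \<open>Every point of the simplex is a limit of points of the open simplex, on a segment to an interior point.\<close>

lemma zero_on_ref_simplex:
  fixes f :: "real^'n \<Rightarrow> real"
  assumes f: "continuous_on ref_simplex f" and 0: "\<And>x. x \<in> open_simplex \<Longrightarrow> f x = 0" and x: "x \<in> ref_simplex"
  shows "f x = 0"
proof -
  obtain y :: "real^'n" where y: "y \<in> open_simplex" using open_simplex_nonempty by blast
  define z where "z n = (1 - 1 / real (Suc n)) *\<^sub>R x + (1 / real (Suc n)) *\<^sub>R y" for n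
  have zW: "z n \<in> open_simplex" for n unfolding z_def by (rule open_simplex_segment[OF y x]) auto
  have "z \<longlonglongrightarrow> (1 - 0) *\<^sub>R x + 0 *\<^sub>R y"
    unfolding z_def by (intro tendsto_intros LIMSEQ_Suc lim_1_over_n)
  then have "(\<lambda>n. f (z n)) \<longlonglongrightarrow> f x"
    using f x zW open_simplex_subset unfolding continuous_on_sequentially comp_def by auto
  then show ?thesis using 0[OF zW] by (simp add: LIMSEQ_const_iff)
qed

lemma negligible_simplex_boundary: "negligible (ref_simplex - open_simplex :: (real^'n) set)"
proof -
  have "negligible {x::real^'n. bary v x = 0}" for v
  proof (cases v)
    case None
    then have "{x::real^'n. bary v x = 0} = {x. (\<chi> i. (1::real)) \<bullet> x = 1}" by (auto simp: bary_def inner_vec_def)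
    then show ?thesis using negligible_hyperplane[of "(\<chi> i. 1) :: real^'n" 1] by simp
  next
    case (Some i)
    then have "{x::real^'n. bary v x = 0} = {x. axis i 1 \<bullet> x = 0}" by (auto simp: bary_def inner_axis')
    then show ?thesis using negligible_hyperplane[of "axis i 1 :: real^'n" 0] by (simp add: axis_eq_0_iff)
  qed
  then have "negligible (\<Union>v. {x::real^'n. bary v x = 0})" by (intro negligible_Union) auto
  then show ?thesis
    by (rule negligible_subset) (auto simp: ref_simplex_eq_bary open_simplex_def order.order_iff_strict)
qed

section \<open>Functions with vanishing derivatives of some order\<close>

text \<open>The \<open>k\<close>th derivative of \<open>p\<close> at \<open>y\<close> in the direction \<open>h\<close>, as a homogeneous polynomial in \<open>h\<close>.\<close>

primrec dir_power :: "nat \<Rightarrow> (real^'n \<Rightarrow> real) \<Rightarrow> real^'n \<Rightarrow> real^'n \<Rightarrow> real" where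
  "dir_power 0 p h y = p y"
| "dir_power (Suc k) p h y = (\<Sum>i\<in>UNIV. h $ i * dir_power k (partial i p) h y)"

lemma dir_power_poly: "(\<lambda>h. dir_power k p h y) \<in> poly_space k"
proof (induction k arbitrary: p)
  case 0 show ?case by (simp add: poly_space_const)
next
  case (Suc k)
  have "(\<lambda>h. h $ i * dir_power k (partial i p) h y) \<in> poly_space (1 + k)" for i
    by (intro poly_space_mult poly_space_coord Suc order_refl)
  then show ?case by (simp add: poly_space_sum)
qed

lemma dir_power_zero:
  "(\<And>is. length is = k \<Longrightarrow> partials is p y = 0) \<Longrightarrow> dir_power k p h y = 0"
proof (induction k arbitrary: p)
  case 0 then show ?case using "0.prems"[of "[]"] by simp
next
  case (Suc k)
  have "dir_power k (partial i p) h y = 0" for i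
    using Suc.prems[of "_ @ [i]"] by (intro Suc.IH) (simp add: partials_append)
  then show ?case by simp
qed

lemma dir_power_deriv:
  "smooth U p \<Longrightarrow> y + s *\<^sub>R h \<in> U \<Longrightarrow>
    ((\<lambda>s. dir_power k p h (y + s *\<^sub>R h)) has_real_derivative dir_power (Suc k) p h (y + s *\<^sub>R h)) (at s)"
proof (induction k arbitrary: p)
  case 0
  let ?z = "y + s *\<^sub>R h"
  have "((\<lambda>s. y + s *\<^sub>R h) has_derivative (\<lambda>t. t *\<^sub>R h)) (at s)" by (auto intro!: derivative_eq_intros)
  from has_derivative_compose[OF this has_derivative_partials[OF smooth_differentiable[OF 0]]]
  have "((\<lambda>s. p (y + s *\<^sub>R h)) has_derivative (\<lambda>t. \<Sum>i\<in>UNIV. (t *\<^sub>R h) $ i * partial i p ?z)) (at s)" .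
  moreover have "(\<lambda>t. \<Sum>i\<in>UNIV. (t *\<^sub>R h) $ i * partial i p ?z) = (*) (\<Sum>i\<in>UNIV. h $ i * partial i p ?z)"
    by (rule ext) (simp add: sum_distrib_left mult_ac)
  ultimately show ?case by (simp add: has_field_derivative_def)
next
  case (Suc k)
  have "((\<lambda>s. dir_power k (partial i p) h (y + s *\<^sub>R h)) has_real_derivative dir_power (Suc k) (partial i p) h (y + s *\<^sub>R h)) (at s)" for i
    using Suc by (intro Suc.IH smooth_partial)
  then have "((\<lambda>s. \<Sum>i\<in>UNIV. h $ i * dir_power k (partial i p) h (y + s *\<^sub>R h)) has_real_derivative
      (\<Sum>i\<in>UNIV. h $ i * dir_power (Suc k) (partial i p) h (y + s *\<^sub>R h))) (at s)"
    by (intro DERIV_sum DERIV_cmult)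
  then show ?case by simp
qed

text \<open>Taylor's theorem on the ray from an interior point to \<open>x\<close>: the intermediate point of the remainder
  lies in the open simplex even if \<open>x\<close> is on the boundary, and the Taylor polynomial is the same for
  all rays.\<close>

lemma poly_if_derivatives_vanish:
  fixes p :: "real^'n \<Rightarrow> real"
  assumes p: "smooth UNIV p" and 0: "\<And>is x. length is = m + 1 \<Longrightarrow> x \<in> open_simplex \<Longrightarrow> partials is p x = 0"
  shows "\<exists>q\<in>poly_space m. \<forall>x\<in>ref_simplex. p x = q x"
proof -
  obtain y :: "real^'n" where y: "y \<in> open_simplex" using open_simplex_nonempty by blast
  define q where "q x = (\<Sum>k<m+1. (1 / fact k) * dir_power k p (x - y) y)" for x
  have shift: "(\<lambda>x. (x - y) $ i) \<in> poly_space 1" for i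
    using poly_space_diff[OF poly_space_coord[of 1 i] poly_space_const[of "y $ i"]] by simp
  have "(\<lambda>x. dir_power k p (x - y) y) \<in> poly_space m" if "k < m + 1" for k
    using poly_space_affine_comp[OF shift dir_power_poly] poly_space_mono[of k m] that by auto
  then have "q \<in> poly_space m" unfolding q_def[abs_def] by (intro poly_space_sum poly_space_scale) auto
  moreover have "p x = q x" if x: "x \<in> ref_simplex" for x
  proof -
    let ?d = "\<lambda>k s. dir_power k p (x - y) (y + s *\<^sub>R (x - y))"
    have "\<exists>t>0. t < 1 \<and> (\<lambda>s. p (y + s *\<^sub>R (x - y))) 1 =
        (\<Sum>k<m+1. ?d k 0 / fact k * 1 ^ k) + ?d (m+1) t / fact (m+1) * 1 ^ (m+1)"
    proof (rule Maclaurin)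
      show "\<forall>k t. k < m + 1 \<and> 0 \<le> t \<and> t \<le> 1 \<longrightarrow> (?d k has_real_derivative ?d (Suc k) t) (at t)"
        by (intro allI impI dir_power_deriv[OF p]) simp
    qed simp_all
    then obtain t where t: "0 < t" "t < 1" "p x = (\<Sum>k<m+1. ?d k 0 / fact k) + ?d (m+1) t / fact (m+1)" by auto
    have "y + t *\<^sub>R (x - y) = (1 - (1 - t)) *\<^sub>R x + (1 - t) *\<^sub>R y" by (simp add: algebra_simps)
    also have "\<dots> \<in> open_simplex" using t by (intro open_simplex_segment[OF y x]) auto
    finally have "?d (m+1) t = 0" using 0 by (intro dir_power_zero) auto
    then show ?thesis using t by (simp add: q_def)
  qed
  ultimately show ?thesis by blast
qed

section \<open>Integrals over the reference simplex\<close>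

lemma set_integrable_compact:
  fixes f :: "'a::euclidean_space \<Rightarrow> real"
  assumes "compact S" "continuous_on S f"
  shows "set_integrable lebesgue S f"
  using integrable_completion[of "\<lambda>x. indicator S x *\<^sub>R f x" lborel] borel_integrable_compact[OF assms]
  unfolding set_integrable_def by (auto dest: borel_measurable_integrable)

lemma set_integrable_ref: "continuous_on ref_simplex f \<Longrightarrow> set_integrable lebesgue ref_simplex (f::real^'n \<Rightarrow> real)"
  by (rule set_integrable_compact[OF compact_ref_simplex])

lemma set_integrable_open: "continuous_on ref_simplex f \<Longrightarrow> set_integrable lebesgue open_simplex (f::real^'n \<Rightarrow> real)"
  by (rule set_integrable_subset[OF set_integrable_ref])
    (auto simp: open_simplex_subset[THEN subsetD] open_open_simplex)

lemma zero_if_integral_square_zero: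
  fixes f :: "real^'n \<Rightarrow> real"
  assumes f: "continuous_on ref_simplex f" and 0: "(LINT x:open_simplex|lebesgue. (f x)\<^sup>2) = 0" and x: "x \<in> open_simplex"
  shows "f x = 0"
proof -
  have "set_integrable lebesgue open_simplex (\<lambda>x. (f x)\<^sup>2)"
    by (intro set_integrable_open continuous_intros f)
  then have "AE x in lebesgue. indicator open_simplex x *\<^sub>R (f x)\<^sup>2 = 0"
    using 0 unfolding set_integrable_def set_lebesgue_integral_def
    by (subst integral_nonneg_eq_0_iff_AE[symmetric]) auto
  then have "AE x in lebesgue. x \<notin> {x \<in> open_simplex. f x \<noteq> 0}" by (rule AE_mp) (auto intro!: AE_I2)
  moreover have op: "open {x \<in> open_simplex. f x \<noteq> 0}"
  proof -
    have "open (open_simplex \<inter> f -` (- {0}))"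
      by (rule continuous_open_preimage[OF continuous_on_subset[OF f open_simplex_subset] open_open_simplex]) (simp add: open_Compl)
    moreover have "{x \<in> open_simplex. f x \<noteq> 0} = open_simplex \<inter> f -` (- {0})" by blast
    ultimately show ?thesis by metis
  qed
  ultimately have "negligible {x \<in> open_simplex. f x \<noteq> 0}"
    by (simp add: negligible_iff_null_sets AE_iff_null_sets)
  then have "{x \<in> open_simplex. f x \<noteq> 0} = {}" using op open_not_negligible by blast
  with x show ?thesis by blast
qed

section \<open>The interpolation error on the reference simplex\<close>

text \<open>On polynomials of bounded degree the Bramble-Hilbert estimate is a comparison of two
  quadratic forms: if the derivatives of order \<open>m + 1\<close> vanish, the function is a polynomial of
  degree \<open>m\<close> on the simplex and coincides with its interpolant.\<close>

lemma interpolation_error_reference: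
  fixes X :: "(real^'n) set"
  assumes X: "unisolvent m X"
  shows "\<exists>C\<ge>0. \<forall>p\<in>poly_space M. \<forall>i. (LINT x:ref_simplex|lebesgue. (partial i (\<lambda>y. p y - interp m X p y) x)\<^sup>2)
    \<le> C * (\<Sum>is | length is = m + 1. LINT x:open_simplex|lebesgue. (partials is p x)\<^sup>2)"
proof -
  define e where "e p = (\<lambda>y. p y - interp m X p y)" for p :: "real^'n \<Rightarrow> real"
  define a where "a p q = (\<Sum>i\<in>UNIV. LINT x:ref_simplex|lebesgue. partial i (e p) x * partial i (e q) x)"
    for p q :: "real^'n \<Rightarrow> real"
  define b where "b p q = (\<Sum>is | length is = m + 1. LINT x:open_simplex|lebesgue. partials is p x * partials is q x)"
    for p q :: "real^'n \<Rightarrow> real"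
  have e_poly: "e p \<in> poly_space (max M m)" if "p \<in> poly_space M" for p
    using that poly_space_mono[of M "max M m"] poly_space_mono[of m "max M m"] interp_works(1)[OF X]
    unfolding e_def by (intro poly_space_diff) auto
  have e_cont: "continuous_on ref_simplex (partial i (e p))" if "p \<in> poly_space M" for i p
    using poly_space_continuous partial_poly_space[OF e_poly[OF that]] by blast
  have e_lin: "partial i (e (\<lambda>x. c * u x + v x)) x = c * partial i (e u) x + partial i (e v) x"
    if "u \<in> poly_space M" "v \<in> poly_space M" for u v c i x
  proof -
    have "e (\<lambda>x. c * u x + v x) = (\<lambda>x. c * e u x + e v x)"
      using interp_linear[OF X, of c u 1 v] by (auto simp: e_def algebra_simps)
    then show ?thesis
      using partial_lin[OF poly_space_differentiable[OF e_poly[OF that(1)]] poly_space_differentiable[OF e_poly[OF that(2)]]] by simp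
  qed
  have p_poly: "partials is p \<in> poly_space M" if "p \<in> poly_space M" for "is" p
    using that by (induction "is") (auto intro: partial_poly_space')
  have p_cont: "continuous_on ref_simplex (partials is p)" if "p \<in> poly_space M" for "is" p
    using poly_space_continuous p_poly[OF that] by blast
  have p_lin: "partials is (\<lambda>x. c * u x + v x) = (\<lambda>x. c * partials is u x + partials is v x)"
    if "u \<in> poly_space M" "v \<in> poly_space M" for u v c "is"
    by (induction "is")
      (auto simp: partial_lin[OF poly_space_differentiable[OF p_poly[OF that(1)]] poly_space_differentiable[OF p_poly[OF that(2)]]])
  have "psd_form M a"
    unfolding psd_form_def
  proof (intro ballI conjI allI)
    fix u v w :: "real^'n \<Rightarrow> real" and c :: real assume uvw: "u \<in> poly_space M" "v \<in> poly_space M" "w \<in> poly_space M"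
    show "0 \<le> a u u" unfolding a_def set_lebesgue_integral_def by (intro sum_nonneg Bochner_Integration.integral_nonneg) auto
    show "a u v = a v u" by (simp add: a_def mult.commute)
    have int: "set_integrable lebesgue ref_simplex (\<lambda>x. partial i (e p) x * partial i (e w) x)"
      if "p \<in> poly_space M" for i p
      using that uvw by (intro set_integrable_ref continuous_intros e_cont)
    have "(LINT x:ref_simplex|lebesgue. partial i (e (\<lambda>x. c * u x + v x)) x * partial i (e w) x) =
        c * (LINT x:ref_simplex|lebesgue. partial i (e u) x * partial i (e w) x) +
        (LINT x:ref_simplex|lebesgue. partial i (e v) x * partial i (e w) x)" for i
      using int[OF uvw(1), of i] int[OF uvw(2), of i]
      by (simp add: e_lin[OF uvw(1,2)] distrib_right mult.assoc set_integral_add(2) set_integral_mult_right)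
    then show "a (\<lambda>x. c * u x + v x) w = c * a u w + a v w"
      by (simp add: a_def sum.distrib sum_distrib_left)
  qed
  moreover have "psd_form M b"
    unfolding psd_form_def
  proof (intro ballI conjI allI)
    fix u v w :: "real^'n \<Rightarrow> real" and c :: real assume uvw: "u \<in> poly_space M" "v \<in> poly_space M" "w \<in> poly_space M"
    show "0 \<le> b u u" unfolding b_def set_lebesgue_integral_def by (intro sum_nonneg Bochner_Integration.integral_nonneg) auto
    show "b u v = b v u" by (simp add: b_def mult.commute)
    have int: "set_integrable lebesgue open_simplex (\<lambda>x. partials is p x * partials is w x)"
      if "p \<in> poly_space M" for "is" p
      using that uvw by (intro set_integrable_open continuous_intros p_cont)
    have "(LINT x:open_simplex|lebesgue. partials is (\<lambda>x. c * u x + v x) x * partials is w x) =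
        c * (LINT x:open_simplex|lebesgue. partials is u x * partials is w x) +
        (LINT x:open_simplex|lebesgue. partials is v x * partials is w x)" for "is"
      using int[OF uvw(1), of "is"] int[OF uvw(2), of "is"]
      by (simp add: p_lin[OF uvw(1,2)] distrib_right mult.assoc set_integral_add(2) set_integral_mult_right)
    then show "b (\<lambda>x. c * u x + v x) w = c * b u w + b v w"
      by (simp add: b_def sum.distrib sum_distrib_left)
  qed
  moreover have "a p p = 0" if p: "p \<in> poly_space M" and b0: "b p p = 0" for p
  proof -
    have fin: "finite {is::'n list. length is = m + 1}" using finite_lists_length_eq[of "UNIV :: 'n set" "m + 1"] by simp
    have "(LINT x:open_simplex|lebesgue. (partials is p x)\<^sup>2) = 0" if "length is = m + 1" for "is"
    proof -
      have "0 \<le> (LINT x:open_simplex|lebesgue. partials is p x * partials is p x)" for "is"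
        unfolding set_lebesgue_integral_def by (intro Bochner_Integration.integral_nonneg) auto
      then show ?thesis using b0 fin that unfolding b_def by (simp add: sum_nonneg_eq_0_iff power2_eq_square)
    qed
    then have "partials is p x = 0" if "length is = m + 1" "x \<in> open_simplex" for "is" x
      using that zero_if_integral_square_zero[OF p_cont[OF p]] by blast
    then obtain q where q: "q \<in> poly_space m" "\<And>x. x \<in> ref_simplex \<Longrightarrow> p x = q x"
      using poly_if_derivatives_vanish[OF smooth_poly[OF p], of m] by blast
    have "interp m X p = q" using X q by (intro interp_unique) (auto simp: unisolvent_def)
    then have e0: "e p x = 0" if "x \<in> open_simplex" for x using q that open_simplex_subset by (auto simp: e_def)
    have "partial i (e p) x = 0" if "x \<in> open_simplex" for i x
      using partial_cong_open(1)[OF open_open_simplex e0 that] by (simp add: partial_const)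
    then have "partial i (e p) x = 0" if "x \<in> ref_simplex" for i x
      using zero_on_ref_simplex[OF e_cont[OF p] _ that] by blast
    then have "(LINT x:ref_simplex|lebesgue. partial i (e p) x * partial i (e p) x) = 0" for i
      unfolding set_lebesgue_integral_def by (intro integral_eq_zero_AE AE_I2) (auto simp: indicator_def)
    then show ?thesis by (simp add: a_def)
  qed
  ultimately obtain C where C: "0 \<le> C" "\<And>p. p \<in> poly_space M \<Longrightarrow> a p p \<le> C * b p p"
    using psd_form_dominates by blast
  have "(LINT x:ref_simplex|lebesgue. (partial i (e p) x)\<^sup>2) \<le> a p p" for i p
  proof -
    have "(LINT x:ref_simplex|lebesgue. partial i (e p) x * partial i (e p) x) \<le> a p p"
      unfolding a_def set_lebesgue_integral_def by (rule member_le_sum) (auto intro: Bochner_Integration.integral_nonneg)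
    then show ?thesis by (simp add: power2_eq_square)
  qed
  then show ?thesis
    using C order_trans unfolding b_def e_def power2_eq_square by (intro exI[of _ C]) blast
qed



section \<open>Derivatives of products\<close>

lemma partials_add_smooth:
  assumes "open U" "smooth U f" "smooth U g"
  shows "x \<in> U \<Longrightarrow> partials is (\<lambda>x. f x + g x) x = partials is f x + partials is g x"
proof (induction "is" arbitrary: x)
  case (Cons i "is")
  have "partial i (partials is (\<lambda>x. f x + g x)) x = partial i (\<lambda>x. partials is f x + partials is g x) x"
    using Cons by (intro partial_cong_open(1)[OF assms(1)])
  then show ?case
    using smooth_differentiable[OF smooth_partials[OF assms(2)] Cons.prems]
      smooth_differentiable[OF smooth_partials[OF assms(3)] Cons.prems] by (simp add: partial_add)
qed simp

lemma partials_zero: "partials is (\<lambda>x. 0) = (\<lambda>x. 0)"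
  by (induction "is") (auto simp: partial_const)

lemma partials_sum_smooth:
  assumes "open U" "finite A" "\<And>a. a \<in> A \<Longrightarrow> smooth U (f a)" "x \<in> U"
  shows "partials is (\<lambda>x. \<Sum>a\<in>A. f a x) x = (\<Sum>a\<in>A. partials is (f a) x)"
  using assms(2,3)
  by (induction A rule: finite_induct)
    (simp_all add: partials_zero partials_add_smooth[OF assms(1) _ _ assms(4)] smooth_sum[OF assms(1)])

text \<open>The binomial coefficients of the Leibniz rule are estimated together by \<open>2 ^ n\<close>; what matters is that
  the powers of \<open>h\<close> multiply correctly.\<close>

lemma partials_mult_bound:
  fixes h F G :: real
  assumes U: "open U" and x: "x \<in> U" and h: "0 \<le> h"
  shows "smooth U f \<Longrightarrow> smooth U g \<Longrightarrow>
    (\<And>js. length js \<le> length is \<Longrightarrow> \<bar>partials js f x\<bar> \<le> F * h ^ length js) \<Longrightarrow>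
    (\<And>js. length js \<le> length is \<Longrightarrow> \<bar>partials js g x\<bar> \<le> G * h ^ length js) \<Longrightarrow>
    \<bar>partials is (\<lambda>x. f x * g x) x\<bar> \<le> 2 ^ length is * F * G * h ^ length is"
proof (induction "is" arbitrary: f g F G rule: rev_induct)
  case Nil
  have "\<bar>f x\<bar> \<le> F" "\<bar>g x\<bar> \<le> G" using Nil(3)[of "[]"] Nil(4)[of "[]"] by auto
  then show ?case by (simp add: abs_mult mult_mono')
next
  case (snoc i "is")
  note f = snoc.prems(1) and g = snoc.prems(2)
  let ?n = "length is"
  have shift: "\<bar>partials js (partial i u) x\<bar> \<le> (K * h) * h ^ length js"
    if "\<And>js. length js \<le> length (is @ [i]) \<Longrightarrow> \<bar>partials js u x\<bar> \<le> K * h ^ length js" "length js \<le> ?n" for js u K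
    using that(1)[of "js @ [i]"] that(2) by (simp add: partials_append mult.assoc)
  have 1: "\<bar>partials is (\<lambda>x. partial i f x * g x) x\<bar> \<le> 2 ^ ?n * (F * h) * G * h ^ ?n"
    using snoc.prems by (intro snoc.IH smooth_partial shift[of f]) auto
  have 2: "\<bar>partials is (\<lambda>x. f x * partial i g x) x\<bar> \<le> 2 ^ ?n * F * (G * h) * h ^ ?n"
    using snoc.prems by (intro snoc.IH smooth_partial shift[of g]) auto
  have "partials (is @ [i]) (\<lambda>x. f x * g x) x = partials is (\<lambda>x. partial i f x * g x + f x * partial i g x) x"
    unfolding partials_append
    by (simp, rule partials_cong_open[OF U _ x])
      (rule partial_mult, auto intro: smooth_differentiable[OF f] smooth_differentiable[OF g])
  also have "\<dots> = partials is (\<lambda>x. partial i f x * g x) x + partials is (\<lambda>x. f x * partial i g x) x"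
    by (intro partials_add_smooth[OF U] smooth_mult[OF U] smooth_partial f g x)
  finally have "\<bar>partials (is @ [i]) (\<lambda>x. f x * g x) x\<bar> \<le> 2 ^ ?n * (F * h) * G * h ^ ?n + 2 ^ ?n * F * (G * h) * h ^ ?n"
    using 1 2 by linarith
  then show ?case by (simp add: algebra_simps)
qed

section \<open>Derivatives in physical coordinates\<close>

text \<open>The operators \<open>phys_partial\<close> are the derivatives in physical coordinates, acting on functions
  of the reference coordinates.\<close>

definition phys_partial :: "(real^'n \<Rightarrow> real^'n) \<Rightarrow> 'n \<Rightarrow> (real^'n \<Rightarrow> real) \<Rightarrow> real^'n \<Rightarrow> real" where
  "phys_partial \<Phi> i f x = (\<Sum>j\<in>UNIV. partial j f x * matrix_inv (jacobian \<Phi> (at x)) $ j $ i)"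

primrec phys_partials :: "(real^'n \<Rightarrow> real^'n) \<Rightarrow> 'n list \<Rightarrow> (real^'n \<Rightarrow> real) \<Rightarrow> real^'n \<Rightarrow> real" where
  "phys_partials \<Phi> [] f = f"
| "phys_partials \<Phi> (i # is) f = phys_partial \<Phi> i (phys_partials \<Phi> is f)"

lemma phys_partials_append: "phys_partials \<Phi> (xs @ ys) f = phys_partials \<Phi> xs (phys_partials \<Phi> ys f)"
  by (induction xs) auto

lemma chain_rule_phys:
  assumes "\<Phi> differentiable (at x)" "jac_det \<Phi> x \<noteq> 0"
  shows "partial a f x = (\<Sum>i\<in>UNIV. partial a (\<lambda>y. \<Phi> y $ i) x * phys_partial \<Phi> i f x)"
proof -
  let ?A = "jacobian \<Phi> (at x)"
  have "invertible ?A" using assms by (simp add: jac_det_def invertible_det_nz)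
  then have inv: "(\<Sum>i\<in>UNIV. matrix_inv ?A $ j $ i * ?A $ i $ a) = (if j = a then 1 else 0)" for j
    using matrix_inv_mult_left[of ?A] by (simp add: vec_eq_iff matrix_matrix_mult_def mat_def)
  have "(\<Sum>i\<in>UNIV. partial a (\<lambda>y. \<Phi> y $ i) x * phys_partial \<Phi> i f x) =
      (\<Sum>i\<in>UNIV. \<Sum>j\<in>UNIV. partial j f x * (matrix_inv ?A $ j $ i * ?A $ i $ a))"
    by (simp add: phys_partial_def jacobian_component[OF assms(1)] sum_distrib_left mult_ac)
  also have "\<dots> = (\<Sum>j\<in>UNIV. partial j f x * (\<Sum>i\<in>UNIV. matrix_inv ?A $ j $ i * ?A $ i $ a))"
    unfolding sum_distrib_left by (rule sum.swap)
  also have "\<dots> = partial a f x" by (simp add: inv if_distrib cong: if_cong)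
  finally show ?thesis ..
qed

text \<open>An open set that contains the closed reference simplex. Physical derivatives are smooth on it, hence
  continuous and bounded up to the boundary of the simplex.\<close>

definition regular_points :: "(real^'n \<Rightarrow> real^'n) \<Rightarrow> (real^'n) set" where
  "regular_points \<Phi> = {x. 0 < jac_det \<Phi> x}"

lemma jac_det_poly:
  fixes \<Phi> :: "real^3 \<Rightarrow> real^3"
  assumes \<Phi>: "\<And>i. (\<lambda>x. \<Phi> x $ i) \<in> poly_space N"
  shows "jac_det \<Phi> \<in> poly_space (N + N + N)"
proof -
  have "jac_det \<Phi> = (\<lambda>x. let A = (\<lambda>c a. partial a (\<lambda>y. \<Phi> y $ c) x) in
      A 1 1 * A 2 2 * A 3 3 + A 1 2 * A 2 3 * A 3 1 + A 1 3 * A 2 1 * A 3 2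
      - A 1 1 * A 2 3 * A 3 2 - A 1 2 * A 2 1 * A 3 3 - A 1 3 * A 2 2 * A 3 1)"
    by (simp add: fun_eq_iff jac_det_def det_3 jacobian_component[OF poly_map_differentiable[OF \<Phi>]])
  then show ?thesis
    unfolding Let_def by (rule ssubst) (intro poly_space_add poly_space_diff poly_space_mult partial_poly_space' \<Phi>)
qed

lemma open_regular_points:
  fixes \<Phi> :: "real^3 \<Rightarrow> real^3"
  assumes "\<And>i. (\<lambda>x. \<Phi> x $ i) \<in> poly_space N"
  shows "open (regular_points \<Phi>)"
  unfolding regular_points_def using poly_space_continuous[OF jac_det_poly[OF assms]]
  by (intro open_Collect_less) auto

lemma smooth_phys_partial:
  fixes \<Phi> :: "real^3 \<Rightarrow> real^3"
  assumes \<Phi>: "\<And>i. (\<lambda>x. \<Phi> x $ i) \<in> poly_space N" and f: "smooth (regular_points \<Phi>) f"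
  shows "smooth (regular_points \<Phi>) (phys_partial \<Phi> i f)"
proof -
  note U = open_regular_points[OF \<Phi>]
  define c where "c = (if i = 1 then -1 else 1 :: real)"
  let ?g = "\<lambda>x. \<Sum>j\<in>UNIV. partial j f x * (inverse (jac_det \<Phi> x) * (c * curl (geo_potential \<Phi> i) x $ j))"
  have "smooth (regular_points \<Phi>) ?g"
    by (intro smooth_sum smooth_mult smooth_inverse smooth_const smooth_partial f U smooth_poly[OF jac_det_poly[OF \<Phi>]]
        smooth_poly[OF curl_poly[OF geo_potential_poly[OF \<Phi>]]]) (simp add: regular_points_def)
  moreover
  have eq: "?g x = phys_partial \<Phi> i f x" if "x \<in> regular_points \<Phi>" for x
  proof -
    have J: "jac_det \<Phi> x \<noteq> 0" using that by (simp add: regular_points_def)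
    have "matrix_inv (jacobian \<Phi> (at x)) $ j $ i = inverse (jac_det \<Phi> x) * geo \<Phi> i j x" for j
      using J by (simp add: geo_def)
    moreover have "geo \<Phi> i j x = c * curl (geo_potential \<Phi> i) x $ j" for j
      by (simp add: geo_3_eq_curl[OF \<Phi> J] c_def)
    ultimately show ?thesis by (simp add: phys_partial_def)
  qed
  have "smooth (regular_points \<Phi>) ?g \<longleftrightarrow> smooth (regular_points \<Phi>) (phys_partial \<Phi> i f)"
    by (rule smooth_cong[OF U]) (rule eq)
  ultimately show ?thesis by blast
qed

lemma smooth_phys_partials:
  fixes \<Phi> :: "real^3 \<Rightarrow> real^3"
  assumes "\<And>i. (\<lambda>x. \<Phi> x $ i) \<in> poly_space N" "smooth (regular_points \<Phi>) f"
  shows "smooth (regular_points \<Phi>) (phys_partials \<Phi> is f)"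
  by (induction "is") (auto intro: smooth_phys_partial assms)

lemma finite_lists_le: "finite {js::'n::finite list. length js \<le> m}"
  using finite_lists_length_le[of "UNIV :: 'n set" m] by simp

text \<open>Every reference derivative produces a factor \<open>h\<close>, whether it hits the function or one of the
  derivatives of the mapping that appear in the chain rule. The induction splits off the innermost
  derivative, so that the induction hypothesis applies to the physical derivatives of the function.\<close>

lemma reference_derivatives_bound:
  fixes \<sigma> :: real
  assumes \<sigma>: "0 \<le> \<sigma>"
  shows "\<exists>C\<ge>0. \<forall>N (\<Phi> :: real^3 \<Rightarrow> real^3) h f x is. 0 \<le> h \<longrightarrow> (\<forall>i. (\<lambda>x. \<Phi> x $ i) \<in> poly_space N) \<longrightarrow>
    x \<in> regular_points \<Phi> \<longrightarrow> (\<forall>is i. is \<noteq> [] \<longrightarrow> \<bar>partials is (\<lambda>y. \<Phi> y $ i) x\<bar> \<le> \<sigma> * h ^ length is) \<longrightarrow>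
    smooth (regular_points \<Phi>) f \<longrightarrow> length is \<le> m \<longrightarrow>
    \<bar>partials is f x\<bar> \<le> C * h ^ length is * (\<Sum>js | length js \<le> m. \<bar>phys_partials \<Phi> js f x\<bar>)"
proof (induction m)
  case 0
  have "{js::3 list. length js \<le> 0} = {[]}" by auto
  then show ?case by (intro exI[of _ 1]) auto
next
  case (Suc m)
  then obtain C where C: "0 \<le> C" and IH: "\<And>N (\<Phi> :: real^3 \<Rightarrow> real^3) h f x is. 0 \<le> h \<Longrightarrow> (\<And>i. (\<lambda>x. \<Phi> x $ i) \<in> poly_space N) \<Longrightarrow>
    x \<in> regular_points \<Phi> \<Longrightarrow> (\<And>is i. is \<noteq> [] \<Longrightarrow> \<bar>partials is (\<lambda>y. \<Phi> y $ i) x\<bar> \<le> \<sigma> * h ^ length is) \<Longrightarrow>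
    smooth (regular_points \<Phi>) f \<Longrightarrow> length is \<le> m \<Longrightarrow>
    \<bar>partials is f x\<bar> \<le> C * h ^ length is * (\<Sum>js | length js \<le> m. \<bar>phys_partials \<Phi> js f x\<bar>)"
    by metis
  show ?case
    \<comment> \<open>three terms of the chain rule, \<open>2 ^ m\<close> from the product rule, \<open>\<sigma>\<close> from the mapping\<close>
  proof (intro exI[of _ "C + 3 * (2 ^ m * \<sigma> * C)"] conjI allI impI)
    show "0 \<le> C + 3 * (2 ^ m * \<sigma> * C)" using C \<sigma> by simp
    fix N and \<Phi> :: "real^3 \<Rightarrow> real^3" and h f x and "is" :: "3 list"
    assume h: "0 \<le> h" and \<Phi>': "\<forall>i. (\<lambda>x. \<Phi> x $ i) \<in> poly_space N" and x: "x \<in> regular_points \<Phi>"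
      and bd: "\<forall>is i. is \<noteq> [] \<longrightarrow> \<bar>partials is (\<lambda>y. \<Phi> y $ i) x\<bar> \<le> \<sigma> * h ^ length is"
      and f: "smooth (regular_points \<Phi>) f" and len: "length is \<le> Suc m"
    have \<Phi>: "\<And>i. (\<lambda>x. \<Phi> x $ i) \<in> poly_space N" using \<Phi>' by blast
    define S where "S = (\<Sum>js | length js \<le> Suc m. \<bar>phys_partials \<Phi> js f x\<bar>)"
    have S: "0 \<le> S" unfolding S_def by (intro sum_nonneg) auto
    note U = open_regular_points[OF \<Phi>]
    show "\<bar>partials is f x\<bar> \<le> (C + 3 * (2 ^ m * \<sigma> * C)) * h ^ length is * S"
    proof (cases "length is \<le> m")
      case True
      have "\<bar>partials is f x\<bar> \<le> C * h ^ length is * (\<Sum>js | length js \<le> m. \<bar>phys_partials \<Phi> js f x\<bar>)"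
        using IH[OF h \<Phi> x _ f True] bd by blast
      also have "\<dots> \<le> C * h ^ length is * S"
        unfolding S_def using C h by (intro mult_left_mono sum_mono2 finite_lists_le) auto
      also have "\<dots> \<le> (C + 3 * (2 ^ m * \<sigma> * C)) * h ^ length is * S"
        using C h \<sigma> S by (intro mult_right_mono) auto
      finally show ?thesis .
    next
      case False
      then have l: "length is = Suc m" using len by simp
      then obtain js a where js: "is = js @ [a]" "length js = m" by (metis length_Suc_conv_rev)
      let ?p = "\<lambda>i x. partial a (\<lambda>y. \<Phi> y $ i) x * phys_partial \<Phi> i f x"
      have sm: "smooth (regular_points \<Phi>) (partial a (\<lambda>y. \<Phi> y $ i))" "smooth (regular_points \<Phi>) (phys_partial \<Phi> i f)" for i
        using smooth_partial[OF smooth_poly[OF \<Phi>]] smooth_phys_partial[OF \<Phi> f] by auto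
      have "partials is f x = partials js (\<lambda>x. \<Sum>i\<in>UNIV. ?p i x) x"
        unfolding js partials_append partials.simps
        by (rule partials_cong_open[OF U _ x]) (auto intro!: chain_rule_phys poly_map_differentiable[OF \<Phi>] simp: regular_points_def)
      also have "\<dots> = (\<Sum>i\<in>UNIV. partials js (?p i) x)"
        by (intro partials_sum_smooth[OF U _ _ x] smooth_mult[OF U] sm) auto
      finally have "\<bar>partials is f x\<bar> \<le> (\<Sum>i\<in>UNIV. \<bar>partials js (?p i) x\<bar>)" by simp
      also have "\<dots> \<le> (\<Sum>i\<in>(UNIV::3 set). 2 ^ m * (\<sigma> * h) * (C * S) * h ^ m)"
      proof (rule sum_mono)
        fix i
        show "\<bar>partials js (?p i) x\<bar> \<le> 2 ^ m * (\<sigma> * h) * (C * S) * h ^ m"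
          unfolding js(2)[symmetric]
        proof (rule partials_mult_bound[OF U x h sm])
          fix ks :: "3 list" assume ks: "length ks \<le> length js"
          show "\<bar>partials ks (partial a (\<lambda>y. \<Phi> y $ i)) x\<bar> \<le> \<sigma> * h * h ^ length ks"
            using bd[rule_format, of "ks @ [a]" i] by (simp add: partials_append mult_ac)
          have "(\<Sum>ls | length ls \<le> m. \<bar>phys_partials \<Phi> ls (phys_partial \<Phi> i f) x\<bar>) =
              (\<Sum>ls | length ls \<le> m. \<bar>phys_partials \<Phi> (ls @ [i]) f x\<bar>)" by (simp add: phys_partials_append)
          also have "\<dots> = (\<Sum>ls\<in>(\<lambda>ls. ls @ [i]) ` {ls. length ls \<le> m}. \<bar>phys_partials \<Phi> ls f x\<bar>)"
            by (subst sum.reindex) (auto simp: inj_on_def)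
          also have "\<dots> \<le> S"
            unfolding S_def by (rule sum_mono2[OF finite_lists_le]) auto
          finally have le: "(\<Sum>ls | length ls \<le> m. \<bar>phys_partials \<Phi> ls (phys_partial \<Phi> i f) x\<bar>) \<le> S" .
          have "\<bar>partials ks (phys_partial \<Phi> i f) x\<bar> \<le>
              C * h ^ length ks * (\<Sum>ls | length ls \<le> m. \<bar>phys_partials \<Phi> ls (phys_partial \<Phi> i f) x\<bar>)"
            using IH[OF h \<Phi> x _ sm(2)] bd ks js(2) by blast
          also have "\<dots> \<le> C * h ^ length ks * S" using C h by (intro mult_left_mono le) auto
          finally show "\<bar>partials ks (phys_partial \<Phi> i f) x\<bar> \<le> C * S * h ^ length ks" by (simp add: mult_ac)
        qed
      qed
      also have "\<dots> = 3 * (2 ^ m * \<sigma> * C) * h ^ length is * S" by (simp add: l)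
      also have "\<dots> \<le> (C + 3 * (2 ^ m * \<sigma> * C)) * h ^ length is * S"
        using C h \<sigma> S by (intro mult_right_mono) auto
      finally show ?thesis .
    qed
  qed
qed

section \<open>Functions on an element\<close>

locale curved_element =
  fixes \<Phi> :: "real^3 \<Rightarrow> real^3" and N :: nat
  assumes \<Phi>: "\<And>i. (\<lambda>x. \<Phi> x $ i) \<in> poly_space N"
    and inj: "inj_on \<Phi> ref_simplex"
    and J: "\<And>x. x \<in> ref_simplex \<Longrightarrow> 0 < jac_det \<Phi> x"
begin

lemma ref_regular: "ref_simplex \<subseteq> regular_points \<Phi>"
  using J by (auto simp: regular_points_def)

lemma differentiable: "\<Phi> differentiable (at x)"
  using \<Phi> by (rule poly_map_differentiable)

lemma has_derivative: "(\<Phi> has_derivative (\<lambda>h. jacobian \<Phi> (at x) *v h)) (at x)"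
  using differentiable jacobian_works by blast

lemma continuous: "continuous_on S \<Phi>"
  by (meson differentiable differentiable_imp_continuous_within continuous_at_imp_continuous_on)

lemma continuous_jac: "continuous_on S (jac_det \<Phi>)"
  by (rule poly_space_continuous[OF jac_det_poly[OF \<Phi>]])

lemma on_elem_image: "x \<in> ref_simplex \<Longrightarrow> on_elem \<Phi> f (\<Phi> x) = f x"
  using inj by (simp add: on_elem_def)

lemma on_elem_image_open: "x \<in> open_simplex \<Longrightarrow> on_elem \<Phi> f (\<Phi> x) = f x"
  using on_elem_image open_simplex_subset by blast

lemma open_image: "open (\<Phi> ` open_simplex)"
  using inj_on_subset[OF inj open_simplex_subset]
  by (intro invariance_of_domain continuous open_open_simplex)

text \<open>On the image of the open simplex the inverse mapping is differentiable, and the chain rule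
  expresses derivatives on the element by the operators above.\<close>

lemma partial_on_elem:
  assumes x: "x \<in> open_simplex" and f: "f differentiable (at x)"
  shows "on_elem \<Phi> f differentiable (at (\<Phi> x))" "partial i (on_elem \<Phi> f) (\<Phi> x) = phys_partial \<Phi> i f x"
proof -
  let ?A = "jacobian \<Phi> (at x)"
  have xr: "x \<in> ref_simplex" using x open_simplex_subset by blast
  have "invertible ?A" using J[OF xr] by (simp add: jac_det_def invertible_det_nz)
  then have AB: "?A ** matrix_inv ?A = mat 1" using matrix_inv_mult_left matrix_left_right_inverse by blast
  have "(inv_into ref_simplex \<Phi> has_derivative (\<lambda>h. matrix_inv ?A *v h)) (at (\<Phi> x))"
  proof (rule has_derivative_inverse_strong[OF open_open_simplex x continuous _ has_derivative])
    show "inv_into ref_simplex \<Phi> (\<Phi> y) = y" if "y \<in> open_simplex" for y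
      using that open_simplex_subset inj by auto
    show "(*v) ?A \<circ> (*v) (matrix_inv ?A) = id" by (auto simp: matrix_vector_mul_assoc AB)
  qed
  moreover have "(f has_derivative (\<lambda>v. \<Sum>j\<in>UNIV. v $ j * partial j f x)) (at (inv_into ref_simplex \<Phi> (\<Phi> x)))"
    using has_derivative_partials[OF f] inj xr by simp
  ultimately have "((\<lambda>y. f (inv_into ref_simplex \<Phi> y)) has_derivative
      (\<lambda>h. \<Sum>j\<in>UNIV. (matrix_inv ?A *v h) $ j * partial j f x)) (at (\<Phi> x))"
    by (rule has_derivative_compose)
  then have D: "(on_elem \<Phi> f has_derivative (\<lambda>h. \<Sum>j\<in>UNIV. (matrix_inv ?A *v h) $ j * partial j f x)) (at (\<Phi> x))"
    by (simp add: on_elem_def[abs_def])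
  show "on_elem \<Phi> f differentiable (at (\<Phi> x))" using D differentiable_def by blast
  show "partial i (on_elem \<Phi> f) (\<Phi> x) = phys_partial \<Phi> i f x"
    unfolding partial_has_derivative[OF D]
    by (simp add: phys_partial_def matrix_vector_mult_basis column_def mult.commute)
qed

lemma smooth_on_elem:
  assumes "smooth (regular_points \<Phi>) f"
  shows "smooth (\<Phi> ` open_simplex) (on_elem \<Phi> f)"
proof -
  have "smooth_up_to n (\<Phi> ` open_simplex) (on_elem \<Phi> f)" for n
    using assms
  proof (induction n arbitrary: f)
    case (Suc n)
    have d: "f differentiable (at x)" if "x \<in> open_simplex" for x
      using smooth_differentiable[OF Suc.prems] that open_simplex_subset ref_regular by blast
    have "partial i (on_elem \<Phi> f) y = on_elem \<Phi> (phys_partial \<Phi> i f) y" if "y \<in> \<Phi> ` open_simplex" for i y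
      using that partial_on_elem(2)[OF _ d] by (auto simp: on_elem_image_open)
    then have "smooth_up_to n (\<Phi> ` open_simplex) (partial i (on_elem \<Phi> f))" for i
      using smooth_up_to_cong[OF open_image, of "partial i (on_elem \<Phi> f)"] Suc.IH[OF smooth_phys_partial[OF \<Phi> Suc.prems]] by blast
    then show ?case using partial_on_elem(1)[OF _ d] by auto
  qed simp
  then show ?thesis by (simp add: smooth_def)
qed

lemma partials_on_elem:
  assumes f: "smooth (regular_points \<Phi>) f"
  shows "x \<in> open_simplex \<Longrightarrow> partials is (on_elem \<Phi> f) (\<Phi> x) = phys_partials \<Phi> is f x"
proof (induction "is" arbitrary: x)
  case Nil then show ?case by (simp add: on_elem_image_open)
next
  case (Cons i "is")
  have "partials is (on_elem \<Phi> f) y = on_elem \<Phi> (phys_partials \<Phi> is f) y" if "y \<in> \<Phi> ` open_simplex" for y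
    using that Cons.IH by (auto simp: on_elem_image_open)
  then have "partial i (partials is (on_elem \<Phi> f)) (\<Phi> x) = partial i (on_elem \<Phi> (phys_partials \<Phi> is f)) (\<Phi> x)"
    using Cons.prems by (intro partial_cong_open(1)[OF open_image]) auto
  also have "\<dots> = phys_partial \<Phi> i (phys_partials \<Phi> is f) x"
    using Cons.prems open_simplex_subset ref_regular
    by (intro partial_on_elem smooth_differentiable[OF smooth_phys_partials[OF \<Phi> f]]) auto
  finally show ?case by simp
qed

text \<open>A scalar integrand is treated as a vector with one component. The first conclusion matters as much
  as the second, because the integral of a function that is not integrable is zero.\<close>

lemma change_of_variables:
  assumes S: "S \<in> sets lebesgue" "S \<subseteq> ref_simplex" and F: "\<And>x. x \<in> S \<Longrightarrow> F (\<Phi> x) = G x"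
    and int: "set_integrable lebesgue S (\<lambda>x. jac_det \<Phi> x * G x)"
  shows "set_integrable lebesgue (\<Phi> ` S) F" "(LINT y:\<Phi> ` S|lebesgue. F y) = (LINT x:S|lebesgue. jac_det \<Phi> x * G x)"
proof -
  let ?F = "\<lambda>y. vec (F y) :: real^1"
  let ?D = "\<lambda>x. \<bar>det (matrix (\<lambda>h. jacobian \<Phi> (at x) *v h))\<bar> *\<^sub>R ?F (\<Phi> x)"
  have D: "?D x = vec (jac_det \<Phi> x * G x)" if "x \<in> S" for x
    using J[of x] F[OF that] that S by (auto simp: jac_det_def vec_eq_iff)
  have "(\<lambda>x. ?D x $ 1) absolutely_integrable_on S"
    using int by (subst set_integrable_cong[OF refl refl, of _ _ "\<lambda>x. jac_det \<Phi> x * G x"]) (auto simp only: D vec_component)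
  then have D_int: "?D absolutely_integrable_on S" by (simp only: absolutely_integrable_on_1_iff)
  then have "?F absolutely_integrable_on (\<Phi> ` S) \<and> integral (\<Phi> ` S) ?F = integral S ?D"
    using has_absolute_integral_change_of_variables[OF S(1) has_derivative_at_withinI[OF has_derivative] inj_on_subset[OF inj S(2)],
      of ?F "integral S ?D"] by blast
  then have F_int: "set_integrable lebesgue (\<Phi> ` S) F" and eq: "integral (\<Phi> ` S) ?F = integral S ?D"
    by (simp_all add: absolutely_integrable_on_1_iff)
  show "set_integrable lebesgue (\<Phi> ` S) F" by fact
  have "integral (\<Phi> ` S) F = integral S (\<lambda>x. ?D x $ 1)"
    using eq by (simp add: integral_on_1_eq vec_eq_iff)
  also have "\<dots> = integral S (\<lambda>x. jac_det \<Phi> x * G x)" using D by (intro integral_cong) auto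
  finally show "(LINT y:\<Phi> ` S|lebesgue. F y) = (LINT x:S|lebesgue. jac_det \<Phi> x * G x)"
    using F_int int by (simp add: set_lebesgue_integral_eq_integral(2))
qed

lemma L2_norm_sq_on_elem:
  assumes g: "continuous_on ref_simplex g"
  shows "L2_norm_sq (elem \<Phi>) (on_elem \<Phi> g) = (LINT x:ref_simplex|lebesgue. jac_det \<Phi> x * (g x)\<^sup>2)"
  unfolding L2_norm_sq_def elem_def
  by (rule change_of_variables(2))
    (auto simp: on_elem_image compact_ref_simplex[THEN compact_imp_closed] intro!: set_integrable_ref continuous_intros continuous_jac g)

text \<open>The interior of an element exceeds the image of the open simplex at most by the image of the boundary,
  a null set.\<close>

lemma L2_norm_sq_interior:
  assumes g: "continuous_on ref_simplex g" and F: "\<And>x. x \<in> open_simplex \<Longrightarrow> F (\<Phi> x) = g x"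
  shows "L2_norm_sq (interior (elem \<Phi>)) F = (LINT x:open_simplex|lebesgue. jac_det \<Phi> x * (g x)\<^sup>2)"
proof -
  have int: "set_integrable lebesgue open_simplex (\<lambda>x. jac_det \<Phi> x * (g x)\<^sup>2)"
    by (intro set_integrable_open continuous_intros continuous_jac g)
  have sub: "\<Phi> ` open_simplex \<subseteq> interior (elem \<Phi>)"
    unfolding elem_def using open_simplex_subset by (intro interior_maximal open_image) auto
  have "negligible (\<Phi> ` (ref_simplex - open_simplex))"
    using differentiable by (intro negligible_differentiable_image_negligible negligible_simplex_boundary)
      (auto simp: differentiable_on_def intro: differentiable_at_withinI)
  then have neg: "negligible (interior (elem \<Phi>) - \<Phi> ` open_simplex)"
    by (rule negligible_subset) (use interior_subset[of "elem \<Phi>"] in \<open>auto simp: elem_def\<close>)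
  have cv: "set_integrable lebesgue (\<Phi> ` open_simplex) (\<lambda>y. (F y)\<^sup>2)"
     "(LINT y:\<Phi> ` open_simplex|lebesgue. (F y)\<^sup>2) = (LINT x:open_simplex|lebesgue. jac_det \<Phi> x * (g x)\<^sup>2)"
    using F by (intro change_of_variables[OF _ open_simplex_subset _ int]; simp add: open_open_simplex)+
  have n1: "negligible {x \<in> interior (elem \<Phi>) - \<Phi> ` open_simplex. (F x)\<^sup>2 \<noteq> 0}"
    by (rule negligible_subset[OF neg]) auto
  have n2: "negligible {x \<in> \<Phi> ` open_simplex - interior (elem \<Phi>). (F x)\<^sup>2 \<noteq> 0}"
    by (rule empty_imp_negligible) (use sub in blast)
  have "set_integrable lebesgue (interior (elem \<Phi>)) (\<lambda>y. (F y)\<^sup>2)"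
    using cv(1) absolutely_integrable_spike_set_eq[OF n1 n2] by blast
  then have "L2_norm_sq (interior (elem \<Phi>)) F = integral (interior (elem \<Phi>)) (\<lambda>y. (F y)\<^sup>2)"
    unfolding L2_norm_sq_def by (rule set_lebesgue_integral_eq_integral)
  also have "\<dots> = integral (\<Phi> ` open_simplex) (\<lambda>y. (F y)\<^sup>2)"
    by (rule integral_spike_set[OF n1 n2])
  also have "\<dots> = (LINT y:\<Phi> ` open_simplex|lebesgue. (F y)\<^sup>2)"
    using cv(1) by (simp add: set_lebesgue_integral_eq_integral(2))
  finally show ?thesis unfolding cv(2) .
qed

lemma L2_norm_phys_partials:
  assumes f: "smooth (regular_points \<Phi>) f"
  shows "(LINT x:open_simplex|lebesgue. jac_det \<Phi> x * (phys_partials \<Phi> is f x)\<^sup>2) =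
    L2_norm_sq (interior (elem \<Phi>)) (multi_partial (\<lambda>i. count (mset is) i) (on_elem \<Phi> f))"
proof (rule L2_norm_sq_interior[symmetric])
  show "continuous_on ref_simplex (phys_partials \<Phi> is f)"
    using smooth_continuous_on[OF smooth_phys_partials[OF \<Phi> f]] ref_regular continuous_on_subset by blast
  show "multi_partial (\<lambda>i. count (mset is) i) (on_elem \<Phi> f) (\<Phi> x) = phys_partials \<Phi> is f x" if "x \<in> open_simplex" for x
    using partials_eq_multi_partial[OF open_image smooth_on_elem[OF f], of "\<Phi> x" "is"] that partials_on_elem[OF f that] by auto
qed

end



section \<open>The geometric error on an element\<close>

lemma set_integral_finite_sum:
  fixes f :: "'a \<Rightarrow> 'b \<Rightarrow> real"
  assumes "finite A" "\<And>a. a \<in> A \<Longrightarrow> set_integrable M S (f a)"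
  shows "set_integrable M S (\<lambda>x. \<Sum>a\<in>A. f a x)" "(LINT x:S|M. \<Sum>a\<in>A. f a x) = (\<Sum>a\<in>A. LINT x:S|M. f a x)"
proof -
  have "set_integrable M S (\<lambda>x. \<Sum>a\<in>A. f a x) \<and> (LINT x:S|M. \<Sum>a\<in>A. f a x) = (\<Sum>a\<in>A. LINT x:S|M. f a x)"
    using assms
  proof (induction A rule: finite_induct)
    case empty show ?case by (simp add: set_integrable_def set_lebesgue_integral_def)
  next
    case (insert a A)
    then show ?case using set_integral_add[of M S "f a" "\<lambda>x. \<Sum>a\<in>A. f a x"] by auto
  qed
  then show "set_integrable M S (\<lambda>x. \<Sum>a\<in>A. f a x)" "(LINT x:S|M. \<Sum>a\<in>A. f a x) = (\<Sum>a\<in>A. LINT x:S|M. f a x)"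
    by auto
qed

lemma L2_norm_sq_nonneg: "0 \<le> L2_norm_sq D u"
  unfolding L2_norm_sq_def set_lebesgue_integral_def by (intro Bochner_Integration.integral_nonneg) auto

lemma sobolev_norm_sq_nonneg: "0 \<le> sobolev_norm_sq s D u"
  unfolding sobolev_norm_sq_def by (intro sum_nonneg L2_norm_sq_nonneg)

text \<open>The bounds that quasi-uniformity gives on a single element of a three-dimensional mesh of size \<open>h\<close>.\<close>

definition scaled_mapping :: "real \<Rightarrow> real \<Rightarrow> (real^3 \<Rightarrow> real^3) \<Rightarrow> bool" where
  "scaled_mapping \<sigma> h \<Phi> \<longleftrightarrow> 0 \<le> h \<and> (\<forall>x\<in>ref_simplex. h ^ 3 \<le> \<sigma> * jac_det \<Phi> x \<and>
     (\<forall>is i. is \<noteq> [] \<longrightarrow> \<bar>partials is (\<lambda>y. \<Phi> y $ i) x\<bar> \<le> \<sigma> * h ^ length is))"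

text \<open>Derivatives of order \<open>m\<close> gain the factor \<open>h ^ m\<close>. The factor \<open>h ^ 3\<close> is comparable to the volume of
  the element and turns the integral over the reference simplex into one over the element.\<close>

lemma reference_energy_le_sobolev:
  assumes \<sigma>: "0 \<le> \<sigma>"
  shows "\<exists>C\<ge>0. \<forall>N \<Phi> h f M. curved_element \<Phi> N \<longrightarrow> scaled_mapping \<sigma> h \<Phi> \<longrightarrow> f \<in> poly_space M \<longrightarrow>
    h ^ 3 * (\<Sum>is | length is = m. LINT x:open_simplex|lebesgue. (partials is f x)\<^sup>2) \<le>
    C * h ^ (2 * m) * (\<Sum>\<alpha> | (\<Sum>i\<in>UNIV. \<alpha> i) \<le> m. L2_norm_sq (interior (elem \<Phi>)) (multi_partial \<alpha> (on_elem \<Phi> f)))"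
proof -
  obtain c where c: "0 \<le> c" and bound: "\<And>N (\<Phi> :: real^3 \<Rightarrow> real^3) h f x is. 0 \<le> h \<Longrightarrow> (\<And>i. (\<lambda>x. \<Phi> x $ i) \<in> poly_space N) \<Longrightarrow>
    x \<in> regular_points \<Phi> \<Longrightarrow> (\<And>is i. is \<noteq> [] \<Longrightarrow> \<bar>partials is (\<lambda>y. \<Phi> y $ i) x\<bar> \<le> \<sigma> * h ^ length is) \<Longrightarrow>
    smooth (regular_points \<Phi>) f \<Longrightarrow> length is \<le> m \<Longrightarrow>
    \<bar>partials is f x\<bar> \<le> c * h ^ length is * (\<Sum>js | length js \<le> m. \<bar>phys_partials \<Phi> js f x\<bar>)"
    using reference_derivatives_bound[OF \<sigma>, of m] by metis
  define L where "L = {js :: 3 list. length js \<le> m}"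
  define A where "A = {is :: 3 list. length is = m}"
  have finL: "finite L" unfolding L_def by (rule finite_lists_le)
  have finA: "finite A" using finite_subset[OF _ finL, of A] by (auto simp: A_def L_def)
  let ?C = "real (card A) * (real (card L) * (\<sigma> * c\<^sup>2 * real (card L)))"
  show ?thesis
  proof (intro exI[of _ ?C] conjI allI impI)
    show "0 \<le> ?C" using \<sigma> by simp
    fix N \<Phi> h M and f :: "real^3 \<Rightarrow> real" assume el: "curved_element \<Phi> N" and sc: "scaled_mapping \<sigma> h \<Phi>" and f: "f \<in> poly_space M"
    interpret curved_element \<Phi> N by (rule el)
    define S where "S = (\<Sum>\<alpha> | (\<Sum>i\<in>UNIV. \<alpha> i) \<le> m. L2_norm_sq (interior (elem \<Phi>)) (multi_partial \<alpha> (on_elem \<Phi> f)))"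
    have h: "0 \<le> h" using sc by (simp add: scaled_mapping_def)
    have sf: "smooth (regular_points \<Phi>) f" using f by (rule smooth_poly)
    define k where "k = \<sigma> * c\<^sup>2 * real (card L) * h ^ (2 * m)"
    have k: "0 \<le> k" using \<sigma> h by (simp add: k_def)
    have cont: "continuous_on ref_simplex (phys_partials \<Phi> js f)" for js
      using smooth_continuous_on[OF smooth_phys_partials[OF \<Phi> sf]] ref_regular continuous_on_subset by blast
    have contf: "continuous_on ref_simplex (partials is f)" for "is"
      using smooth_continuous_on[OF smooth_partials[OF sf]] ref_regular continuous_on_subset by blast
    have int: "set_integrable lebesgue open_simplex (\<lambda>x. k * (jac_det \<Phi> x * (phys_partials \<Phi> js f x)\<^sup>2))" for js
      by (intro set_integrable_open continuous_intros continuous_jac cont)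
    have pt: "h ^ 3 * (partials is f x)\<^sup>2 \<le> (\<Sum>js\<in>L. k * (jac_det \<Phi> x * (phys_partials \<Phi> js f x)\<^sup>2))"
      if "is \<in> A" "x \<in> open_simplex" for "is" x
    proof -
      let ?s = "\<Sum>js\<in>L. \<bar>phys_partials \<Phi> js f x\<bar>"
      let ?q = "\<Sum>js\<in>L. (phys_partials \<Phi> js f x)\<^sup>2"
      have xr: "x \<in> ref_simplex" using that open_simplex_subset by blast
      have "\<bar>partials is f x\<bar> \<le> c * h ^ length is * ?s"
        unfolding L_def using sc xr ref_regular that(1)
        by (intro bound[OF h \<Phi> _ _ sf]) (auto simp: scaled_mapping_def A_def)
      then have "\<bar>partials is f x\<bar>\<^sup>2 \<le> (c * h ^ m * ?s)\<^sup>2" using that by (intro power_mono) (auto simp: A_def)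
      also have "\<dots> = c\<^sup>2 * h ^ (2 * m) * ?s\<^sup>2" by (simp add: power_mult_distrib power_mult[symmetric] mult.commute)
      also have "\<dots> \<le> c\<^sup>2 * h ^ (2 * m) * (?q * real (card L))"
        using sum_squared_le_sum_of_squares[of "\<lambda>js. \<bar>phys_partials \<Phi> js f x\<bar>" L] h by (intro mult_left_mono) auto
      finally have p: "(partials is f x)\<^sup>2 \<le> c\<^sup>2 * h ^ (2 * m) * (?q * real (card L))" by simp
      have "h ^ 3 \<le> \<sigma> * jac_det \<Phi> x" using sc xr by (simp add: scaled_mapping_def)
      then have "h ^ 3 * (partials is f x)\<^sup>2 \<le> (\<sigma> * jac_det \<Phi> x) * (c\<^sup>2 * h ^ (2 * m) * (?q * real (card L)))"
        using p h \<sigma> J[OF xr] by (intro mult_mono) auto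
      also have "\<dots> = (\<Sum>js\<in>L. k * (jac_det \<Phi> x * (phys_partials \<Phi> js f x)\<^sup>2))"
        by (simp add: k_def sum_distrib_left[symmetric] sum_distrib_right[symmetric] mult_ac)
      finally show ?thesis .
    qed
    have "h ^ 3 * (LINT x:open_simplex|lebesgue. (partials is f x)\<^sup>2) \<le> real (card L) * (k * S)" if "is \<in> A" for "is"
    proof -
      have "h ^ 3 * (LINT x:open_simplex|lebesgue. (partials is f x)\<^sup>2) = (LINT x:open_simplex|lebesgue. h ^ 3 * (partials is f x)\<^sup>2)"
        by simp
      also have "\<dots> \<le> (LINT x:open_simplex|lebesgue. \<Sum>js\<in>L. k * (jac_det \<Phi> x * (phys_partials \<Phi> js f x)\<^sup>2))"
        using pt[OF that] by (intro set_integral_mono set_integral_finite_sum(1)[OF finL int])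
          (intro set_integrable_open continuous_intros contf)
      also have "\<dots> = (\<Sum>js\<in>L. k * (LINT x:open_simplex|lebesgue. jac_det \<Phi> x * (phys_partials \<Phi> js f x)\<^sup>2))"
        by (subst set_integral_finite_sum(2)[OF finL int]) simp
      also have "\<dots> \<le> (\<Sum>js\<in>L. k * S)"
      proof (intro sum_mono mult_left_mono k)
        fix js assume "js \<in> L"
        then have "(\<Sum>i\<in>UNIV. count (mset js) i) \<le> m"
          by (simp add: sum_count_mset L_def)
        then show "(LINT x:open_simplex|lebesgue. jac_det \<Phi> x * (phys_partials \<Phi> js f x)\<^sup>2) \<le> S"
          unfolding L2_norm_phys_partials[OF sf] S_def
          by (intro member_le_sum[of "\<lambda>i. count (mset js) i"] finite_multi_indices L2_norm_sq_nonneg) auto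
      qed
      finally show ?thesis by simp
    qed
    then have "(\<Sum>is\<in>A. h ^ 3 * (LINT x:open_simplex|lebesgue. (partials is f x)\<^sup>2)) \<le> (\<Sum>is\<in>A. real (card L) * (k * S))"
      by (rule sum_mono)
    then show "h ^ 3 * (\<Sum>is | length is = m. LINT x:open_simplex|lebesgue. (partials is f x)\<^sup>2) \<le>
      ?C * h ^ (2 * m) * (\<Sum>\<alpha> | (\<Sum>i\<in>UNIV. \<alpha> i) \<le> m. L2_norm_sq (interior (elem \<Phi>)) (multi_partial \<alpha> (on_elem \<Phi> f)))"
      unfolding S_def[symmetric] by (simp add: A_def sum_distrib_left k_def mult_ac)
  qed
qed

lemma jac_det_le:
  assumes el: "curved_element \<Phi> N" and sc: "scaled_mapping \<sigma> h \<Phi>" and x: "x \<in> ref_simplex"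
  shows "jac_det \<Phi> x \<le> 6 * (\<sigma> * h) ^ 3"
proof -
  interpret curved_element \<Phi> N by (rule el)
  define A where "A c a = partial a (\<lambda>y. \<Phi> y $ c) x" for c a
  have A: "\<bar>A c a\<bar> \<le> \<sigma> * h" for c a
  proof -
    have "\<bar>partials [a] (\<lambda>y. \<Phi> y $ c) x\<bar> \<le> \<sigma> * h ^ length [a]"
      using sc x unfolding scaled_mapping_def by blast
    then show ?thesis by (simp add: A_def)
  qed
  have "\<bar>A c a * A c' a' * A c'' a''\<bar> \<le> (\<sigma> * h) ^ 3" for c a c' a' c'' a''
  proof -
    have "0 \<le> \<sigma> * h" using A[of c a] by linarith
    then have "\<bar>A c a\<bar> * \<bar>A c' a'\<bar> * \<bar>A c'' a''\<bar> \<le> (\<sigma> * h) * (\<sigma> * h) * (\<sigma> * h)"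
      using A by (intro mult_mono) auto
    then show ?thesis by (simp add: abs_mult power3_eq_cube)
  qed
  then have B: "A c a * A c' a' * A c'' a'' \<le> (\<sigma> * h) ^ 3" "- (A c a * A c' a' * A c'' a'') \<le> (\<sigma> * h) ^ 3" for c a c' a' c'' a''
    by (meson abs_le_D1 abs_le_D2)+
  have "jac_det \<Phi> x = A 1 1 * A 2 2 * A 3 3 + A 1 2 * A 2 3 * A 3 1 + A 1 3 * A 2 1 * A 3 2
      - A 1 1 * A 2 3 * A 3 2 - A 1 2 * A 2 1 * A 3 3 - A 1 3 * A 2 2 * A 3 1"
    by (simp add: jac_det_def det_3 jacobian_component[OF differentiable] A_def)
  also have "\<dots> \<le> 6 * (\<sigma> * h) ^ 3"
    using B(1)[of 1 1 2 2 3 3] B(1)[of 1 2 2 3 3 1] B(1)[of 1 3 2 1 3 2]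
      B(2)[of 1 1 2 3 3 2] B(2)[of 1 2 2 1 3 3] B(2)[of 1 3 2 2 3 1] by linarith
  finally show ?thesis .
qed

lemma curl_square_le:
  assumes "\<And>a c. partial a (\<lambda>y. v y $ c) x - partial a (\<lambda>y. w y $ c) x = D a c"
  shows "(curl v x $ j - curl w x $ j)\<^sup>2 \<le> 2 * (\<Sum>a\<in>UNIV. \<Sum>c\<in>UNIV. (D a c)\<^sup>2)"
proof -
  define P where "P a c = (D a c)\<^sup>2" for a c
  have P: "0 \<le> P a c" for a c by (simp add: P_def)
  have sq: "(D a c - D c a)\<^sup>2 \<le> 2 * P a c + 2 * P c a" for a c
    using zero_le_power2[of "D a c + D c a"] by (simp add: P_def power2_eq_square algebra_simps)
  have "(curl v x $ j - curl w x $ j)\<^sup>2 = (D 2 3 - D 3 2)\<^sup>2 \<or> (curl v x $ j - curl w x $ j)\<^sup>2 = (D 3 1 - D 1 3)\<^sup>2 \<or>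
      (curl v x $ j - curl w x $ j)\<^sup>2 = (D 1 2 - D 2 1)\<^sup>2"
    using exhaust_3[of j] by (auto simp: curl_def assms[symmetric] algebra_simps)
  then have "(curl v x $ j - curl w x $ j)\<^sup>2 \<le> 2 * P 2 3 + 2 * P 3 2 \<or> (curl v x $ j - curl w x $ j)\<^sup>2 \<le> 2 * P 3 1 + 2 * P 1 3 \<or>
      (curl v x $ j - curl w x $ j)\<^sup>2 \<le> 2 * P 1 2 + 2 * P 2 1"
    using sq[of 2 3] sq[of 3 1] sq[of 1 2] by metis
  then show ?thesis
    unfolding P_def[symmetric] sum_3
    using P[of 1 1] P[of 1 2] P[of 1 3] P[of 2 1] P[of 2 2] P[of 2 3] P[of 3 1] P[of 3 2] P[of 3 3] by argo
qed

text \<open>The error of a geometric term is, up to sign, a component of the curl of the interpolation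
  error of its potential. Its size is transported to the reference simplex, where the norm of the
  potential enters only through derivatives of order \<open>N + 2\<close>, and these are transported back.\<close>

lemma geometric_error_element:
  assumes X: "unisolvent N X" "unisolvent (N + 1) X'" and \<sigma>: "0 \<le> \<sigma>"
  shows "\<exists>C\<ge>0. \<forall>\<Phi> h i j. curved_element \<Phi> N \<longrightarrow> scaled_mapping \<sigma> h \<Phi> \<longrightarrow>
    L2_norm_sq (elem \<Phi>) (on_elem \<Phi> (\<lambda>x. geo \<Phi> i j x - approx_geo3 N X X' \<Phi> i j x)) \<le>
    C * h ^ (2 * (N + 2)) * sobolev_norm_sq (N + 2) (elem \<Phi>) (on_elem \<Phi> (geo_potential \<Phi> i))"
proof -
  obtain c where c: "0 \<le> c" and ref: "\<And>p i. p \<in> poly_space (2 * N) \<Longrightarrow>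
      (LINT x:ref_simplex|lebesgue. (partial i (\<lambda>y. p y - interp (N + 1) X' p y) x)\<^sup>2)
      \<le> c * (\<Sum>is | length is = N + 1 + 1. LINT x:open_simplex|lebesgue. (partials is p x)\<^sup>2)"
    using interpolation_error_reference[OF X(2), of "2 * N"] by blast
  obtain c' where c': "0 \<le> c'" and scale: "\<And>N' \<Phi> h f M. curved_element \<Phi> N' \<Longrightarrow> scaled_mapping \<sigma> h \<Phi> \<Longrightarrow> f \<in> poly_space M \<Longrightarrow>
      h ^ 3 * (\<Sum>is | length is = N + 2. LINT x:open_simplex|lebesgue. (partials is f x)\<^sup>2) \<le>
      c' * h ^ (2 * (N + 2)) * (\<Sum>\<alpha> | (\<Sum>i\<in>UNIV. \<alpha> i) \<le> N + 2. L2_norm_sq (interior (elem \<Phi>)) (multi_partial \<alpha> (on_elem \<Phi> f)))"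
    using reference_energy_le_sobolev[OF \<sigma>, of "N + 2"] by metis
  show ?thesis
    \<comment> \<open>\<open>6\<close> terms of the determinant, \<open>2\<close> for the square of a difference, \<open>3\<close> directions of differentiation\<close>
  proof (intro exI[of _ "36 * \<sigma> ^ 3 * c * c'"] conjI allI impI)
    show "0 \<le> 36 * \<sigma> ^ 3 * c * c'" using \<sigma> c c' by simp
    fix \<Phi> h i j assume el: "curved_element \<Phi> N" and sc: "scaled_mapping \<sigma> h \<Phi>"
    interpret curved_element \<Phi> N by (rule el)
    have h: "0 \<le> h" using sc by (simp add: scaled_mapping_def)
    define r where "r = geo_potential \<Phi> i"
    define w where "w = interp_vec (N + 1) X' r"
    define s where "s = (if i = 1 then -1 else 1 :: real)"
    define e where "e a = (\<lambda>y. r y $ a - interp (N + 1) X' (\<lambda>y. r y $ a) y)" for a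
    have r: "(\<lambda>y. r y $ a) \<in> poly_space (2 * N)" for a unfolding r_def by (rule geo_potential_poly[OF \<Phi>])
    have w: "(\<lambda>y. w y $ a) \<in> poly_space (N + 1)" for a unfolding w_def by (rule interp_vec_poly[OF X(2)])
    have e_eq: "e a = (\<lambda>y. r y $ a - w y $ a)" for a by (simp add: e_def w_def interp_vec_def)
    have e_partial: "partial b (e a) x = partial b (\<lambda>y. r y $ a) x - partial b (\<lambda>y. w y $ a) x" for a b x
      unfolding e_eq by (rule partial_diff[OF poly_space_differentiable[OF r] poly_space_differentiable[OF w]])
    have e_cont: "continuous_on ref_simplex (partial b (e a))" for a b
    proof -
      have "continuous_on ref_simplex (\<lambda>x. partial b (\<lambda>y. r y $ a) x - partial b (\<lambda>y. w y $ a) x)"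
        by (intro continuous_intros poly_space_continuous[OF partial_poly_space[OF r]] poly_space_continuous[OF partial_poly_space[OF w]])
      then show ?thesis by (simp add: e_partial[abs_def])
    qed
    define g where "g x = geo \<Phi> i j x - approx_geo3 N X X' \<Phi> i j x" for x
    have g: "g x = s * (curl r x $ j - curl w x $ j)" if "x \<in> ref_simplex" for x
      using J[OF that] unfolding g_def approx_geo3_eq_curl[OF X] s_def w_def r_def
      by (subst geo_3_eq_curl[OF \<Phi>]) auto
    have g_cont: "continuous_on ref_simplex g"
    proof -
      have "continuous_on ref_simplex (\<lambda>x. s * (curl r x $ j - curl w x $ j))"
        by (intro continuous_intros poly_space_continuous[OF curl_poly[OF r]] poly_space_continuous[OF curl_poly[OF w]])
      then show ?thesis using g continuous_on_cong by (metis (no_types, lifting))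
    qed
    let ?K = "12 * (\<sigma> * h) ^ 3"
    have pt: "jac_det \<Phi> x * (g x)\<^sup>2 \<le> (\<Sum>b\<in>UNIV. \<Sum>a\<in>UNIV. ?K * (partial b (e a) x)\<^sup>2)" if x: "x \<in> ref_simplex" for x
    proof -
      have "(g x)\<^sup>2 = (curl r x $ j - curl w x $ j)\<^sup>2" by (simp add: g[OF x] s_def power_mult_distrib)
      also have "\<dots> \<le> 2 * (\<Sum>b\<in>UNIV. \<Sum>a\<in>UNIV. (partial b (e a) x)\<^sup>2)"
        by (rule curl_square_le) (simp add: e_partial)
      finally have "jac_det \<Phi> x * (g x)\<^sup>2 \<le> (6 * (\<sigma> * h) ^ 3) * (2 * (\<Sum>b\<in>UNIV. \<Sum>a\<in>UNIV. (partial b (e a) x)\<^sup>2))"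
        using jac_det_le[OF el sc x] J[OF x] \<sigma> h by (intro mult_mono) auto
      then show ?thesis by (simp add: sum_distrib_left mult.assoc)
    qed
    have int: "set_integrable lebesgue ref_simplex (\<lambda>x. ?K * (partial b (e a) x)\<^sup>2)" for a b
      by (intro set_integrable_ref continuous_intros e_cont)
    define E where "E a = (\<Sum>is | length is = N + 2. LINT x:open_simplex|lebesgue. (partials is (\<lambda>y. r y $ a) x)\<^sup>2)" for a
    have "L2_norm_sq (elem \<Phi>) (on_elem \<Phi> g) = (LINT x:ref_simplex|lebesgue. jac_det \<Phi> x * (g x)\<^sup>2)"
      by (rule L2_norm_sq_on_elem[OF g_cont])
    also have "\<dots> \<le> (LINT x:ref_simplex|lebesgue. \<Sum>b\<in>UNIV. \<Sum>a\<in>UNIV. ?K * (partial b (e a) x)\<^sup>2)"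
      using pt by (intro set_integral_mono set_integral_finite_sum(1) int finite)
        (intro set_integrable_ref continuous_intros g_cont continuous_jac)
    also have "\<dots> = (\<Sum>b\<in>UNIV. \<Sum>a\<in>UNIV. ?K * (LINT x:ref_simplex|lebesgue. (partial b (e a) x)\<^sup>2))"
      by (simp add: set_integral_finite_sum int)
    also have "\<dots> \<le> (\<Sum>b\<in>(UNIV::3 set). \<Sum>a\<in>UNIV. ?K * (c * E a))"
      using ref[OF r] \<sigma> h by (intro sum_mono mult_left_mono) (auto simp: e_def E_def)
    also have "\<dots> = 36 * \<sigma> ^ 3 * c * (\<Sum>a\<in>UNIV. h ^ 3 * E a)"
      by (simp add: sum_distrib_left power_mult_distrib mult_ac)
    also have "\<dots> \<le> 36 * \<sigma> ^ 3 * c * (\<Sum>a\<in>UNIV. c' * h ^ (2 * (N + 2)) *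
        (\<Sum>\<alpha> | (\<Sum>i\<in>UNIV. \<alpha> i) \<le> N + 2. L2_norm_sq (interior (elem \<Phi>)) (multi_partial \<alpha> (on_elem \<Phi> (\<lambda>y. r y $ a)))))"
      using scale[OF el sc r] \<sigma> c unfolding E_def by (intro mult_left_mono sum_mono) auto
    also have "\<dots> = 36 * \<sigma> ^ 3 * c * c' * h ^ (2 * (N + 2)) * sobolev_norm_sq (N + 2) (elem \<Phi>) (on_elem \<Phi> r)"
      by (simp only: sobolev_norm_sq_def on_elem_def[abs_def] sum_distrib_left[symmetric] mult.assoc)
    finally show "L2_norm_sq (elem \<Phi>) (on_elem \<Phi> (\<lambda>x. geo \<Phi> i j x - approx_geo3 N X X' \<Phi> i j x)) \<le>
      36 * \<sigma> ^ 3 * c * c' * h ^ (2 * (N + 2)) * sobolev_norm_sq (N + 2) (elem \<Phi>) (on_elem \<Phi> (geo_potential \<Phi> i))"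
      unfolding g_def[abs_def] r_def .
  qed
qed

section \<open>The geometric error on a mesh\<close>

lemma mesh_curved_element: "isoparametric_mesh N \<Omega> K \<Phi> \<Longrightarrow> k < K \<Longrightarrow> curved_element (\<Phi> k) N"
  by (simp add: isoparametric_mesh_def curved_element_def)

lemma compact_elem:
  assumes "curved_element \<Phi> N" shows "compact (elem \<Phi>)"
  unfolding elem_def by (rule compact_continuous_image[OF curved_element.continuous[OF assms] compact_ref_simplex])

lemma mesh_size_nonneg:
  assumes mesh: "isoparametric_mesh N \<Omega> K \<Phi>" and k: "k < K"
  shows "0 \<le> mesh_size K (\<Phi> :: nat \<Rightarrow> real^3 \<Rightarrow> real^3)"
proof -
  have "0 \<le> diameter (elem (\<Phi> k))"
    using compact_elem[OF mesh_curved_element[OF mesh k]] by (intro diameter_ge_0 compact_imp_bounded)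
  also have "\<dots> \<le> mesh_size K \<Phi>" unfolding mesh_size_def using k by (intro Max_ge) auto
  finally show ?thesis .
qed

lemma mesh_scaled_mapping:
  fixes \<Phi> :: "nat \<Rightarrow> real^3 \<Rightarrow> real^3"
  assumes mesh: "isoparametric_mesh N \<Omega> K \<Phi>" and q: "quasi_uniform \<sigma> K \<Phi>" and k: "k < K"
  shows "scaled_mapping \<bar>\<sigma>\<bar> (mesh_size K \<Phi>) (\<Phi> k)"
  unfolding scaled_mapping_def
proof (intro conjI ballI allI impI)
  note h = mesh_size_nonneg[OF mesh k]
  show "0 \<le> mesh_size K \<Phi>" by (rule h)
  fix x :: "real^3" assume x: "x \<in> ref_simplex"
  have "mesh_size K \<Phi> ^ 3 \<le> \<sigma> * jac_det (\<Phi> k) x" using q k x by (simp add: quasi_uniform_def)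
  also have "\<dots> \<le> \<bar>\<sigma>\<bar> * jac_det (\<Phi> k) x"
    using curved_element.J[OF mesh_curved_element[OF mesh k] x] by (intro mult_right_mono) auto
  finally show "mesh_size K \<Phi> ^ 3 \<le> \<bar>\<sigma>\<bar> * jac_det (\<Phi> k) x" .
  fix "is" :: "3 list" and i assume "is \<noteq> []"
  then have "\<bar>partials is (\<lambda>y. \<Phi> k y $ i) x\<bar> \<le> \<sigma> * mesh_size K \<Phi> ^ length is"
    using q k x by (simp add: quasi_uniform_def)
  also have "\<dots> \<le> \<bar>\<sigma>\<bar> * mesh_size K \<Phi> ^ length is" using h by (intro mult_right_mono) auto
  finally show "\<bar>partials is (\<lambda>y. \<Phi> k y $ i) x\<bar> \<le> \<bar>\<sigma>\<bar> * mesh_size K \<Phi> ^ length is" .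
qed

lemma mesh_domain_measure_pos:
  fixes \<Phi> :: "nat \<Rightarrow> real^3 \<Rightarrow> real^3"
  assumes \<Omega>: "open \<Omega>" and mesh: "isoparametric_mesh N \<Omega> K \<Phi>" and K: "0 < K"
  shows "0 < measure lebesgue \<Omega>"
proof -
  have cl: "closure \<Omega> = (\<Union>k<K. elem (\<Phi> k))" using mesh by (simp add: isoparametric_mesh_def)
  have "bounded (\<Union>k<K. elem (\<Phi> k))"
    using compact_elem[OF mesh_curved_element[OF mesh]] compact_imp_bounded by (intro bounded_UN) auto
  then have "bounded \<Omega>" using cl closure_subset bounded_subset by metis
  then have "\<Omega> \<in> lmeasurable" using \<Omega> by (rule lmeasurable_open)
  moreover have "elem (\<Phi> 0) \<noteq> {}"
    using open_simplex_nonempty open_simplex_subset by (auto simp: elem_def)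
  then have "closure \<Omega> \<noteq> {}" unfolding cl using K by blast
  then have "\<not> negligible \<Omega>" using \<Omega> open_not_negligible by auto
  ultimately have "measure lebesgue \<Omega> \<noteq> 0" using negligible_iff_measure0 by blast
  then show ?thesis using measure_nonneg[of lebesgue \<Omega>] by linarith
qed

text \<open>For a nonempty mesh the domain has positive measure, which may therefore be absorbed in the constant.
  For the empty mesh both sides vanish.\<close>

lemma geometric_error_mesh:
  assumes X: "unisolvent N X" "unisolvent (N + 1) X'" and \<Omega>: "open (\<Omega> :: (real^3) set)"
  shows "\<exists>C::real. \<forall>K \<Phi>. isoparametric_mesh N \<Omega> K \<Phi> \<and> quasi_uniform \<sigma> K \<Phi> \<longrightarrow>
    (\<forall>i j. (\<Sum>k<K. L2_norm_sq (elem (\<Phi> k)) (on_elem (\<Phi> k) (\<lambda>x. geo (\<Phi> k) i j x - approx_geo3 N X X' (\<Phi> k) i j x)))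
      \<le> C * measure lebesgue \<Omega> * mesh_size K \<Phi> ^ (2 * (N + 2)) *
        (\<Sum>i\<in>UNIV. \<Sum>k<K. sobolev_norm_sq (N + 2) (elem (\<Phi> k)) (on_elem (\<Phi> k) (geo_potential (\<Phi> k) i))))"
proof -
  obtain C where C: "0 \<le> C" and elt: "\<And>\<Phi> h i j. curved_element \<Phi> N \<Longrightarrow> scaled_mapping \<bar>\<sigma>\<bar> h \<Phi> \<Longrightarrow>
    L2_norm_sq (elem \<Phi>) (on_elem \<Phi> (\<lambda>x. geo \<Phi> i j x - approx_geo3 N X X' \<Phi> i j x)) \<le>
    C * h ^ (2 * (N + 2)) * sobolev_norm_sq (N + 2) (elem \<Phi>) (on_elem \<Phi> (geo_potential \<Phi> i))"
    using geometric_error_element[OF X, of "\<bar>\<sigma>\<bar>"] by auto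
  show ?thesis
  proof (intro exI[of _ "C / measure lebesgue \<Omega>"] allI impI)
    fix K \<Phi> i j assume "isoparametric_mesh N \<Omega> K \<Phi> \<and> quasi_uniform \<sigma> K \<Phi>"
    then have mesh: "isoparametric_mesh N \<Omega> K \<Phi>" and q: "quasi_uniform \<sigma> K \<Phi>" by auto
    let ?S = "\<lambda>i k. sobolev_norm_sq (N + 2) (elem (\<Phi> k)) (on_elem (\<Phi> k) (geo_potential (\<Phi> k) i))"
    let ?L = "\<Sum>k<K. L2_norm_sq (elem (\<Phi> k)) (on_elem (\<Phi> k) (\<lambda>x. geo (\<Phi> k) i j x - approx_geo3 N X X' (\<Phi> k) i j x))"
    show "?L \<le> C / measure lebesgue \<Omega> * measure lebesgue \<Omega> * mesh_size K \<Phi> ^ (2 * (N + 2)) * (\<Sum>i\<in>UNIV. \<Sum>k<K. ?S i k)"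
    proof (cases "K = 0")
      case False
      then have "0 < measure lebesgue \<Omega>" using mesh_domain_measure_pos[OF \<Omega> mesh] by simp
      have h: "0 \<le> mesh_size K \<Phi>" using mesh_size_nonneg[OF mesh, of 0] False by simp
      have "?L \<le> (\<Sum>k<K. C * mesh_size K \<Phi> ^ (2 * (N + 2)) * ?S i k)"
        by (intro sum_mono elt mesh_curved_element[OF mesh] mesh_scaled_mapping[OF mesh q]) auto
      also have "\<dots> = C * mesh_size K \<Phi> ^ (2 * (N + 2)) * (\<Sum>k<K. ?S i k)" by (simp only: sum_distrib_left)
      also have "\<dots> \<le> C * mesh_size K \<Phi> ^ (2 * (N + 2)) * (\<Sum>i\<in>UNIV. \<Sum>k<K. ?S i k)"
        using C h by (intro mult_left_mono member_le_sum[of i UNIV "\<lambda>i. \<Sum>k<K. ?S i k"] sum_nonneg sobolev_norm_sq_nonneg) auto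
      finally show ?thesis using \<open>0 < measure lebesgue \<Omega>\<close> by simp
    qed simp
  qed
qed

section \<open>The metric identities and normals\<close>

lemma surf_part_normals:
  "(\<Sum>j\<in>UNIV. surf_part (point_values xq xf (G i j)) * surf_normal_vec fc j) =
    (\<chi> s. approx_scaled_normal G (fc s) (xf s) $ i)"
  by (simp add: vec_eq_iff surf_part_def point_values_def surf_normal_vec_def approx_scaled_normal_def mult.assoc times_vec_def)

lemma geo2_discrete_divergence:
  assumes \<phi>: "poly_basis N \<phi>" and M: "pos_def (mass_mat \<phi> xq wq)" and quad: "reference_quadrature N xq wq fc xf ws"
    and mesh: "isoparametric_mesh N \<Omega> K \<Phi>" and k: "k < K"
  shows "(\<Sum>j\<in>UNIV. decoupled_op \<phi> xq wq fc xf ws j *v point_values xq xf (approx_geo2 (\<Phi> k) i j)) = 0"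
proof -
  have \<Phi>: "\<And>i. (\<lambda>x. \<Phi> k x $ i) \<in> poly_space N" and J: "\<And>x. x \<in> ref_simplex \<Longrightarrow> jac_det (\<Phi> k) x \<noteq> 0"
    using mesh k unfolding isoparametric_mesh_def by (auto simp: less_imp_neq[symmetric])
  define p where "p j = (if i = 1 then if j = 1 then partial 2 (\<lambda>y. \<Phi> k y $ 2) else (\<lambda>x. - partial 1 (\<lambda>y. \<Phi> k y $ 2) x)
     else if j = 1 then (\<lambda>x. - partial 2 (\<lambda>y. \<Phi> k y $ 1) x) else partial 1 (\<lambda>y. \<Phi> k y $ 1))" for j :: 2
  have p: "p j \<in> poly_space N" for j
    unfolding p_def by (auto intro: poly_space_uminus partial_poly_space'[OF \<Phi>])
  have d: "partial a (\<lambda>y. \<Phi> k y $ c) differentiable (at x)" for a c x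
    by (rule poly_space_differentiable[OF partial_poly_space[OF \<Phi>]])
  have div: "(\<Sum>j\<in>UNIV. partial j (p j) x) = 0" for x
    using partial_commute_poly[OF \<Phi>, of 1 2 _ x] by (simp add: sum_2 p_def partial_uminus[OF d])
  have geo: "approx_geo2 (\<Phi> k) i j x = p j x" if "x \<in> ref_simplex" for j x
    unfolding approx_geo2_def geo_2[OF poly_map_differentiable[OF \<Phi>] J[OF that]] p_def by auto
  have "xq a \<in> ref_simplex" "xf s \<in> ref_simplex" for a s
    using quad face_subset_simplex unfolding reference_quadrature_def by blast+
  then have "point_values xq xf (approx_geo2 (\<Phi> k) i j) = point_values xq xf (p j)" for j
    by (simp add: point_values_def vec_eq_iff geo split: sum.split)
  then show ?thesis using discrete_divergence_zero[OF \<phi> M p div] by simp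
qed

lemma geo2_normals_opposite:
  assumes ex: "exact_scaled_normals K \<Phi>" and sh: "shared_face K \<Phi> k f l g"
    and xy: "x \<in> face f" "y \<in> face g" "\<Phi> k x = \<Phi> l y"
  shows "approx_scaled_normal (approx_geo2 (\<Phi> k)) f x = - approx_scaled_normal (approx_geo2 (\<Phi> l)) g y"
proof -
  have "approx_scaled_normal (approx_geo2 (\<Phi> m)) f z = face_jac (\<Phi> m) f z *\<^sub>R face_normal (\<Phi> m) f z"
    if "m < K" "z \<in> face f" for m f z
    using ex that unfolding exact_scaled_normals_def
    by (simp add: vec_eq_iff approx_scaled_normal_def approx_geo2_def mult.commute)
  moreover have "k < K" "l < K" using sh by (auto simp: shared_face_def)
  ultimately show ?thesis using ex sh xy unfolding exact_scaled_normals_def by simp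
qed

section \<open>Conservation, consistent normals and convergence\<close>

theorem theorem5:
  shows "(\<forall>(N::nat) (\<sigma>::real) (\<Omega>::(real^2) set) X X' (\<phi>::'p2::finite \<Rightarrow> real^2 \<Rightarrow> real)
            (xq::'q2::finite \<Rightarrow> real^2) wq (fc::'s2::finite \<Rightarrow> 2 option) xf ws.
          open \<Omega> \<and> connected \<Omega> \<and> interpolation_nodes N X \<and> interpolation_nodes (N + 1) X' \<and>
          poly_basis N \<phi> \<and> reference_quadrature N xq wq fc xf ws \<and> pos_def (mass_mat \<phi> xq wq) \<longrightarrow>
          (\<forall>K \<Phi>. isoparametric_mesh N \<Omega> K \<Phi> \<and> quasi_uniform \<sigma> K \<Phi> \<and>
             watertight X X' fc xf K \<Phi> \<and> exact_scaled_normals K \<Phi> \<longrightarrow>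
             (\<forall>k<K. \<forall>i. (\<Sum>j\<in>UNIV. decoupled_op \<phi> xq wq fc xf ws j *v
                            point_values xq xf (approx_geo2 (\<Phi> k) i j)) = 0) \<and>
             (\<forall>k<K. \<forall>i. (\<Sum>j\<in>UNIV. surf_part (point_values xq xf (approx_geo2 (\<Phi> k) i j))
                                      * surf_normal_vec fc j) =
                         (\<chi> s. approx_scaled_normal (approx_geo2 (\<Phi> k)) (fc s) (xf s) $ i)) \<and>
             (\<forall>k f l g. shared_face K \<Phi> k f l g \<longrightarrow>
                (\<forall>x\<in>face f. \<forall>y\<in>face g. \<Phi> k x = \<Phi> l y \<longrightarrow>
                   approx_scaled_normal (approx_geo2 (\<Phi> k)) f x =
                   - approx_scaled_normal (approx_geo2 (\<Phi> l)) g y)) \<and>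
             (\<forall>i j. (\<Sum>k<K. L2_norm_sq (elem (\<Phi> k))
                        (on_elem (\<Phi> k) (\<lambda>x. geo (\<Phi> k) i j x - approx_geo2 (\<Phi> k) i j x))) = 0)))
       \<and>
       (\<forall>(N::nat) (\<sigma>::real) (\<Omega>::(real^3) set) X X' (\<phi>::'p3::finite \<Rightarrow> real^3 \<Rightarrow> real)
            (xq::'q3::finite \<Rightarrow> real^3) wq (fc::'s3::finite \<Rightarrow> 3 option) xf ws.
          open \<Omega> \<and> connected \<Omega> \<and> interpolation_nodes N X \<and> interpolation_nodes (N + 1) X' \<and>
          poly_basis N \<phi> \<and> reference_quadrature N xq wq fc xf ws \<and> pos_def (mass_mat \<phi> xq wq) \<longrightarrow>
          (\<exists>C_N::real. \<forall>K \<Phi>. isoparametric_mesh N \<Omega> K \<Phi> \<and> quasi_uniform \<sigma> K \<Phi> \<and>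
             watertight X X' fc xf K \<Phi> \<and> exact_scaled_normals K \<Phi> \<longrightarrow>
             (\<forall>k<K. \<forall>i. (\<Sum>j\<in>UNIV. decoupled_op \<phi> xq wq fc xf ws j *v
                            point_values xq xf (approx_geo3 N X X' (\<Phi> k) i j)) = 0) \<and>
             (\<forall>k<K. \<forall>i. (\<Sum>j\<in>UNIV. surf_part (point_values xq xf (approx_geo3 N X X' (\<Phi> k) i j))
                                      * surf_normal_vec fc j) =
                         (\<chi> s. approx_scaled_normal (approx_geo3 N X X' (\<Phi> k)) (fc s) (xf s) $ i)) \<and>
             (\<forall>k f l g. shared_face K \<Phi> k f l g \<longrightarrow>
                (\<forall>x\<in>face f. \<forall>y\<in>face g. \<Phi> k x = \<Phi> l y \<longrightarrow>
                   approx_scaled_normal (approx_geo3 N X X' (\<Phi> k)) f x =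
                   - approx_scaled_normal (approx_geo3 N X X' (\<Phi> l)) g y)) \<and>
             (\<forall>i j. (\<Sum>k<K. L2_norm_sq (elem (\<Phi> k))
                        (on_elem (\<Phi> k) (\<lambda>x. geo (\<Phi> k) i j x - approx_geo3 N X X' (\<Phi> k) i j x)))
                \<le> C_N * measure lebesgue \<Omega> * mesh_size K \<Phi> ^ (2 * (N + 2)) *
                   (\<Sum>i\<in>UNIV. \<Sum>k<K. sobolev_norm_sq (N + 2) (elem (\<Phi> k))
                                       (on_elem (\<Phi> k) (geo_potential (\<Phi> k) i))))))"
proof (intro conjI allI impI ballI, goal_cases)
  case (1 N \<sigma> \<Omega> X X' \<phi> xq wq fc xf ws K \<Phi> k i)
  then show ?case by (blast intro: geo2_discrete_divergence)
next
  case (2 N \<sigma> \<Omega> X X' \<phi> xq wq fc xf ws K \<Phi> k i)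
  show ?case by (rule surf_part_normals)
next
  case (3 N \<sigma> \<Omega> X X' \<phi> xq wq fc xf ws K \<Phi> k f l g x y)
  then show ?case by (blast intro: geo2_normals_opposite)
next
  case (4 N \<sigma> \<Omega> X X' \<phi> xq wq fc xf ws K \<Phi> i j)
  show ?case by (simp add: approx_geo2_def L2_norm_sq_def on_elem_def)
next
  case (5 N \<sigma> \<Omega> X X' \<phi> xq wq fc xf ws)
  then have X: "interpolation_nodes N X" and X': "interpolation_nodes (N + 1) X'" and \<Omega>: "open \<Omega>"
    and \<phi>: "poly_basis N \<phi>" and M: "pos_def (mass_mat \<phi> xq wq)" by auto
  have uni: "unisolvent N X" "unisolvent (N + 1) X'" using X X' by (auto simp: interpolation_nodes_def)
  obtain C where C: "\<forall>K \<Phi>. isoparametric_mesh N \<Omega> K \<Phi> \<and> quasi_uniform \<sigma> K \<Phi> \<longrightarrow>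
    (\<forall>i j. (\<Sum>k<K. L2_norm_sq (elem (\<Phi> k)) (on_elem (\<Phi> k) (\<lambda>x. geo (\<Phi> k) i j x - approx_geo3 N X X' (\<Phi> k) i j x)))
      \<le> C * measure lebesgue \<Omega> * mesh_size K \<Phi> ^ (2 * (N + 2)) *
        (\<Sum>i\<in>UNIV. \<Sum>k<K. sobolev_norm_sq (N + 2) (elem (\<Phi> k)) (on_elem (\<Phi> k) (geo_potential (\<Phi> k) i))))"
    using geometric_error_mesh[OF uni \<Omega>, of \<sigma>] by blast
  show ?case
  proof (intro exI[of _ C] conjI allI impI ballI, goal_cases)
    case (1 K \<Phi> k i)
    show ?case by (rule discrete_divergence_zero[OF \<phi> M approx_geo3_poly[OF uni(1)] approx_geo3_div[OF uni]])
  next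
    case (2 K \<Phi> k i)
    show ?case by (rule surf_part_normals)
  next
    case (3 K \<Phi> k f l g x y)
    then show ?case using approx_scaled_normals_opposite[OF X X'] by blast
  next
    case (4 K \<Phi> i j)
    then show ?case using C by blast
  qed
qed

end
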